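(* Let $k$ be a natural number and let $T$ be a theory in-between $\mathsf{HA}+\neg\neg\mathrm{LEM}(\Pi_{k-2})$ ($\mathsf{HA}$ if $k<2$) and $\mathsf{PA}$. The following are pairwise equivalent: (1) $\mathrm{PNFT}_T\big((\neg\mathrm{E}_{k'})^{\lor\text{-free}},\neg\neg\Pi_{k'}\big)$ for all $k'\le k$; (2) $\mathrm{PNFT}_T\big((\neg\neg\mathrm{U}_{k'})^{\lor\text{-free}},\neg\neg\Pi_{k'}\big)$ for all $k'\le k$; (3) $T\vdash\neg\neg\mathrm{DNE}(\Sigma_{k-1})$.
   Context: $\mathsf{HA}$ is intuitionistic (Heyting) arithmetic in the language with function symbols for all primitive recursive functions and logical constants $\forall,\exists,\to,\land,\lor,\perp$; $\neg\varphi$ abbreviates $\varphi\to\perp$. $\mathsf{PA}$ is $\mathsf{HA}$ plus the law of excluded middle for all formulas. $S+\mathrm{P}$ adds all instances of schema $\mathrm{P}$ to $S$. A theory $T$ is in-between $S$ and $S'$ if it is a theory in the language of $\mathsf{HA}$ whose theorems include those of $S$ and are included in those of $S'$. $T\vdash\mathrm{P}$ means every instance of $\mathrm{P}$ is provable in $T$; a principle indexed by a negative number is vacuous. $\mathrm{FV}(\varphi)$ is the set of free variables. $\Sigma_0=\Pi_0$ are the quantifier-free formulas; $\Pi_{k+1}$: formulas $Q_1\bar x_1\cdots Q_{k+1}\bar x_{k+1}\varphi_{qf}$ ($Q_i=\forall$ for odd $i$, $\exists$ for even $i$); $\Sigma_{k+1}$ likewise starting with $\exists$ (blocks may be empty by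 the paper's convention). $\Gamma(x)$: formulas in $\Gamma$ with free variables among $x$. $\mathrm{LEM}(\Gamma)$: $\forall x(\varphi(x)\lor\neg\varphi(x))$, $\varphi(x)\in\Gamma(x)$; $\mathrm{DNE}(\Gamma)$: $\forall x(\neg\neg\varphi(x)\to\varphi(x))$, $\varphi(x)\in\Gamma(x)$. For a principle $\mathrm{P}$ of these forms, $\neg\neg\mathrm{P}$ is the schema $\neg\neg\xi$ for $\xi$ an instance (a sentence) of $\mathrm{P}$. For a class $\Gamma$: $\neg\Gamma=\{\neg\varphi:\varphi\in\Gamma\}$, $\neg\neg\Gamma=\{\neg\neg\varphi:\varphi\in\Gamma\}$, and $\Gamma^{\lor\text{-free}}$ is the class of formulas in $\Gamma$ not containing $\lor$. $\mathrm{PNFT}_T(\Gamma,\Gamma')$: for every $\varphi\in\Gamma$ there is $\varphi'\in\Gamma'$ with $\mathrm{FV}(\varphi)=\mathrm{FV}(\varphi')$ and $T\vdash\varphi\leftrightarrow\varphi'$. Alternation paths: finite alternating sequences of $+,-$; $i(s)$ first symbol ($\times$ if empty), $s^\perp$ swaps signs, $l(s)$ length. $\mathrm{Alt}(\varphi)=\{\langle\rangle\}$ for quantifier-free $\varphi$; otherwise $\mathrm{Alt}(\neg\varphi_1)=\{s^\perp:s\in\mathrm{Alt}(\varphi_1)\}$, $\mathrm{Alt}(\varphi_1\land\varphi_2)=\mathrm{Alt}(\varphi_1\lor\varphi_2)=\mathrm{Alt}(\varphi_1)\cup\mathrm{Alt}(\varphi_2)$, $\mathrm{Alt}(\varphi_1\to\varphi_2)=\{s^\perp:s\in\mathrm{Alt}(\varphi_1)\}\cup\mathrm{Alt}(\varphi_2)$,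 $\mathrm{Alt}(\forall x\varphi_1)=\{s\in\mathrm{Alt}(\varphi_1):i(s)=-\}\cup\{-s:s\in\mathrm{Alt}(\varphi_1),i(s)\ne-\}$, $\mathrm{Alt}(\exists x\varphi_1)=\{s\in\mathrm{Alt}(\varphi_1):i(s)=+\}\cup\{+s:s\in\mathrm{Alt}(\varphi_1),i(s)\ne+\}$. $\deg\varphi=\max\{l(s):s\in\mathrm{Alt}(\varphi)\}$, $\mathrm{F}_k=\{\varphi:\deg\varphi=k\}$, $\mathrm{U}_0=\mathrm{E}_0=\mathrm{F}_0$, $\mathrm{U}_{k+1}=\{\varphi\in\mathrm{F}_{k+1}:i(s)=-$ for all $s\in\mathrm{Alt}(\varphi)$ with $l(s)=k+1\}$, $\mathrm{E}_{k+1}$ likewise with $+$. *)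

theory Defs
  imports Main
begin

subsection \<open>The language of arithmetic\<close>

text \<open>
  A function symbol is a pair of a primitive recursive code and an arity; the arity is the length
  of the argument list to which the code is applied in a term, so that every term is well formed.
  A code is meaningful at every arity (missing arguments count as 0, surplus ones are ignored),
  and every primitive recursive function of arity n is named by some code at arity n.
\<close>

datatype pr = Zr | Sc | Pj nat | Cn pr "pr list" | Rc pr pr

datatype trm = Var nat | Fn pr "trm list"

abbreviation zero :: trm where "zero \<equiv> Fn Zr []"
abbreviation suc :: "trm \<Rightarrow> trm" where "suc t \<equiv> Fn Sc [t]"

text \<open>Formulas use de Bruijn indices; \<open>FAll\<close> and \<open>FEx\<close> bind index 0 of their argument.\<close>

datatype fm =
    FEq trm trm
  | FBot
  | FImp fm fm
  | FAnd fm fm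
  | FOr fm fm
  | FAll fm
  | FEx fm

abbreviation FNeg :: "fm \<Rightarrow> fm" where "FNeg \<phi> \<equiv> FImp \<phi> FBot"
abbreviation FIff :: "fm \<Rightarrow> fm \<Rightarrow> fm" where "FIff \<phi> \<psi> \<equiv> FAnd (FImp \<phi> \<psi>) (FImp \<psi> \<phi>)"

primrec fv_trm :: "trm \<Rightarrow> nat set" where
  "fv_trm (Var n) = {n}"
| "fv_trm (Fn f ts) = \<Union> (set (map fv_trm ts))"

primrec FV :: "fm \<Rightarrow> nat set" where
  "FV (FEq s t) = fv_trm s \<union> fv_trm t"
| "FV FBot = {}"
| "FV (FImp \<phi> \<psi>) = FV \<phi> \<union> FV \<psi>"
| "FV (FAnd \<phi> \<psi>) = FV \<phi> \<union> FV \<psi>"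
| "FV (FOr \<phi> \<psi>) = FV \<phi> \<union> FV \<psi>"
| "FV (FAll \<phi>) = {n. Suc n \<in> FV \<phi>}"
| "FV (FEx \<phi>) = {n. Suc n \<in> FV \<phi>}"

primrec sub_trm :: "(nat \<Rightarrow> trm) \<Rightarrow> trm \<Rightarrow> trm" where
  "sub_trm \<sigma> (Var n) = \<sigma> n"
| "sub_trm \<sigma> (Fn f ts) = Fn f (map (sub_trm \<sigma>) ts)"

definition up :: "(nat \<Rightarrow> trm) \<Rightarrow> nat \<Rightarrow> trm" where
  "up \<sigma> = case_nat (Var 0) (\<lambda>n. sub_trm (\<lambda>m. Var (Suc m)) (\<sigma> n))"

primrec sub :: "(nat \<Rightarrow> trm) \<Rightarrow> fm \<Rightarrow> fm" where
  "sub \<sigma> (FEq s t) = FEq (sub_trm \<sigma> s) (sub_trm \<sigma> t)"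
| "sub \<sigma> FBot = FBot"
| "sub \<sigma> (FImp \<phi> \<psi>) = FImp (sub \<sigma> \<phi>) (sub \<sigma> \<psi>)"
| "sub \<sigma> (FAnd \<phi> \<psi>) = FAnd (sub \<sigma> \<phi>) (sub \<sigma> \<psi>)"
| "sub \<sigma> (FOr \<phi> \<psi>) = FOr (sub \<sigma> \<phi>) (sub \<sigma> \<psi>)"
| "sub \<sigma> (FAll \<phi>) = FAll (sub (up \<sigma>) \<phi>)"
| "sub \<sigma> (FEx \<phi>) = FEx (sub (up \<sigma>) \<phi>)"

definition lift :: "fm \<Rightarrow> fm" where
  "lift = sub (\<lambda>n. Var (Suc n))"

definition inst :: "fm \<Rightarrow> trm \<Rightarrow> fm" where
  "inst \<phi> t = sub (case_nat t Var) \<phi>"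

subsection \<open>Intuitionistic predicate logic with equality\<close>

text \<open>
  \<open>T\<close> is a set of axioms and \<open>\<Gamma>\<close> a set of local assumptions. Since \<open>T\<close> is not lifted in
  \<open>AllI\<close> and \<open>ExE\<close>, free variables of axioms are implicitly universally quantified.
\<close>

inductive prv :: "fm set \<Rightarrow> fm set \<Rightarrow> fm \<Rightarrow> bool" for T where
  Ax: "\<phi> \<in> T \<Longrightarrow> prv T \<Gamma> \<phi>"
| Hyp: "\<phi> \<in> \<Gamma> \<Longrightarrow> prv T \<Gamma> \<phi>"
| BotE: "prv T \<Gamma> FBot \<Longrightarrow> prv T \<Gamma> \<phi>"
| ImpI: "prv T (insert \<phi> \<Gamma>) \<psi> \<Longrightarrow> prv T \<Gamma> (FImp \<phi> \<psi>)"
| ImpE: "prv T \<Gamma> (FImp \<phi> \<psi>) \<Longrightarrow> prv T \<Gamma> \<phi> \<Longrightarrow> prv T \<Gamma> \<psi>"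
| AndI: "prv T \<Gamma> \<phi> \<Longrightarrow> prv T \<Gamma> \<psi> \<Longrightarrow> prv T \<Gamma> (FAnd \<phi> \<psi>)"
| AndE1: "prv T \<Gamma> (FAnd \<phi> \<psi>) \<Longrightarrow> prv T \<Gamma> \<phi>"
| AndE2: "prv T \<Gamma> (FAnd \<phi> \<psi>) \<Longrightarrow> prv T \<Gamma> \<psi>"
| OrI1: "prv T \<Gamma> \<phi> \<Longrightarrow> prv T \<Gamma> (FOr \<phi> \<psi>)"
| OrI2: "prv T \<Gamma> \<psi> \<Longrightarrow> prv T \<Gamma> (FOr \<phi> \<psi>)"
| OrE: "prv T \<Gamma> (FOr \<phi> \<psi>) \<Longrightarrow> prv T (insert \<phi> \<Gamma>) \<chi> \<Longrightarrow> prv T (insert \<psi> \<Gamma>) \<chi> \<Longrightarrow> prv T \<Gamma> \<chi>"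
| AllI: "prv T (lift ` \<Gamma>) \<phi> \<Longrightarrow> prv T \<Gamma> (FAll \<phi>)"
| AllE: "prv T \<Gamma> (FAll \<phi>) \<Longrightarrow> prv T \<Gamma> (inst \<phi> t)"
| ExI: "prv T \<Gamma> (inst \<phi> t) \<Longrightarrow> prv T \<Gamma> (FEx \<phi>)"
| ExE: "prv T \<Gamma> (FEx \<phi>) \<Longrightarrow> prv T (insert \<phi> (lift ` \<Gamma>)) (lift \<psi>) \<Longrightarrow> prv T \<Gamma> \<psi>"
| EqRefl: "prv T \<Gamma> (FEq t t)"
| EqSubst: "prv T \<Gamma> (FEq s t) \<Longrightarrow> prv T \<Gamma> (inst \<phi> s) \<Longrightarrow> prv T \<Gamma> (inst \<phi> t)"

definition theorems :: "fm set \<Rightarrow> fm set" where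
  "theorems T = {\<phi>. prv T {} \<phi>}"

definition in_between :: "fm set \<Rightarrow> fm set \<Rightarrow> fm set \<Rightarrow> bool" where
  "in_between S S' T \<longleftrightarrow> theorems S \<subseteq> theorems T \<and> theorems T \<subseteq> theorems S'"

text \<open>A principle is the set of its instances.\<close>

definition proves :: "fm set \<Rightarrow> fm set \<Rightarrow> bool" where
  "proves T P \<longleftrightarrow> P \<subseteq> theorems T"

subsection \<open>Heyting and Peano arithmetic\<close>

inductive_set HA :: "fm set" where
  Suc_neq_zero: "FNeg (FEq (suc t) zero) \<in> HA"
| Suc_inj: "FImp (FEq (suc s) (suc t)) (FEq s t) \<in> HA"
| Zr: "FEq (Fn Zr ts) zero \<in> HA"
| Sc_Nil: "FEq (Fn Sc []) (suc zero) \<in> HA"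
| Sc_Cons: "FEq (Fn Sc (t # ts)) (suc t) \<in> HA"
| Pj: "FEq (Fn (Pj i) ts) (if i < length ts then ts ! i else zero) \<in> HA"
| Cn: "FEq (Fn (Cn f gs) ts) (Fn f (map (\<lambda>g. Fn g ts) gs)) \<in> HA"
| Rc_Nil: "FEq (Fn (Rc f g) []) (Fn f []) \<in> HA"
| Rc_zero: "FEq (Fn (Rc f g) (zero # ts)) (Fn f ts) \<in> HA"
| Rc_suc: "FEq (Fn (Rc f g) (suc t # ts)) (Fn g (Fn (Rc f g) (t # ts) # t # ts)) \<in> HA"
| Induct: "FImp (inst \<phi> zero)
     (FImp (FAll (FImp \<phi> (sub (case_nat (suc (Var 0)) (\<lambda>n. Var (Suc n))) \<phi>))) (FAll \<phi>)) \<in> HA"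

definition PA :: "fm set" where
  "PA = HA \<union> {FOr \<phi> (FNeg \<phi>) | \<phi>. True}"

subsection \<open>Prenex classes and principles\<close>

primrec qf :: "fm \<Rightarrow> bool" where
  "qf (FEq s t) = True"
| "qf FBot = True"
| "qf (FImp \<phi> \<psi>) = (qf \<phi> \<and> qf \<psi>)"
| "qf (FAnd \<phi> \<psi>) = (qf \<phi> \<and> qf \<psi>)"
| "qf (FOr \<phi> \<psi>) = (qf \<phi> \<and> qf \<psi>)"
| "qf (FAll \<phi>) = False"
| "qf (FEx \<phi>) = False"

fun Sigma_cl :: "nat \<Rightarrow> fm set" and Pi_cl :: "nat \<Rightarrow> fm set" where
  "Sigma_cl 0 = {\<phi>. qf \<phi>}"
| "Sigma_cl (Suc k) = {(FEx ^^ n) \<phi> | n \<phi>. \<phi> \<in> Pi_cl k}"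
| "Pi_cl 0 = {\<phi>. qf \<phi>}"
| "Pi_cl (Suc k) = {(FAll ^^ n) \<phi> | n \<phi>. \<phi> \<in> Sigma_cl k}"

text \<open>In the schemas below the single variable x of \<open>\<phi>(x)\<close> is index 0.\<close>

definition LEM :: "fm set \<Rightarrow> fm set" where
  "LEM \<Gamma> = {FAll (FOr \<phi> (FNeg \<phi>)) | \<phi>. \<phi> \<in> \<Gamma> \<and> FV \<phi> \<subseteq> {0}}"

definition DNE :: "fm set \<Rightarrow> fm set" where
  "DNE \<Gamma> = {FAll (FImp (FNeg (FNeg \<phi>)) \<phi>) | \<phi>. \<phi> \<in> \<Gamma> \<and> FV \<phi> \<subseteq> {0}}"

text \<open>Principles with a negative index are vacuous, whence the integer indices.\<close>

definition LEM_Pi :: "int \<Rightarrow> fm set" where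
  "LEM_Pi i = (if i < 0 then {} else LEM (Pi_cl (nat i)))"

definition DNE_Sigma :: "int \<Rightarrow> fm set" where
  "DNE_Sigma i = (if i < 0 then {} else DNE (Sigma_cl (nat i)))"

text \<open>The following two operations apply both to classes of formulas and to principles.\<close>

definition neg :: "fm set \<Rightarrow> fm set" where
  "neg \<Gamma> = {FNeg \<phi> | \<phi>. \<phi> \<in> \<Gamma>}"

definition nneg :: "fm set \<Rightarrow> fm set" where
  "nneg \<Gamma> = {FNeg (FNeg \<phi>) | \<phi>. \<phi> \<in> \<Gamma>}"

primrec or_free :: "fm \<Rightarrow> bool" where
  "or_free (FEq s t) = True"
| "or_free FBot = True"
| "or_free (FImp \<phi> \<psi>) = (or_free \<phi> \<and> or_free \<psi>)"
| "or_free (FAnd \<phi> \<psi>) = (or_free \<phi> \<and> or_free \<psi>)"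
| "or_free (FOr \<phi> \<psi>) = False"
| "or_free (FAll \<phi>) = or_free \<phi>"
| "or_free (FEx \<phi>) = or_free \<phi>"

definition or_free_part :: "fm set \<Rightarrow> fm set" where
  "or_free_part \<Gamma> = {\<phi> \<in> \<Gamma>. or_free \<phi>}"

definition PNFT :: "fm set \<Rightarrow> fm set \<Rightarrow> fm set \<Rightarrow> bool" where
  "PNFT T \<Gamma> \<Gamma>' \<longleftrightarrow>
     (\<forall>\<phi>\<in>\<Gamma>. \<exists>\<phi>'\<in>\<Gamma>'. FV \<phi> = FV \<phi>' \<and> FIff \<phi> \<phi>' \<in> theorems T)"

subsection \<open>Alternation paths\<close>

datatype sign = Plus | Minus

primrec flip :: "sign \<Rightarrow> sign" where
  "flip Plus = Minus"
| "flip Minus = Plus"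

definition perp :: "sign list \<Rightarrow> sign list" where
  "perp s = map flip s"

text \<open>\<open>None\<close> stands for the symbol \<open>\<times>\<close> assigned to the empty path.\<close>

definition init_sign :: "sign list \<Rightarrow> sign option" where
  "init_sign s = (case s of [] \<Rightarrow> None | a # _ \<Rightarrow> Some a)"

text \<open>The clause for negation takes precedence over the one for implication.\<close>

primrec Alt :: "fm \<Rightarrow> sign list set" where
  "Alt (FEq s t) = {[]}"
| "Alt FBot = {[]}"
| "Alt (FImp \<phi> \<psi>) = (if \<psi> = FBot then perp ` Alt \<phi> else perp ` Alt \<phi> \<union> Alt \<psi>)"
| "Alt (FAnd \<phi> \<psi>) = Alt \<phi> \<union> Alt \<psi>"
| "Alt (FOr \<phi> \<psi>) = Alt \<phi> \<union> Alt \<psi>"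
| "Alt (FAll \<phi>) = {s \<in> Alt \<phi>. init_sign s = Some Minus}
     \<union> {Minus # s | s. s \<in> Alt \<phi> \<and> init_sign s \<noteq> Some Minus}"
| "Alt (FEx \<phi>) = {s \<in> Alt \<phi>. init_sign s = Some Plus}
     \<union> {Plus # s | s. s \<in> Alt \<phi> \<and> init_sign s \<noteq> Some Plus}"

lemma Alt_qf: "qf \<phi> \<Longrightarrow> Alt \<phi> = {[]}"
  by (induction \<phi>) (auto simp: perp_def)

definition deg :: "fm \<Rightarrow> nat" where
  "deg \<phi> = Max (length ` Alt \<phi>)"

definition F_cl :: "nat \<Rightarrow> fm set" where
  "F_cl k = {\<phi>. deg \<phi> = k}"

primrec U_cl :: "nat \<Rightarrow> fm set" where
  "U_cl 0 = F_cl 0"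
| "U_cl (Suc k) = {\<phi> \<in> F_cl (Suc k). \<forall>s\<in>Alt \<phi>. length s = Suc k \<longrightarrow> init_sign s = Some Minus}"

primrec E_cl :: "nat \<Rightarrow> fm set" where
  "E_cl 0 = F_cl 0"
| "E_cl (Suc k) = {\<phi> \<in> F_cl (Suc k). \<forall>s\<in>Alt \<phi>. length s = Suc k \<longrightarrow> init_sign s = Some Plus}"

end

theory Submission
  imports Defs "HOL-Library.Reflection"
begin

text \<open>
  Both implications rest on one translation, the negative translation with a formula \<open>A\<close> in place
  of \<open>\<bottom>\<close>, which sends theorems of \<open>PA\<close> to theorems of \<open>HA\<close>.

  Assume \<open>\<not>\<not>DNE(\<Sigma>\<^bsub>k-1\<^esub>)\<close>. Since the equivalence to be proved relates negated formulas, \<open>DNE(\<Sigma>\<^bsub>k-1\<^esub>)\<close>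
  itself may be used. It makes every \<open>\<or>\<close>-free formula of the class \<open>U\<^sub>k\<close>, and every \<open>\<Pi>\<^sub>k\<close> formula,
  equivalent to its translation with \<open>A = \<bottom>\<close>, so the classical prenex normal form is also a normal
  form in the theory.

  Conversely, let \<open>\<sigma>\<close> be \<open>\<Sigma>\<^bsub>m+1\<^esub>\<close>. The formula \<open>\<not>\<not>\<forall>x(\<not>\<not>\<sigma> \<rightarrow> \<sigma>)\<close> belongs to both classes, so it
  is equivalent to some \<open>\<not>\<not>\<pi>\<close> with \<open>\<pi>\<close> in \<open>\<Pi>\<^bsub>m+2\<^esub>\<close>, and \<open>PA\<close> proves \<open>\<pi>\<close>. Over \<open>HA + LEM(\<Sigma>\<^sub>m)\<close> the
  translation of a \<open>\<Sigma>\<^sub>m\<close> or \<open>\<Pi>\<^sub>m\<close> formula \<open>\<phi>\<close> is \<open>\<phi> \<or> A\<close>; taking for \<open>A\<close> the \<open>\<Sigma>\<^bsub>m+1\<^esub>\<close> matrix of \<open>\<pi>\<close>, as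
  in Friedman's argument for \<open>\<Pi>\<^sub>2\<close> conservation, shows that this theory proves \<open>\<pi>\<close>. The double
  negations of \<open>LEM(\<Sigma>\<^sub>m)\<close> follow from those of \<open>LEM(\<Pi>\<^sub>m)\<close> and of \<open>DNE(\<Sigma>\<^sub>m)\<close>, by induction on \<open>m\<close>.
\<close>

subsection \<open>Substitution and derivations\<close>

lemma sub_trm_cong: "(\<And>n. n \<in> fv_trm t \<Longrightarrow> \<sigma> n = \<tau> n) \<Longrightarrow> sub_trm \<sigma> t = sub_trm \<tau> t"
  by (induction t) auto

lemma sub_trm_Var [simp]: "sub_trm Var t = t"
  by (induction t) (auto intro: map_idI)

lemma sub_trm_sub_trm [simp]: "sub_trm \<sigma> (sub_trm \<tau> t) = sub_trm (\<lambda>n. sub_trm \<sigma> (\<tau> n)) t"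
  by (induction t) auto

lemma up_simps [simp]: "up \<sigma> 0 = Var 0" "up \<sigma> (Suc n) = sub_trm (\<lambda>m. Var (Suc m)) (\<sigma> n)"
  by (simp_all add: up_def)

lemma up_Var [simp]: "up Var = Var"
  by (rule ext) (simp add: up_def split: nat.split)

lemma up_comp [simp]: "(\<lambda>n. sub_trm (up \<sigma>) (up \<tau> n)) = up (\<lambda>n. sub_trm \<sigma> (\<tau> n))"
  by (rule ext) (simp add: up_def split: nat.split)

lemma sub_cong: "(\<And>n. n \<in> FV \<phi> \<Longrightarrow> \<sigma> n = \<tau> n) \<Longrightarrow> sub \<sigma> \<phi> = sub \<tau> \<phi>"
proof (induction \<phi> arbitrary: \<sigma> \<tau>)
  case (FEq s t)
  then show ?case using sub_trm_cong[of s \<sigma> \<tau>] sub_trm_cong[of t \<sigma> \<tau>] by simp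
next
  case (FAll \<phi>)
  have "up \<sigma> n = up \<tau> n" if "n \<in> FV \<phi>" for n
    using that FAll.prems by (cases n) auto
  then show ?case using FAll.IH[of "up \<sigma>" "up \<tau>"] by simp
next
  case (FEx \<phi>)
  have "up \<sigma> n = up \<tau> n" if "n \<in> FV \<phi>" for n
    using that FEx.prems by (cases n) auto
  then show ?case using FEx.IH[of "up \<sigma>" "up \<tau>"] by simp
next
  case (FImp \<phi> \<psi>)
  show ?case using FImp.IH[of \<sigma> \<tau>] FImp.prems by simp
next
  case (FAnd \<phi> \<psi>)
  show ?case using FAnd.IH[of \<sigma> \<tau>] FAnd.prems by simp
next
  case (FOr \<phi> \<psi>)
  show ?case using FOr.IH[of \<sigma> \<tau>] FOr.prems by simp
qed simp

lemma sub_Var [simp]: "sub Var \<phi> = \<phi>"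
  by (induction \<phi>) auto

lemma sub_sub [simp]: "sub \<sigma> (sub \<tau> \<phi>) = sub (\<lambda>n. sub_trm \<sigma> (\<tau> n)) \<phi>"
  by (induction \<phi> arbitrary: \<sigma> \<tau>) auto

lemma sub_closed: "FV \<phi> = {} \<Longrightarrow> sub \<sigma> \<phi> = \<phi>"
  using sub_cong[of \<phi> \<sigma> Var] by simp

lemma fv_sub_trm: "fv_trm (sub_trm \<sigma> t) = (\<Union>n\<in>fv_trm t. fv_trm (\<sigma> n))"
  by (induction t) auto

lemma FV_sub: "FV (sub \<sigma> \<phi>) = (\<Union>n\<in>FV \<phi>. fv_trm (\<sigma> n))"
proof -
  have bind: "{m. \<exists>n\<in>A. Suc m \<in> fv_trm (up \<sigma> n)} = (\<Union>n\<in>{n. Suc n \<in> A}. fv_trm (\<sigma> n))"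
    for A \<sigma>
  proof -
    have "Suc m \<in> fv_trm (up \<sigma> n) \<longleftrightarrow> (\<exists>n'. n = Suc n' \<and> m \<in> fv_trm (\<sigma> n'))" for m n
      by (cases n) (auto simp: fv_sub_trm)
    then show ?thesis by auto
  qed
  show ?thesis
    by (induction \<phi> arbitrary: \<sigma>) (simp_all add: fv_sub_trm bind)
qed

lemma FV_lift: "FV (lift \<phi>) = Suc ` FV \<phi>"
  by (auto simp: lift_def FV_sub)

lemma finite_fv_trm: "finite (fv_trm t)"
  by (induction t) auto

lemma finite_FV: "finite (FV \<phi>)"
proof -
  have "finite {n. Suc n \<in> A}" if "finite A" for A
    using finite_vimageI[OF that inj_Suc] by (simp add: vimage_def)
  then show ?thesis by (induction \<phi>) (simp_all add: finite_fv_trm)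
qed

lemma lift_simps [simp]:
  "lift FBot = FBot"
  "lift (FEq s t) = FEq (sub_trm (\<lambda>n. Var (Suc n)) s) (sub_trm (\<lambda>n. Var (Suc n)) t)"
  "lift (FImp \<phi> \<psi>) = FImp (lift \<phi>) (lift \<psi>)"
  "lift (FAnd \<phi> \<psi>) = FAnd (lift \<phi>) (lift \<psi>)"
  "lift (FOr \<phi> \<psi>) = FOr (lift \<phi>) (lift \<psi>)"
  by (simp_all add: lift_def)

lemma inst_simps [simp]:
  "inst FBot t = FBot"
  "inst (FEq s u) t = FEq (sub_trm (case_nat t Var) s) (sub_trm (case_nat t Var) u)"
  "inst (FImp \<phi> \<psi>) t = FImp (inst \<phi> t) (inst \<psi> t)"
  "inst (FAnd \<phi> \<psi>) t = FAnd (inst \<phi> t) (inst \<psi> t)"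
  "inst (FOr \<phi> \<psi>) t = FOr (inst \<phi> t) (inst \<psi> t)"
  by (simp_all add: inst_def)

lemma sub_lift: "sub (up \<sigma>) (lift \<phi>) = lift (sub \<sigma> \<phi>)"
  by (simp add: lift_def)

lemma inst_lift [simp]: "inst (lift \<phi>) t = \<phi>"
  by (simp add: lift_def inst_def)

lemma inst_sub_up: "inst (sub (up \<sigma>) \<phi>) t = sub (case_nat t \<sigma>) \<phi>"
proof -
  have "(\<lambda>n. sub_trm (case_nat t Var) (up \<sigma> n)) = case_nat t \<sigma>"
    by (rule ext) (simp add: up_def split: nat.split)
  then show ?thesis by (simp add: inst_def)
qed

lemma case_nat_Var_Suc [simp]: "case_nat (Var 0) (\<lambda>n. Var (Suc n)) = Var"
  by (rule ext) (simp split: nat.split)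

section \<open>Structural rules for derivations\<close>

lemma prv_mono: "prv T \<Gamma> \<phi> \<Longrightarrow> \<Gamma> \<subseteq> \<Delta> \<Longrightarrow> prv T \<Delta> \<phi>"
proof (induction arbitrary: \<Delta> rule: prv.induct)
  case (ImpI \<phi> \<Gamma> \<psi>)
  then show ?case by (meson insert_mono prv.ImpI)
next
  case (OrE \<Gamma> \<phi> \<psi> \<chi>)
  then show ?case by (meson insert_mono prv.OrE)
next
  case (AllI \<Gamma> \<phi>)
  then show ?case by (meson image_mono prv.AllI)
next
  case (ExE \<Gamma> \<phi> \<psi>)
  then show ?case by (meson image_mono insert_mono prv.ExE)
next
  case (EqSubst \<Gamma> s t \<phi>)
  then show ?case by (metis prv.EqSubst)
qed (auto intro: prv.Ax prv.Hyp prv.BotE prv.ImpE prv.AndI prv.AndE1 prv.AndE2 prv.OrI1 prv.OrI2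
    prv.AllE prv.ExI prv.EqRefl)

lemma prv_theory_mono:
  "prv S \<Gamma> \<phi> \<Longrightarrow> (\<And>\<chi>. \<chi> \<in> S \<Longrightarrow> prv T {} \<chi>) \<Longrightarrow> prv T \<Gamma> \<phi>"
proof (induction rule: prv.induct)
  case (Ax \<phi> \<Gamma>)
  then show ?case using prv_mono by blast
next
  case (EqSubst \<Gamma> s t \<phi>)
  then show ?case by (metis prv.EqSubst)
next
  case (OrE \<Gamma> \<phi> \<psi> \<chi>)
  then show ?case by (metis prv.OrE)
next
  case (ExE \<Gamma> \<phi> \<psi>)
  then show ?case by (metis prv.ExE)
qed (auto intro: prv.Hyp prv.BotE prv.ImpI prv.ImpE prv.AndI prv.AndE1 prv.AndE2 prv.OrI1 prv.OrI2
    prv.AllI prv.AllE prv.ExI prv.EqRefl)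

lemma prv_cut: "prv T \<Gamma> \<phi> \<Longrightarrow> prv T (insert \<phi> \<Gamma>) \<psi> \<Longrightarrow> prv T \<Gamma> \<psi>"
  by (rule ImpE[OF ImpI])

text \<open>After \<open>AllI\<close> the context is lifted. Instantiating a lifted universal
  assumption at the fresh variable \<open>Var 0\<close> gives back its matrix verbatim.\<close>

lemma prv_lift_AllE: "prv T \<Gamma> (lift (FAll \<phi>)) \<Longrightarrow> prv T \<Gamma> \<phi>"
  using AllE[of T \<Gamma> "sub (up (\<lambda>n. Var (Suc n))) \<phi>" "Var 0"]
  by (simp add: lift_def inst_sub_up)

lemma prv_lift_ExI: "prv T \<Gamma> \<phi> \<Longrightarrow> prv T \<Gamma> (lift (FEx \<phi>))"
  using ExI[of T \<Gamma> "sub (up (\<lambda>n. Var (Suc n))) \<phi>" "Var 0"]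
  by (simp add: lift_def inst_sub_up)

text \<open>Free variables of axioms are implicitly quantified, so theorems are closed under
  substitution for every axiom set: quantify all variables and instantiate them again.\<close>

lemma prv_sub:
  assumes "prv T {} \<phi>"
  shows "prv T {} (sub \<sigma> \<phi>)"
proof -
  have "FV \<phi> \<subseteq> {..<N} \<Longrightarrow> prv T {} \<phi> \<Longrightarrow> prv T {} (sub \<sigma> \<phi>)" for N \<phi> \<sigma>
  proof (induction N arbitrary: \<phi> \<sigma>)
    case 0
    then show ?case by (simp add: sub_closed)
  next
    case (Suc N)
    have "FV (FAll \<phi>) \<subseteq> {..<N}" using Suc.prems(1) by auto
    moreover have "prv T {} (FAll \<phi>)" using Suc.prems(2) by (auto intro: AllI)
    ultimately have "prv T {} (sub (\<lambda>n. \<sigma> (Suc n)) (FAll \<phi>))" by (rule Suc.IH)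
    then have "prv T {} (inst (sub (up (\<lambda>n. \<sigma> (Suc n))) \<phi>) (\<sigma> 0))"
      by (simp add: AllE)
    moreover have "case_nat (\<sigma> 0) (\<lambda>n. \<sigma> (Suc n)) = \<sigma>"
      by (rule ext) (simp split: nat.split)
    ultimately show ?case by (simp add: inst_sub_up)
  qed
  moreover obtain N where "FV \<phi> \<subseteq> {..<N}"
    using finite_nat_set_iff_bounded[of "FV \<phi>"] finite_FV[of \<phi>] by auto
  ultimately show ?thesis using assms by blast
qed

lemma prv_FAll_iff: "prv T {} (FAll \<phi>) \<longleftrightarrow> prv T {} \<phi>"
  using prv_sub[of T "FAll \<phi>" "\<lambda>n. Var (Suc n)"] prv_lift_AllE[of T "{}" \<phi>] AllI[of T "{}" \<phi>]
  by (metis image_empty lift_def)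

lemma prv_And_iff: "prv T \<Gamma> (FAnd a b) \<longleftrightarrow> prv T \<Gamma> a \<and> prv T \<Gamma> b"
  by (metis AndI AndE1 AndE2)

lemma prv_All_mono: "prv T (insert \<phi> (lift ` \<Gamma>)) \<psi> \<Longrightarrow> prv T (insert (FAll \<phi>) \<Gamma>) (FAll \<psi>)"
proof (rule AllI)
  assume *: "prv T (insert \<phi> (lift ` \<Gamma>)) \<psi>"
  have "prv T (lift ` insert (FAll \<phi>) \<Gamma>) \<phi>" by (rule prv_lift_AllE) (simp add: Hyp)
  then show "prv T (lift ` insert (FAll \<phi>) \<Gamma>) \<psi>"
    by (rule prv_cut) (rule prv_mono[OF *], auto)
qed

lemma prv_Ex_mono: "prv T (insert \<phi> (lift ` \<Gamma>)) \<psi> \<Longrightarrow> prv T (insert (FEx \<phi>) \<Gamma>) (FEx \<psi>)"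
proof (rule ExE[of _ _ \<phi>])
  assume *: "prv T (insert \<phi> (lift ` \<Gamma>)) \<psi>"
  show "prv T (insert \<phi> (lift ` insert (FEx \<phi>) \<Gamma>)) (lift (FEx \<psi>))"
    by (rule prv_lift_ExI) (rule prv_mono[OF *], auto)
qed (simp add: Hyp)

subsection \<open>Deciding intuitionistic propositional logic\<close>

text \<open>Propositional skeletons: later proofs turn a goal about \<open>prv\<close> into
  \<open>prv_den\<close> of a skeleton by reflection, with quantified formulas and translations as
  atoms, and close it by running \<open>ipc\<close>.\<close>

datatype pf = PAt nat | PBot | PImp pf pf | PAnd pf pf | POr pf pf

primrec den :: "pf \<Rightarrow> fm list \<Rightarrow> fm" where
  "den (PAt n) vs = vs ! n"
| "den PBot vs = FBot"
| "den (PImp p q) vs = FImp (den p vs) (den q vs)"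
| "den (PAnd p q) vs = FAnd (den p vs) (den q vs)"
| "den (POr p q) vs = FOr (den p vs) (den q vs)"

text \<open>The method \<open>reify\<close> expects the environment as last argument of an interpretation.\<close>

definition prv_den :: "fm set \<Rightarrow> fm set \<Rightarrow> pf \<Rightarrow> fm list \<Rightarrow> bool" where
  "prv_den T \<Gamma> p vs = prv T \<Gamma> (den p vs)"

text \<open>Dyckhoff's contraction-free calculus, with fuel. In \<open>ipc n ps qs r\<close> the assumptions \<open>ps\<close> are
  still to be decomposed; \<open>qs\<close> holds atoms and implications with an atom or an implication on
  the left.\<close>

definition nested_imp_step :: "(pf list \<Rightarrow> pf list \<Rightarrow> pf \<Rightarrow> bool) \<Rightarrow> pf list \<Rightarrow> pf \<Rightarrow> bool" where
  "nested_imp_step f qs r = list_ex (\<lambda>q. case q of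
       PImp (PImp a b) c \<Rightarrow>
         if f [PImp b c, a] (removeAll q qs) b then f [c] (removeAll q qs) r else False
     | _ \<Rightarrow> False) qs"

primrec ipc :: "nat \<Rightarrow> pf list \<Rightarrow> pf list \<Rightarrow> pf \<Rightarrow> bool" where
  "ipc 0 ps qs r = False"
| "ipc (Suc n) ps qs r =
    (case ps of
      p # ps \<Rightarrow>
       (case p of
          PAt i \<Rightarrow> ipc n ps (p # qs) r
        | PBot \<Rightarrow> True
        | PAnd a b \<Rightarrow> ipc n (a # b # ps) qs r
        | POr a b \<Rightarrow> if ipc n (a # ps) qs r then ipc n (b # ps) qs r else False
        | PImp a c \<Rightarrow>
           (case a of
              PAt i \<Rightarrow> ipc n ps (p # qs) r
            | PBot \<Rightarrow> ipc n ps qs r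
            | PAnd a b \<Rightarrow> ipc n (PImp a (PImp b c) # ps) qs r
            | POr a b \<Rightarrow> ipc n (PImp a c # PImp b c # ps) qs r
            | PImp a b \<Rightarrow> ipc n ps (p # qs) r))
    | [] \<Rightarrow>
       (case r of
          PImp a b \<Rightarrow> ipc n [a] qs b
        | PAnd a b \<Rightarrow> if ipc n [] qs a then ipc n [] qs b else False
        | _ \<Rightarrow>
           if r \<in> set qs then True else
           (case find (\<lambda>q. case q of PImp (PAt i) c \<Rightarrow> PAt i \<in> set qs | _ \<Rightarrow> False) qs of
              Some q \<Rightarrow> (case q of PImp a c \<Rightarrow> ipc n [c] (removeAll q qs) r | _ \<Rightarrow> False)
            | None \<Rightarrow>
               if (case r of POr a b \<Rightarrow> if ipc n [] qs a then True else ipc n [] qs b | _ \<Rightarrow> False)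
               then True else nested_imp_step (ipc n) qs r)))"

text \<open>Each clause of \<open>ipc\<close> mirrors a derivation, so exhausted fuel can lose
  proofs but not correctness. \<open>\<Gamma>\<close> varies in the induction because disjunctions
  on the left and implications on the right extend it.\<close>

lemma ipc_sound:
  "ipc n ps qs r \<Longrightarrow> (\<And>p. p \<in> set ps \<union> set qs \<Longrightarrow> prv T \<Gamma> (den p vs)) \<Longrightarrow> prv T \<Gamma> (den r vs)"
proof (induction n arbitrary: ps qs r \<Gamma>)
  case 0
  then show ?case by simp
next
  case (Suc n)
  note IH = Suc.IH and hyp = Suc.prems(2)
  have mono: "prv T (insert \<phi> \<Gamma>) (den p vs)" if "prv T \<Gamma> (den p vs)" for \<phi> p
    using that prv_mono by blast
  have curry: "prv T \<Gamma> (FImp a (FImp b c))" if "prv T \<Gamma> (FImp (FAnd a b) c)" for a b c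
    by (intro ImpI, rule ImpE[OF prv_mono[OF that]]) (auto intro: AndI Hyp)
  have dj1: "prv T \<Gamma> (FImp a c)" if "prv T \<Gamma> (FImp (FOr a b) c)" for a b c
    by (intro ImpI, rule ImpE[OF prv_mono[OF that]]) (auto intro: OrI1 Hyp)
  have dj2: "prv T \<Gamma> (FImp b c)" if "prv T \<Gamma> (FImp (FOr a b) c)" for a b c
    by (intro ImpI, rule ImpE[OF prv_mono[OF that]]) (auto intro: OrI2 Hyp)
  \<comment> \<open>While \<open>a \<longrightarrow> b\<close> is being proved, only
    \<open>b \<longrightarrow> c\<close> is kept of
    \<open>(a \<longrightarrow> b) \<longrightarrow> c\<close>; this is how contraction is
    avoided.\<close>
  have nest: "prv T \<Gamma> (FImp b c)" if "prv T \<Gamma> (FImp (FImp a b) c)" for a b c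
    by (intro ImpI, rule ImpE[OF prv_mono[OF that]]) (auto intro: ImpI Hyp)
  show ?case
  proof (cases ps)
    case (Cons p ps')
    have p: "prv T \<Gamma> (den p vs)" and hyp': "\<And>q. q \<in> set ps' \<union> set qs \<Longrightarrow> prv T \<Gamma> (den q vs)"
      using hyp Cons by auto
    show ?thesis
    proof (cases p)
      case (PAt i)
      then have "ipc n ps' (p # qs) r" using Suc.prems(1) Cons by simp
      then show ?thesis by (rule IH) (use p hyp' in auto)
    next
      case PBot
      then show ?thesis using BotE[of T \<Gamma>] p by simp
    next
      case (PAnd a b)
      then have *: "ipc n (a # b # ps') qs r" using Suc.prems(1) Cons by simp
      have "prv T \<Gamma> (den a vs)" "prv T \<Gamma> (den b vs)"
        using p PAnd AndE1[of T \<Gamma> "den a vs" "den b vs"] AndE2[of T \<Gamma> "den a vs" "den b vs"] by auto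
      then show ?thesis using hyp' by (intro IH[OF *]) auto
    next
      case (POr a b)
      then have *: "ipc n (a # ps') qs r" "ipc n (b # ps') qs r"
        using Suc.prems(1) Cons by (auto split: if_splits)
      have "prv T (insert (den a vs) \<Gamma>) (den r vs)"
        by (rule IH[OF *(1)]) (use hyp' mono in \<open>auto intro: Hyp\<close>)
      moreover have "prv T (insert (den b vs) \<Gamma>) (den r vs)"
        by (rule IH[OF *(2)]) (use hyp' mono in \<open>auto intro: Hyp\<close>)
      ultimately show ?thesis using p POr OrE[of T \<Gamma> "den a vs" "den b vs"] by simp
    next
      case (PImp a c)
      show ?thesis
      proof (cases a)
        case (PAt i)
        then have "ipc n ps' (p # qs) r" using Suc.prems(1) Cons PImp by simp
        then show ?thesis by (rule IH) (use p hyp' in auto)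
      next
        case PBot
        then have "ipc n ps' qs r" using Suc.prems(1) Cons PImp by simp
        then show ?thesis by (rule IH) (use hyp' in auto)
      next
        case (PAnd a' b)
        then have "ipc n (PImp a' (PImp b c) # ps') qs r" using Suc.prems(1) Cons PImp by simp
        then show ?thesis by (rule IH) (use p hyp' PAnd PImp curry[of "den a' vs"] in auto)
      next
        case (POr a' b)
        then have "ipc n (PImp a' c # PImp b c # ps') qs r" using Suc.prems(1) Cons PImp by simp
        then show ?thesis by (rule IH) (use p hyp' POr PImp dj1[of "den a' vs"] dj2[of "den a' vs"] in auto)
      next
        case (PImp a' b)
        then have "ipc n ps' (p # qs) r" using Suc.prems(1) Cons \<open>p = PImp a c\<close> by simp
        then show ?thesis by (rule IH) (use p hyp' in auto)
      qed
    qed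
  next
    case Nil
    have hyp': "\<And>q. q \<in> set qs \<Longrightarrow> prv T \<Gamma> (den q vs)" using hyp by auto
    have step: "prv T \<Gamma> (den r vs)" if "ipc n [c] (removeAll q qs) r" "prv T \<Gamma> (den c vs)" for c q
      by (rule IH[OF that(1)]) (use that(2) hyp' in auto)
    have one: "prv T \<Gamma> (den r vs)" if "ipc n [] qs r" for r
      by (rule IH[OF that]) (use hyp' in auto)
    show ?thesis
    proof (cases "\<exists>a b. r = PImp a b \<or> r = PAnd a b")
      case True
      then obtain a b where "r = PImp a b \<or> r = PAnd a b" by blast
      then show ?thesis
      proof
        assume r: "r = PImp a b"
        then have *: "ipc n [a] qs b" using Suc.prems(1) Nil by simp
        have "prv T (insert (den a vs) \<Gamma>) (den b vs)"
          by (rule IH[OF *]) (use hyp' mono in \<open>auto intro: Hyp\<close>)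
        then show ?thesis using r by (simp add: ImpI)
      next
        assume r: "r = PAnd a b"
        then have "ipc n [] qs a" "ipc n [] qs b" using Suc.prems(1) Nil by (auto split: if_splits)
        then show ?thesis using r one by (simp add: AndI)
      qed
    next
      case False
      let ?f = "find (\<lambda>q. case q of PImp (PAt i) c \<Rightarrow> PAt i \<in> set qs | _ \<Rightarrow> False) qs"
      consider (hyp) "r \<in> set qs"
        | (atom) q where "?f = Some q" "case q of PImp a c \<Rightarrow> ipc n [c] (removeAll q qs) r | _ \<Rightarrow> False"
        | (disj) a b where "r = POr a b" "ipc n [] qs a \<or> ipc n [] qs b"
        | (imp) "nested_imp_step (ipc n) qs r"
        using Suc.prems(1) Nil False
        by (cases r; cases ?f; simp split: if_split_asm; blast)
      then show ?thesis
      proof cases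
        case hyp
        then show ?thesis using hyp' by blast
      next
        case atom
        from atom(1) have "q \<in> set qs" "case q of PImp (PAt i) c \<Rightarrow> PAt i \<in> set qs | _ \<Rightarrow> False"
          by (auto simp: find_Some_iff)
        then obtain i c where q: "q = PImp (PAt i) c" "PAt i \<in> set qs" "q \<in> set qs"
          by (auto split: pf.split_asm)
        then have "prv T \<Gamma> (den c vs)" using hyp'[of q] hyp'[of "PAt i"] ImpE[of T \<Gamma> "den (PAt i) vs"] by simp
        then show ?thesis using atom(2) q step by auto
      next
        case disj
        then show ?thesis using one[of a] one[of b] OrI1[of T \<Gamma> "den a vs"] OrI2[of T \<Gamma> "den b vs"] by auto
      next
        case imp
        then obtain q where q0: "q \<in> set qs" and q': "case q of
             PImp (PImp a b) c \<Rightarrow>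
               if ipc n [PImp b c, a] (removeAll q qs) b then ipc n [c] (removeAll q qs) r else False
           | _ \<Rightarrow> False"
          unfolding nested_imp_step_def list_ex_iff by blast
        obtain p' c where "q = PImp p' c" using q' by (cases q) auto
        moreover obtain a b where "p' = PImp a b" using q' calculation by (cases p') auto
        ultimately have q: "q \<in> set qs" "q = PImp (PImp a b) c"
          "ipc n [PImp b c, a] (removeAll q qs) b" "ipc n [c] (removeAll q qs) r"
          using q0 q' by (auto split: if_split_asm)
        have abc: "prv T \<Gamma> (FImp (FImp (den a vs) (den b vs)) (den c vs))"
          using hyp'[OF q(1)] q(2) by simp
        have bc: "prv T \<Gamma> (den (PImp b c) vs)" using nest[OF abc] by simp
        have "prv T (insert (den a vs) \<Gamma>) (den b vs)"
          by (rule IH[OF q(3)]) (use hyp' mono mono[OF bc] in \<open>auto intro: Hyp\<close>)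
        then have "prv T \<Gamma> (den c vs)" by (intro ImpE[OF abc] ImpI)
        then show ?thesis using step q(4) by blast
      qed
    qed
  qed
qed

text \<open>Fuel 40 is enough for all propositional goals below; the premise is evaluated by
  \<open>code_simp\<close>.\<close>

lemma ipc_prv: "ipc 40 [] [] p \<Longrightarrow> prv_den T \<Gamma> p vs"
  unfolding prv_den_def by (rule ipc_sound) auto

lemmas ipc_eqs = den.simps prv_den_def

lemma prv_mp1: "prv T \<Gamma> a \<Longrightarrow> prv T \<Gamma> (FImp a c) \<Longrightarrow> prv T \<Gamma> c"
  by (rule ImpE)

lemma prv_mp2: "prv T \<Gamma> a \<Longrightarrow> prv T \<Gamma> b \<Longrightarrow> prv T \<Gamma> (FImp a (FImp b c)) \<Longrightarrow> prv T \<Gamma> c"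
  by (rule ImpE[OF ImpE])

lemma prv_mp3:
  "prv T \<Gamma> a \<Longrightarrow> prv T \<Gamma> b \<Longrightarrow> prv T \<Gamma> c \<Longrightarrow> prv T \<Gamma> (FImp a (FImp b (FImp c d))) \<Longrightarrow> prv T \<Gamma> d"
  by (rule ImpE[OF ImpE[OF ImpE]])

subsection \<open>Negative translation with a parameter\<close>

abbreviation nn :: "fm \<Rightarrow> fm \<Rightarrow> fm" where "nn A \<phi> \<equiv> FImp (FImp \<phi> A) A"

text \<open>The Goedel--Gentzen translation with \<open>A\<close> in place of \<open>\<bottom>\<close>: for \<open>A = \<bottom>\<close> it is the usual one,
  and for other \<open>A\<close> it also performs Friedman's A-translation.\<close>

primrec tr :: "fm \<Rightarrow> fm \<Rightarrow> fm" where
  "tr (FEq s t) A = nn A (FEq s t)"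
| "tr FBot A = A"
| "tr (FImp \<phi> \<psi>) A = FImp (tr \<phi> A) (tr \<psi> A)"
| "tr (FAnd \<phi> \<psi>) A = FAnd (tr \<phi> A) (tr \<psi> A)"
| "tr (FOr \<phi> \<psi>) A = nn A (FOr (tr \<phi> A) (tr \<psi> A))"
| "tr (FAll \<phi>) A = FAll (tr \<phi> (lift A))"
| "tr (FEx \<phi>) A = nn A (FEx (tr \<phi> (lift A)))"

lemma sub_tr: "sub \<sigma> (tr \<phi> A) = tr (sub \<sigma> \<phi>) (sub \<sigma> A)"
  by (induction \<phi> arbitrary: \<sigma> A) (simp_all add: sub_lift)

lemma lift_tr: "lift (tr \<phi> A) = tr (lift \<phi>) (lift A)"
  by (simp only: lift_def sub_tr)

lemma inst_tr: "tr (inst \<phi> t) A = inst (tr \<phi> (lift A)) t"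
  using inst_lift[of A t] by (simp add: inst_def sub_tr)

text \<open>Triple implication into \<open>A\<close> collapses to a single one, which settles atoms,
  \<open>\<or>\<close> and \<open>\<exists>\<close>. Implication inherits stability from its
  conclusion, \<open>\<and>\<close> and \<open>\<forall>\<close> from their components.\<close>

lemma nn_stable: "prv T \<Gamma> (FImp (nn A (tr \<phi> A)) (tr \<phi> A))"
proof (induction \<phi> arbitrary: \<Gamma> A)
  case (FEq s t)
  show ?case unfolding tr.simps by (reify ipc_eqs) (rule ipc_prv, code_simp)
next
  case FBot
  show ?case unfolding tr.simps by (reify ipc_eqs) (rule ipc_prv, code_simp)
next
  case (FImp \<phi> \<psi>)
  show ?case unfolding tr.simps
    by (rule ImpE[OF _ FImp.IH(2)[of \<Gamma> A]], reify ipc_eqs) (rule ipc_prv, code_simp)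
next
  case (FAnd \<phi> \<psi>)
  show ?case unfolding tr.simps
    by (rule ImpE[OF ImpE[OF _ FAnd.IH(1)[of \<Gamma> A]] FAnd.IH(2)[of \<Gamma> A]], reify ipc_eqs)
      (rule ipc_prv, code_simp)
next
  case (FOr \<phi> \<psi>)
  show ?case unfolding tr.simps by (reify ipc_eqs) (rule ipc_prv, code_simp)
next
  case (FEx \<phi>)
  show ?case unfolding tr.simps by (reify ipc_eqs) (rule ipc_prv, code_simp)
next
  case (FAll \<phi>)
  let ?\<Gamma> = "lift ` insert (nn A (tr (FAll \<phi>) A)) \<Gamma>"
  \<comment> \<open>The universal formula implies each instance, so its double negation relative to
    \<open>A\<close> implies that of the instance, to which the induction hypothesis
    applies.\<close>
  have *: "prv T ?\<Gamma> (FImp (lift (tr (FAll \<phi>) A)) (tr \<phi> (lift A)))"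
    by (rule ImpI, rule prv_lift_AllE) (simp add: Hyp)
  have **: "prv T ?\<Gamma> (nn (lift A) (lift (tr (FAll \<phi>) A)))" by (simp add: Hyp)
  have "prv T ?\<Gamma> (tr \<phi> (lift A))"
    by (rule ImpE[OF ImpE[OF ImpE[OF _ *] **] FAll.IH[of ?\<Gamma> "lift A"]], reify ipc_eqs)
      (rule ipc_prv, code_simp)
  then show ?case unfolding tr.simps by (intro ImpI AllI)
qed

text \<open>Stability of the goal lets a relative double negation among the premises be stripped.
  This handles eliminations of \<open>\<or>\<close>, \<open>\<exists>\<close> and equality, whose
  major premises are translated with \<open>nn A\<close>.\<close>

lemma nn_elim:
  assumes "prv T \<Gamma> (nn A \<psi>)" "prv T (insert \<psi> \<Gamma>) (tr \<phi> A)"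
  shows "prv T \<Gamma> (tr \<phi> A)"
  by (rule ImpE[OF ImpE[OF ImpE[OF _ assms(1)] ImpI[OF assms(2)]] nn_stable[where A = A and \<phi> = \<phi>]],
      reify ipc_eqs) (rule ipc_prv, code_simp)

lemma nn_intro:
  assumes "prv T \<Gamma> \<phi>"
  shows "prv T \<Gamma> (nn A \<phi>)"
  by (rule ImpE[OF _ assms(1)], reify ipc_eqs) (rule ipc_prv, code_simp)

lemma tr_efq: "prv T \<Gamma> A \<Longrightarrow> prv T \<Gamma> (tr \<phi> A)"
  using ImpE[OF nn_stable] ImpI prv_mono by (metis subset_insertI)

text \<open>Equations survive under \<open>nn A\<close>, and induction for \<open>\<phi>\<close>
  becomes induction for its translation, since the lifted \<open>A\<close> does not contain the
  induction variable.\<close>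

lemma tr_HA:
  assumes "\<chi> \<in> HA"
  shows "prv HA {} (tr \<chi> A)"
  using assms
proof cases
  case (Suc_neq_zero t)
  show ?thesis unfolding Suc_neq_zero tr.simps
    by (rule ImpE[OF _ Ax[OF assms[unfolded Suc_neq_zero]]], reify ipc_eqs)
      (rule ipc_prv, code_simp)
next
  case (Suc_inj s t)
  show ?thesis unfolding Suc_inj tr.simps
    by (rule ImpE[OF _ Ax[OF assms[unfolded Suc_inj]]], reify ipc_eqs)
      (rule ipc_prv, code_simp)
next
  case (Induct \<phi>)
  let ?s = "case_nat (suc (Var 0)) (\<lambda>n. Var (Suc n))"
  have "sub ?s (lift A) = lift A" by (simp add: lift_def)
  then have "tr \<chi> A = FImp (inst (tr \<phi> (lift A)) zero)
     (FImp (FAll (FImp (tr \<phi> (lift A)) (sub ?s (tr \<phi> (lift A))))) (FAll (tr \<phi> (lift A))))"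
    unfolding Induct by (simp add: sub_tr inst_tr)
  then show ?thesis by (simp add: Ax HA.Induct)
qed (use Ax[OF assms] nn_intro in simp)+

text \<open>Excluded middle translates into an intuitionistically valid formula, and elimination
  rules go through by stability. \<open>A\<close> is generalised because the rules for bound
  variables lift it.\<close>

theorem tr_PA:
  assumes "prv PA \<Gamma> \<phi>"
  shows "prv HA ((\<lambda>\<chi>. tr \<chi> A) ` \<Gamma>) (tr \<phi> A)"
  using assms
proof (induction arbitrary: A rule: prv.induct)
  case (Ax \<phi> \<Gamma>)
  show ?case
  proof (cases "\<phi> \<in> HA")
    case True
    then show ?thesis using tr_HA prv_mono by blast
  next
    case False
    then obtain \<psi> where "\<phi> = FOr \<psi> (FNeg \<psi>)" using Ax by (auto simp: PA_def)
    then show ?thesis by (simp only: tr.simps) (reify ipc_eqs, rule ipc_prv, code_simp)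
  qed
next
  case (BotE \<Gamma> \<phi>)
  then show ?case using tr_efq by simp
next
  case (OrE \<Gamma> \<phi> \<psi> \<chi>)
  let ?\<Gamma> = "(\<lambda>\<chi>. tr \<chi> A) ` \<Gamma>"
  have "prv HA (insert (FOr (tr \<phi> A) (tr \<psi> A)) ?\<Gamma>) (tr \<chi> A)"
  proof (rule prv.OrE)
    show "prv HA (insert (FOr (tr \<phi> A) (tr \<psi> A)) ?\<Gamma>) (FOr (tr \<phi> A) (tr \<psi> A))"
      by (simp add: Hyp)
  qed (rule prv_mono[OF OrE.IH(2)[of A]], force, rule prv_mono[OF OrE.IH(3)[of A]], force)
  then show ?case using OrE.IH(1)[of A] by (auto intro: nn_elim)
next
  case (AllI \<Gamma> \<phi>)
  then show ?case by (auto simp: image_image lift_tr intro: prv.AllI)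
next
  case (AllE \<Gamma> \<phi> t)
  then show ?case by (auto simp: inst_tr intro: prv.AllE)
next
  case (ExI \<Gamma> \<phi> t)
  have "prv HA ((\<lambda>\<chi>. tr \<chi> A) ` \<Gamma>) (FEx (tr \<phi> (lift A)))"
    using ExI.IH[of A] by (auto simp: inst_tr intro: prv.ExI)
  then show ?case by (simp add: nn_intro)
next
  case (ExE \<Gamma> \<phi> \<psi>)
  let ?\<Gamma> = "(\<lambda>\<chi>. tr \<chi> A) ` \<Gamma>"
  have "prv HA (insert (FEx (tr \<phi> (lift A))) ?\<Gamma>) (tr \<psi> A)"
  proof (rule prv.ExE)
    show "prv HA (insert (FEx (tr \<phi> (lift A))) ?\<Gamma>) (FEx (tr \<phi> (lift A)))"
      by (simp add: Hyp)
    show "prv HA (insert (tr \<phi> (lift A)) (lift ` insert (FEx (tr \<phi> (lift A))) ?\<Gamma>)) (lift (tr \<psi> A))"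
      using ExE.IH(2)[of "lift A"] by (auto simp: image_image lift_tr intro: prv_mono)
  qed
  then show ?case using ExE.IH(1)[of A] by (auto intro: nn_elim)
next
  case (EqRefl \<Gamma> t)
  then show ?case by (simp add: nn_intro prv.EqRefl)
next
  case (EqSubst \<Gamma> s t \<phi>)
  let ?\<Gamma> = "(\<lambda>\<chi>. tr \<chi> A) ` \<Gamma>"
  have "prv HA (insert (FEq s t) ?\<Gamma>) (inst (tr \<phi> (lift A)) s)"
    using EqSubst.IH(2)[of A] by (auto simp: inst_tr intro: prv_mono)
  then have "prv HA (insert (FEq s t) ?\<Gamma>) (tr (inst \<phi> t) A)"
    unfolding inst_tr by (intro prv.EqSubst[of _ _ s t]) (simp_all add: Hyp)
  then show ?case using EqSubst.IH(1)[of A] by (auto intro: nn_elim)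
next
  case (ImpE \<Gamma> \<phi> \<psi>)
  then show ?case using prv.ImpE by fastforce
next
  case (AndE1 \<Gamma> \<phi> \<psi>)
  then show ?case using prv.AndE1 by fastforce
next
  case (AndE2 \<Gamma> \<phi> \<psi>)
  then show ?case using prv.AndE2 by fastforce
qed (auto intro: prv.Hyp prv.ImpI prv.AndI prv.OrI1 prv.OrI2 nn_intro)

subsection \<open>Elementary arithmetic in \<open>HA\<close>\<close>

lemma eq_cong:
  assumes "prv T \<Gamma> (FEq s t)"
  shows "prv T \<Gamma> (FEq (sub_trm (case_nat s Var) u) (sub_trm (case_nat t Var) u))"
  \<comment> \<open>The left side is lifted away from the substituted variable, so only the right
    side is rewritten.\<close>
  using EqSubst[OF assms, of "FEq (sub_trm (\<lambda>n. Var (Suc n)) (sub_trm (case_nat s Var) u)) u"]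
  by (simp add: EqRefl)

lemma eq_sym:
  assumes "prv T \<Gamma> (FEq s t)"
  shows "prv T \<Gamma> (FEq t s)"
  using EqSubst[OF assms, of "FEq (Var 0) (sub_trm (\<lambda>n. Var (Suc n)) s)"]
  by (simp add: EqRefl)

lemma eq_trans [trans]:
  assumes "prv T \<Gamma> (FEq s t)" "prv T \<Gamma> (FEq t u)"
  shows "prv T \<Gamma> (FEq s u)"
  using EqSubst[OF assms(2), of "FEq (sub_trm (\<lambda>n. Var (Suc n)) s) (Var 0)"] assms(1)
  by simp

lemma eq_Fn:
  assumes "prv T \<Gamma> (FEq s t)"
  shows "prv T \<Gamma> (FEq (Fn f (s # ts)) (Fn f (t # ts)))"
  using eq_cong[OF assms, of "Fn f (Var 0 # map (sub_trm (\<lambda>n. Var (Suc n))) ts)"]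
  by (simp add: comp_def)

lemma HA_induct:
  assumes "prv HA \<Gamma> (inst \<phi> zero)"
    and "prv HA (insert \<phi> (lift ` \<Gamma>)) (sub (case_nat (suc (Var 0)) (\<lambda>n. Var (Suc n))) \<phi>)"
  shows "prv HA \<Gamma> (inst \<phi> t)"
  by (rule AllE, rule ImpE[OF ImpE[OF Ax[OF HA.Induct] assms(1)]], intro AllI ImpI assms(2))

section \<open>Primitive recursive codes for parity, halving and pairing\<close>

definition prd_pr :: pr where "prd_pr = Rc Zr (Pj (Suc 0))"
definition not_pr :: pr where "not_pr = Rc (Cn Sc [Zr]) Zr"
definition par_pr :: pr where "par_pr = Rc Zr not_pr"
definition dbl_pr :: pr where "dbl_pr = Rc Zr (Cn Sc [Cn Sc [Pj 0]])"
text \<open>Adds 1 to the second argument if the first is nonzero. Halving then is the recursion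
  half(t + 1) = half t + par t.\<close>

definition cond_suc_pr :: pr where "cond_suc_pr = Rc (Pj 0) (Cn Sc [Pj 2])"
definition half_pr :: pr where "half_pr = Rc Zr (Cn cond_suc_pr [Cn par_pr [Pj (Suc 0)], Pj 0])"
text \<open>Injectivity of this pairing follows from parity and halving alone, without the laws of
  addition and multiplication.\<close>

definition pair_pr :: pr where "pair_pr = Rc (Cn Sc [dbl_pr]) (Cn dbl_pr [Pj 0])"

abbreviation prd :: "trm \<Rightarrow> trm" where "prd t \<equiv> Fn prd_pr [t]"
abbreviation par :: "trm \<Rightarrow> trm" where "par t \<equiv> Fn par_pr [t]"
abbreviation dbl :: "trm \<Rightarrow> trm" where "dbl t \<equiv> Fn dbl_pr [t]"
abbreviation half :: "trm \<Rightarrow> trm" where "half t \<equiv> Fn half_pr [t]"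

text \<open>This is \<open>2\<^sup>s (2t + 1)\<close>.\<close>

abbreviation pair :: "trm \<Rightarrow> trm \<Rightarrow> trm" where "pair s t \<equiv> Fn pair_pr [s, t]"

lemma Pj_eq: "i < length ts \<Longrightarrow> prv HA \<Gamma> (FEq (Fn (Pj i) ts) (ts ! i))"
  using Ax[OF HA.Pj, of \<Gamma> i ts] by simp

lemma Cn_eq: "prv HA \<Gamma> (FEq (Fn (Cn f gs) ts) (Fn f (map (\<lambda>g. Fn g ts) gs)))"
  by (rule Ax[OF HA.Cn])

lemma Cn1_eq: "prv HA \<Gamma> (FEq (Fn (Cn f [g]) ts) (Fn f [Fn g ts]))"
  using Cn_eq[of \<Gamma> f "[g]" ts] by simp

lemma prd_suc: "prv HA \<Gamma> (FEq (prd (suc t)) t)"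
  unfolding prd_pr_def by (rule eq_trans[OF Ax[OF HA.Rc_suc] Pj_eq[of "Suc 0" "[_, t]", simplified]])

lemma not_zero: "prv HA \<Gamma> (FEq (Fn not_pr (zero # ts)) (suc zero))"
  unfolding not_pr_def
  by (rule eq_trans[OF Ax[OF HA.Rc_zero] eq_trans[OF Cn1_eq eq_Fn[OF Ax[OF HA.Zr]]]])

lemma not_suc: "prv HA \<Gamma> (FEq (Fn not_pr (suc t # ts)) zero)"
  unfolding not_pr_def by (rule eq_trans[OF Ax[OF HA.Rc_suc] Ax[OF HA.Zr]])

lemma par_zero: "prv HA \<Gamma> (FEq (par zero) zero)"
  unfolding par_pr_def by (rule Ax[OF HA.Rc_zero])

lemma par_suc: "prv HA \<Gamma> (FEq (par (suc t)) (Fn not_pr [par t, t]))"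
  unfolding par_pr_def by (rule Ax[OF HA.Rc_suc])

lemma par_even: "prv HA \<Gamma> (FEq (par t) zero) \<Longrightarrow> prv HA \<Gamma> (FEq (par (suc t)) (suc zero))"
  by (rule eq_trans[OF par_suc eq_trans[OF eq_Fn not_zero]])

lemma par_odd: "prv HA \<Gamma> (FEq (par t) (suc zero)) \<Longrightarrow> prv HA \<Gamma> (FEq (par (suc t)) zero)"
  by (rule eq_trans[OF par_suc eq_trans[OF eq_Fn not_suc]])

lemma Cn_Sc_Pj: "i < length ts \<Longrightarrow> prv HA \<Gamma> (FEq (Fn (Cn Sc [Pj i]) ts) (suc (ts ! i)))"
  by (rule eq_trans[OF Cn1_eq eq_Fn[OF Pj_eq]])

lemma dbl_zero: "prv HA \<Gamma> (FEq (dbl zero) zero)"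
  unfolding dbl_pr_def by (rule Ax[OF HA.Rc_zero])

lemma dbl_suc: "prv HA \<Gamma> (FEq (dbl (suc t)) (suc (suc (dbl t))))"
proof -
  have "prv HA \<Gamma> (FEq (dbl (suc t)) (Fn (Cn Sc [Cn Sc [Pj 0]]) [dbl t, t]))"
    unfolding dbl_pr_def by (rule Ax[OF HA.Rc_suc])
  also have "prv HA \<Gamma> (FEq (Fn (Cn Sc [Cn Sc [Pj 0]]) [dbl t, t]) (suc (suc (dbl t))))"
    by (rule eq_trans[OF Cn1_eq eq_Fn[OF Cn_Sc_Pj[of 0 "[dbl t, t]", simplified]]])
  finally show ?thesis .
qed

lemma cond_suc_zero: "prv HA \<Gamma> (FEq (Fn cond_suc_pr [zero, t]) t)"
  unfolding cond_suc_pr_def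
  by (rule eq_trans[OF Ax[OF HA.Rc_zero] Pj_eq[of 0 "[t]", simplified]])

lemma cond_suc_suc: "prv HA \<Gamma> (FEq (Fn cond_suc_pr [suc s, t]) (suc t))"
  unfolding cond_suc_pr_def
  by (rule eq_trans[OF Ax[OF HA.Rc_suc]], rule Cn_Sc_Pj[of 2 "[_, s, t]", simplified])

lemma half_suc: "prv HA \<Gamma> (FEq (half (suc t)) (Fn cond_suc_pr [par t, half t]))"
proof -
  let ?ts = "[half t, t]"
  have par: "prv HA \<Gamma> (FEq (Fn (Cn par_pr [Pj (Suc 0)]) ?ts) (par t))"
    by (rule eq_trans[OF Cn1_eq eq_Fn[OF Pj_eq[of "Suc 0" ?ts, simplified]]])
  have "prv HA \<Gamma> (FEq (half (suc t)) (Fn (Cn cond_suc_pr [Cn par_pr [Pj (Suc 0)], Pj 0]) ?ts))"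
    unfolding half_pr_def by (rule Ax[OF HA.Rc_suc])
  also have "prv HA \<Gamma> (FEq (Fn (Cn cond_suc_pr [Cn par_pr [Pj (Suc 0)], Pj 0]) ?ts)
      (Fn cond_suc_pr [Fn (Cn par_pr [Pj (Suc 0)]) ?ts, Fn (Pj 0) ?ts]))"
    using Cn_eq[of \<Gamma> cond_suc_pr "[Cn par_pr [Pj (Suc 0)], Pj 0]" ?ts] by simp
  also have "prv HA \<Gamma> (FEq (Fn cond_suc_pr [Fn (Cn par_pr [Pj (Suc 0)]) ?ts, Fn (Pj 0) ?ts])
      (Fn cond_suc_pr [par t, Fn (Pj 0) ?ts]))"
    by (rule eq_Fn[OF par])
  also have "prv HA \<Gamma> (FEq (Fn cond_suc_pr [par t, Fn (Pj 0) ?ts]) (Fn cond_suc_pr [par t, half t]))"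
    using eq_cong[OF Pj_eq[of 0 ?ts \<Gamma>], of "Fn cond_suc_pr [sub_trm (\<lambda>n. Var (Suc n)) (par t), Var 0]"]
    by simp
  finally show ?thesis .
qed

lemma half_zero: "prv HA \<Gamma> (FEq (half zero) zero)"
  unfolding half_pr_def by (rule Ax[OF HA.Rc_zero])

lemma half_even: "prv HA \<Gamma> (FEq (par t) zero) \<Longrightarrow> prv HA \<Gamma> (FEq (half (suc t)) (half t))"
  by (rule eq_trans[OF half_suc eq_trans[OF eq_Fn cond_suc_zero]])

lemma half_odd:
  "prv HA \<Gamma> (FEq (par t) (suc zero)) \<Longrightarrow> prv HA \<Gamma> (FEq (half (suc t)) (suc (half t)))"
  by (rule eq_trans[OF half_suc eq_trans[OF eq_Fn cond_suc_suc]])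

lemma par_dbl: "prv HA \<Gamma> (FEq (par (dbl t)) zero)"
proof -
  let ?\<phi> = "FEq (par (dbl (Var 0))) zero"
  have "prv HA \<Gamma> (inst ?\<phi> t)"
  proof (rule HA_induct)
    show "prv HA \<Gamma> (inst ?\<phi> zero)"
      by (simp add: eq_trans[OF eq_Fn[OF dbl_zero] par_zero])
    let ?\<Delta> = "insert ?\<phi> (lift ` \<Gamma>)"
    have "prv HA ?\<Delta> (FEq (par (dbl (suc (Var 0)))) (par (suc (suc (dbl (Var 0))))))"
      by (rule eq_Fn[OF dbl_suc])
    also have "prv HA ?\<Delta> (FEq (par (suc (suc (dbl (Var 0))))) zero)"
      by (rule par_odd[OF par_even]) (simp add: Hyp)
    finally show "prv HA ?\<Delta> (sub (case_nat (suc (Var 0)) (\<lambda>n. Var (Suc n))) ?\<phi>)"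
      by simp
  qed
  then show ?thesis by simp
qed

lemma half_dbl: "prv HA \<Gamma> (FEq (half (dbl t)) t)"
proof -
  let ?\<phi> = "FEq (half (dbl (Var 0))) (Var 0)"
  have "prv HA \<Gamma> (inst ?\<phi> t)"
  proof (rule HA_induct)
    show "prv HA \<Gamma> (inst ?\<phi> zero)"
      by (simp add: eq_trans[OF eq_Fn[OF dbl_zero] half_zero])
    let ?\<Delta> = "insert ?\<phi> (lift ` \<Gamma>)"
    have "prv HA ?\<Delta> (FEq (half (dbl (suc (Var 0)))) (half (suc (suc (dbl (Var 0))))))"
      by (rule eq_Fn[OF dbl_suc])
    also have "prv HA ?\<Delta> (FEq (half (suc (suc (dbl (Var 0))))) (suc (half (suc (dbl (Var 0))))))"
      by (rule half_odd[OF par_even[OF par_dbl]])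
    also have "prv HA ?\<Delta> (FEq (suc (half (suc (dbl (Var 0))))) (suc (half (dbl (Var 0)))))"
      by (rule eq_Fn[OF half_even[OF par_dbl]])
    also have "prv HA ?\<Delta> (FEq (suc (half (dbl (Var 0)))) (suc (Var 0)))"
      by (rule eq_Fn) (simp add: Hyp)
    finally show "prv HA ?\<Delta> (sub (case_nat (suc (Var 0)) (\<lambda>n. Var (Suc n))) ?\<phi>)"
      by simp
  qed
  then show ?thesis by simp
qed

lemma pair_zero: "prv HA \<Gamma> (FEq (pair zero t) (suc (dbl t)))"
  unfolding pair_pr_def by (rule eq_trans[OF Ax[OF HA.Rc_zero] Cn1_eq])

lemma pair_suc: "prv HA \<Gamma> (FEq (pair (suc s) t) (dbl (pair s t)))"
proof -
  have "prv HA \<Gamma> (FEq (pair (suc s) t) (Fn (Cn dbl_pr [Pj 0]) [pair s t, s, t]))"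
    unfolding pair_pr_def by (rule Ax[OF HA.Rc_suc])
  also have "prv HA \<Gamma> (FEq (Fn (Cn dbl_pr [Pj 0]) [pair s t, s, t]) (dbl (pair s t)))"
    by (rule eq_trans[OF Cn1_eq eq_Fn[OF Pj_eq[of 0 "[pair s t, s, t]", simplified]]])
  finally show ?thesis .
qed

section \<open>Case distinction and injectivity of pairing\<close>

lemma zero_neq_suc: "prv HA \<Gamma> (FEq zero (suc t)) \<Longrightarrow> prv HA \<Gamma> \<phi>"
  by (rule BotE, rule ImpE[OF Ax[OF HA.Suc_neq_zero] eq_sym])

text \<open>An induction whose step proves the second disjunct outright. Naming the predecessor by
  the term \<open>prd t\<close> keeps the split free of \<open>\<exists>\<close>.\<close>

lemma nat_cases:
  assumes "prv HA (insert (FEq t zero) \<Gamma>) \<chi>" "prv HA (insert (FEq t (suc (prd t))) \<Gamma>) \<chi>"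
  shows "prv HA \<Gamma> \<chi>"
proof -
  let ?\<phi> = "FOr (FEq (Var 0) zero) (FEq (Var 0) (suc (prd (Var 0))))"
  have "prv HA \<Gamma> (inst ?\<phi> t)"
  proof (rule HA_induct)
    show "prv HA \<Gamma> (inst ?\<phi> zero)" by (simp add: OrI1 EqRefl)
    show "prv HA (insert ?\<phi> (lift ` \<Gamma>)) (sub (case_nat (suc (Var 0)) (\<lambda>n. Var (Suc n))) ?\<phi>)"
      by (simp add: OrI2[OF eq_sym[OF eq_Fn[OF prd_suc]]])
  qed
  then show ?thesis using OrE assms by simp
qed

lemma eq_Fn_iff:
  assumes "prv T \<Gamma> (FEq s t)" "prv T \<Gamma> (FEq (Fn f [s]) a)" "prv T \<Gamma> (FEq (Fn f [t]) b)"
  shows "prv T \<Gamma> (FEq a b)"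
  by (rule eq_trans[OF eq_sym[OF assms(2)] eq_trans[OF eq_Fn[OF assms(1)] assms(3)]])

text \<open>Taking parities of both sides gives 1 = 0.\<close>

lemma odd_neq_even: "prv HA \<Gamma> (FEq (suc (dbl s)) (dbl t)) \<Longrightarrow> prv HA \<Gamma> \<phi>"
  by (rule zero_neq_suc, rule eq_Fn_iff[OF eq_sym par_dbl par_even[OF par_dbl]])

text \<open>\<open>pair_inj_at x\<close> is \<open>\<forall>x' y y'. pair x y = pair x' y' \<longrightarrow> x = x' \<and> y = y'\<close>.\<close>

definition pair_inj_at :: "trm \<Rightarrow> fm" where
  "pair_inj_at x = (let x3 = sub_trm (\<lambda>n. Var (Suc (Suc (Suc n)))) x in
     FAll (FAll (FAll (FImp
       (FEq (pair x3 (Var (Suc 0))) (pair (Var (Suc (Suc 0))) (Var 0)))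
       (FAnd (FEq x3 (Var (Suc (Suc 0)))) (FEq (Var (Suc 0)) (Var 0)))))))"

lemma sub_pair_inj_at: "sub \<sigma> (pair_inj_at x) = pair_inj_at (sub_trm \<sigma> x)"
  by (simp add: pair_inj_at_def Let_def)

lemma pair_inj_atD:
  assumes "prv T \<Gamma> (pair_inj_at x)"
  shows "prv T \<Gamma> (FImp (FEq (pair x y) (pair x' y')) (FAnd (FEq x x') (FEq y y')))"
  using AllE[OF AllE[OF AllE[OF assms[unfolded pair_inj_at_def Let_def], of x',
        unfolded inst_def sub.simps], of y, unfolded inst_def sub.simps], of y']
  by simp

text \<open>The left side is odd, so parity excludes a successor \<open>x'\<close>; if
  \<open>x'\<close> is zero, halving reduces both sides to the second components.\<close>

lemma pair_inj_at_zero: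
  assumes eq: "prv HA \<Gamma> (FEq (pair zero y) (pair x' y'))"
  shows "prv HA \<Gamma> (FAnd (FEq zero x') (FEq y y'))"
proof (rule nat_cases[of x'])
  let ?\<Gamma> = "insert (FEq x' zero) \<Gamma>"
  have x': "prv HA ?\<Gamma> (FEq x' zero)" by (simp add: Hyp)
  have "prv HA ?\<Gamma> (FEq (suc (dbl y)) (pair zero y))" by (rule eq_sym[OF pair_zero])
  also have "prv HA ?\<Gamma> (FEq (pair zero y) (pair x' y'))" by (rule prv_mono[OF eq]) auto
  also have "prv HA ?\<Gamma> (FEq (pair x' y') (pair zero y'))" by (rule eq_Fn[OF x'])
  also have "prv HA ?\<Gamma> (FEq (pair zero y') (suc (dbl y')))" by (rule pair_zero)
  finally have "prv HA ?\<Gamma> (FEq y y')"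
    by (rule eq_Fn_iff[OF _ eq_trans[OF half_even[OF par_dbl] half_dbl]
          eq_trans[OF half_even[OF par_dbl] half_dbl]])
  then show "prv HA ?\<Gamma> (FAnd (FEq zero x') (FEq y y'))" by (intro AndI eq_sym[OF x'])
next
  let ?\<Gamma> = "insert (FEq x' (suc (prd x'))) \<Gamma>"
  have x': "prv HA ?\<Gamma> (FEq x' (suc (prd x')))" by (simp add: Hyp)
  have "prv HA ?\<Gamma> (FEq (suc (dbl y)) (pair zero y))" by (rule eq_sym[OF pair_zero])
  also have "prv HA ?\<Gamma> (FEq (pair zero y) (pair x' y'))" by (rule prv_mono[OF eq]) auto
  also have "prv HA ?\<Gamma> (FEq (pair x' y') (pair (suc (prd x')) y'))" by (rule eq_Fn[OF x'])
  also have "prv HA ?\<Gamma> (FEq (pair (suc (prd x')) y') (dbl (pair (prd x') y')))"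
    by (rule pair_suc)
  finally show "prv HA ?\<Gamma> (FAnd (FEq zero x') (FEq y y'))" by (rule odd_neq_even)
qed

text \<open>The left side is even, so parity excludes \<open>x'\<close> zero; otherwise halving
  leads to a pair with first component \<open>prd x'\<close>. This is why \<open>pair_inj_at\<close>
  quantifies over \<open>x'\<close>.\<close>

lemma pair_inj_at_suc:
  assumes inj: "prv HA \<Gamma> (pair_inj_at x)"
    and eq: "prv HA \<Gamma> (FEq (pair (suc x) y) (pair x' y'))"
  shows "prv HA \<Gamma> (FAnd (FEq (suc x) x') (FEq y y'))"
proof (rule nat_cases[of x'])
  let ?\<Gamma> = "insert (FEq x' zero) \<Gamma>"
  have x': "prv HA ?\<Gamma> (FEq x' zero)" by (simp add: Hyp)
  have "prv HA ?\<Gamma> (FEq (dbl (pair x y)) (pair (suc x) y))" by (rule eq_sym[OF pair_suc])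
  also have "prv HA ?\<Gamma> (FEq (pair (suc x) y) (pair x' y'))" by (rule prv_mono[OF eq]) auto
  also have "prv HA ?\<Gamma> (FEq (pair x' y') (pair zero y'))" by (rule eq_Fn[OF x'])
  also have "prv HA ?\<Gamma> (FEq (pair zero y') (suc (dbl y')))" by (rule pair_zero)
  finally show "prv HA ?\<Gamma> (FAnd (FEq (suc x) x') (FEq y y'))" by (rule odd_neq_even[OF eq_sym])
next
  let ?\<Gamma> = "insert (FEq x' (suc (prd x'))) \<Gamma>"
  have x': "prv HA ?\<Gamma> (FEq x' (suc (prd x')))" by (simp add: Hyp)
  have "prv HA ?\<Gamma> (FEq (dbl (pair x y)) (pair (suc x) y))" by (rule eq_sym[OF pair_suc])
  also have "prv HA ?\<Gamma> (FEq (pair (suc x) y) (pair x' y'))" by (rule prv_mono[OF eq]) auto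
  also have "prv HA ?\<Gamma> (FEq (pair x' y') (pair (suc (prd x')) y'))" by (rule eq_Fn[OF x'])
  also have "prv HA ?\<Gamma> (FEq (pair (suc (prd x')) y') (dbl (pair (prd x') y')))"
    by (rule pair_suc)
  finally have "prv HA ?\<Gamma> (FEq (pair x y) (pair (prd x') y'))"
    by (rule eq_Fn_iff[OF _ half_dbl half_dbl])
  moreover have "prv HA ?\<Gamma> (pair_inj_at x)" by (rule prv_mono[OF inj]) auto
  ultimately have *: "prv HA ?\<Gamma> (FAnd (FEq x (prd x')) (FEq y y'))"
    by (intro ImpE[OF pair_inj_atD])
  have "prv HA ?\<Gamma> (FEq (suc x) x')"
    by (rule eq_trans[OF eq_Fn[OF AndE1[OF *]] eq_sym[OF x']])
  then show "prv HA ?\<Gamma> (FAnd (FEq (suc x) x') (FEq y y'))" by (rule AndI[OF _ AndE2[OF *]])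
qed

lemma pair_inj_at_all: "prv HA \<Gamma> (pair_inj_at t)"
proof -
  let ?\<phi> = "pair_inj_at (Var 0)"
  have "prv HA \<Gamma> (inst ?\<phi> t)"
  proof (rule HA_induct)
    have "prv HA \<Gamma> (pair_inj_at zero)"
      unfolding pair_inj_at_def Let_def sub_trm.simps list.map
      by (intro AllI ImpI pair_inj_at_zero) (simp add: Hyp)
    then show "prv HA \<Gamma> (inst ?\<phi> zero)" by (simp add: inst_def sub_pair_inj_at)
    let ?\<Delta> = "insert ?\<phi> (lift ` \<Gamma>)"
    have "lift (lift (lift ?\<phi>)) = pair_inj_at (Var (Suc (Suc (Suc 0))))"
      by (simp add: lift_def sub_pair_inj_at)
    then have "pair_inj_at (Var (Suc (Suc (Suc 0)))) \<in> lift ` lift ` lift ` ?\<Delta>" by force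
    then have "prv HA ?\<Delta> (pair_inj_at (suc (Var 0)))"
      by (subst pair_inj_at_def, unfold Let_def sub_trm.simps list.map, intro AllI ImpI,
          intro pair_inj_at_suc) (simp_all add: Hyp)
    then show "prv HA ?\<Delta> (sub (case_nat (suc (Var 0)) (\<lambda>n. Var (Suc n))) ?\<phi>)"
      by (simp add: sub_pair_inj_at)
  qed
  then show ?thesis by (simp add: inst_def sub_pair_inj_at)
qed

lemma pair_inj:
  "prv HA \<Gamma> (FEq (pair x y) (pair x' y')) \<Longrightarrow> prv HA \<Gamma> (FAnd (FEq x x') (FEq y y'))"
  by (rule ImpE[OF pair_inj_atD[OF pair_inj_at_all]])

text \<open>Induction on \<open>s\<close> with the other side universally quantified, because the
  step compares \<open>suc x\<close> with \<open>y\<close> through \<open>x\<close> and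
  \<open>prd y\<close>.\<close>

lemma eq_decidable: "prv HA \<Gamma> (FOr (FEq s t) (FNeg (FEq s t)))"
proof -
  let ?D = "\<lambda>x. FAll (FOr (FEq x (Var 0)) (FNeg (FEq x (Var 0))))"
  let ?\<phi> = "?D (Var (Suc 0))"
  have zero: "prv HA \<Gamma> (FOr (FEq zero y) (FNeg (FEq zero y)))" for \<Gamma> y
  proof (rule nat_cases[of y])
    show "prv HA (insert (FEq y zero) \<Gamma>) (FOr (FEq zero y) (FNeg (FEq zero y)))"
      by (rule OrI1, rule eq_sym) (simp add: Hyp)
    show "prv HA (insert (FEq y (suc (prd y))) \<Gamma>) (FOr (FEq zero y) (FNeg (FEq zero y)))"
      by (rule OrI2, rule ImpI, rule zero_neq_suc[of _ "prd y"], rule eq_trans[of _ _ _ y])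
        (auto simp: Hyp)
  qed
  have suc: "prv HA \<Gamma> (FOr (FEq (suc x) y) (FNeg (FEq (suc x) y)))"
    if "prv HA \<Gamma> (FOr (FEq x (prd y)) (FNeg (FEq x (prd y))))" for \<Gamma> x y
  proof (rule nat_cases[of y])
    show "prv HA (insert (FEq y zero) \<Gamma>) (FOr (FEq (suc x) y) (FNeg (FEq (suc x) y)))"
      by (rule OrI2, rule ImpI, rule zero_neq_suc[of _ x], rule eq_trans[OF eq_sym eq_sym, of _ _ y])
        (auto simp: Hyp)
    let ?\<Gamma> = "insert (FEq y (suc (prd y))) \<Gamma>"
    have *: "prv HA \<Delta> (FEq y (suc (prd y)))" if "?\<Gamma> \<subseteq> \<Delta>" for \<Delta>
      using that by (auto intro: Hyp)
    show "prv HA ?\<Gamma> (FOr (FEq (suc x) y) (FNeg (FEq (suc x) y)))"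
    proof (rule OrE[OF prv_mono[OF that]])
      show "prv HA (insert (FEq x (prd y)) ?\<Gamma>) (FOr (FEq (suc x) y) (FNeg (FEq (suc x) y)))"
        by (rule OrI1, rule eq_trans[OF eq_Fn eq_sym[OF *]]) (auto simp: Hyp)
      show "prv HA (insert (FNeg (FEq x (prd y))) ?\<Gamma>) (FOr (FEq (suc x) y) (FNeg (FEq (suc x) y)))"
        by (rule OrI2, rule ImpI, rule ImpE[of _ _ "FEq x (prd y)"], simp add: Hyp,
            rule ImpE[OF Ax[OF HA.Suc_inj] eq_trans[OF _ *]]) (auto simp: Hyp)
    qed auto
  qed
  have "prv HA \<Gamma> (inst ?\<phi> s)"
  proof (rule HA_induct)
    show "prv HA \<Gamma> (inst ?\<phi> zero)" using zero by (auto simp: inst_def intro: AllI)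
    let ?\<Delta> = "insert ?\<phi> (lift ` \<Gamma>)"
    have "prv HA (lift ` ?\<Delta>) (lift ?\<phi>)" by (auto intro: Hyp)
    then have "prv HA (lift ` ?\<Delta>) (inst (FOr (FEq (Var (Suc (Suc 0))) (Var 0))
        (FNeg (FEq (Var (Suc (Suc 0))) (Var 0)))) (prd (Var 0)))"
      by (intro AllE) (simp add: lift_def)
    then show "prv HA ?\<Delta> (sub (case_nat (suc (Var 0)) (\<lambda>n. Var (Suc n))) ?\<phi>)"
      using suc by (auto intro: AllI)
  qed
  then have "prv HA \<Gamma> (FAll (FOr (FEq (sub_trm (\<lambda>n. Var (Suc n)) s) (Var 0))
      (FNeg (FEq (sub_trm (\<lambda>n. Var (Suc n)) s) (Var 0)))))"
    by (simp add: inst_def)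
  from AllE[OF this, of t] show ?thesis by simp
qed

lemma qf_decidable: "qf \<phi> \<Longrightarrow> prv HA \<Gamma> (FOr \<phi> (FNeg \<phi>))"
proof (induction \<phi>)
  case (FEq s t)
  show ?case by (rule eq_decidable)
next
  case FBot
  show ?case by (reify ipc_eqs) (rule ipc_prv, code_simp)
next
  case (FImp \<phi> \<psi>)
  then have "prv HA \<Gamma> (FOr \<phi> (FNeg \<phi>))" "prv HA \<Gamma> (FOr \<psi> (FNeg \<psi>))" by auto
  then show ?case
    by (rule prv_mp2) (reify ipc_eqs, rule ipc_prv, code_simp)
next
  case (FAnd \<phi> \<psi>)
  then have "prv HA \<Gamma> (FOr \<phi> (FNeg \<phi>))" "prv HA \<Gamma> (FOr \<psi> (FNeg \<psi>))" by auto
  then show ?case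
    by (rule prv_mp2) (reify ipc_eqs, rule ipc_prv, code_simp)
next
  case (FOr \<phi> \<psi>)
  then have "prv HA \<Gamma> (FOr \<phi> (FNeg \<phi>))" "prv HA \<Gamma> (FOr \<psi> (FNeg \<psi>))" by auto
  then show ?case
    by (rule prv_mp2) (reify ipc_eqs, rule ipc_prv, code_simp)
qed simp_all

subsection \<open>Provable equivalence\<close>

definition eqv :: "fm set \<Rightarrow> fm \<Rightarrow> fm \<Rightarrow> bool" where
  "eqv T \<phi> \<psi> \<longleftrightarrow> prv T {} (FIff \<phi> \<psi>)"

lemma eqvI: "prv T {\<phi>} \<psi> \<Longrightarrow> prv T {\<psi>} \<phi> \<Longrightarrow> eqv T \<phi> \<psi>"
  by (simp add: eqv_def AndI ImpI)

lemma eqvD1: "eqv T \<phi> \<psi> \<Longrightarrow> prv T \<Gamma> \<phi> \<Longrightarrow> prv T \<Gamma> \<psi>"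
  unfolding eqv_def by (meson AndE1 ImpE prv_mono empty_subsetI)

lemma eqvD2: "eqv T \<phi> \<psi> \<Longrightarrow> prv T \<Gamma> \<psi> \<Longrightarrow> prv T \<Gamma> \<phi>"
  unfolding eqv_def by (meson AndE2 ImpE prv_mono empty_subsetI)

lemma eqv_refl [simp]: "eqv T \<phi> \<phi>"
  by (simp add: eqvI Hyp)

lemma eqv_sym: "eqv T \<phi> \<psi> \<Longrightarrow> eqv T \<psi> \<phi>"
  using eqvD1 eqvD2 by (meson Hyp eqvI insertI1)

lemma eqv_trans [trans]: "eqv T \<phi> \<psi> \<Longrightarrow> eqv T \<psi> \<chi> \<Longrightarrow> eqv T \<phi> \<chi>"
  using eqvD1 eqvD2 by (meson Hyp eqvI insertI1)

lemma eqv_Imp: "eqv T \<phi> \<phi>' \<Longrightarrow> eqv T \<psi> \<psi>' \<Longrightarrow> eqv T (FImp \<phi> \<psi>) (FImp \<phi>' \<psi>')"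
  unfolding eqv_def by (erule (1) prv_mp2) (reify ipc_eqs, rule ipc_prv, code_simp)

lemma eqv_And: "eqv T \<phi> \<phi>' \<Longrightarrow> eqv T \<psi> \<psi>' \<Longrightarrow> eqv T (FAnd \<phi> \<psi>) (FAnd \<phi>' \<psi>')"
  unfolding eqv_def by (erule (1) prv_mp2) (reify ipc_eqs, rule ipc_prv, code_simp)

lemma eqv_Or: "eqv T \<phi> \<phi>' \<Longrightarrow> eqv T \<psi> \<psi>' \<Longrightarrow> eqv T (FOr \<phi> \<psi>) (FOr \<phi>' \<psi>')"
  unfolding eqv_def by (erule (1) prv_mp2) (reify ipc_eqs, rule ipc_prv, code_simp)

lemma eqv_Neg: "eqv T \<phi> \<psi> \<Longrightarrow> eqv T (FNeg \<phi>) (FNeg \<psi>)"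
  by (simp add: eqv_Imp)

lemma eqv_All: "eqv T \<phi> \<psi> \<Longrightarrow> eqv T (FAll \<phi>) (FAll \<psi>)"
  by (rule eqvI; rule prv_All_mono; auto intro: eqvD1 eqvD2 Hyp)

lemma eqv_Ex: "eqv T \<phi> \<psi> \<Longrightarrow> eqv T (FEx \<phi>) (FEx \<psi>)"
  by (rule eqvI; rule prv_Ex_mono; auto intro: eqvD1 eqvD2 Hyp)

lemma eqv_sub: "eqv T \<phi> \<psi> \<Longrightarrow> eqv T (sub \<sigma> \<phi>) (sub \<sigma> \<psi>)"
  unfolding eqv_def using prv_sub[of T "FIff \<phi> \<psi>" \<sigma>] by simp

lemma eqv_theory_mono: "eqv S \<phi> \<psi> \<Longrightarrow> (\<And>\<chi>. \<chi> \<in> S \<Longrightarrow> prv T {} \<chi>) \<Longrightarrow> eqv T \<phi> \<psi>"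
  unfolding eqv_def by (rule prv_theory_mono)

lemma eqv_And_commute: "eqv T (FAnd \<phi> \<psi>) (FAnd \<psi> \<phi>)"
  unfolding eqv_def by (reify ipc_eqs) (rule ipc_prv, code_simp)

lemma eqv_All_And: "eqv T (FAll (FAnd \<phi> (lift \<psi>))) (FAnd (FAll \<phi>) \<psi>)"
proof (rule eqvI)
  let ?\<Gamma> = "{FAll (FAnd \<phi> (lift \<psi>))}"
  \<comment> \<open>Any term would do here: the conjunct \<open>\<psi>\<close> does not depend on
    the bound variable.\<close>
  have "prv T ?\<Gamma> (inst (FAnd \<phi> (lift \<psi>)) zero)" by (rule AllE) (simp add: Hyp)
  then have "prv T ?\<Gamma> \<psi>" using AndE2[of T ?\<Gamma> "inst \<phi> zero" \<psi>] by simp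
  moreover have "prv T ?\<Gamma> (FAll \<phi>)"
    by (rule prv_All_mono, rule AndE1[of _ _ _ "lift \<psi>"]) (simp add: Hyp)
  ultimately show "prv T ?\<Gamma> (FAnd (FAll \<phi>) \<psi>)" by (rule AndI[rotated])
next
  let ?\<Gamma> = "lift ` {FAnd (FAll \<phi>) \<psi>}"
  have "prv T ?\<Gamma> (FAnd (lift (FAll \<phi>)) (lift \<psi>))" by (simp add: Hyp)
  then have "prv T ?\<Gamma> (FAnd \<phi> (lift \<psi>))"
    using prv_lift_AllE[of T ?\<Gamma> \<phi>] by (simp add: prv_And_iff)
  then show "prv T {FAnd (FAll \<phi>) \<psi>} (FAll (FAnd \<phi> (lift \<psi>)))" by (rule AllI)
qed

lemma eqv_Ex_And: "eqv T (FEx (FAnd \<phi> (lift \<psi>))) (FAnd (FEx \<phi>) \<psi>)"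
proof (rule eqvI)
  let ?\<Gamma> = "insert (FAnd \<phi> (lift \<psi>)) (lift ` {FEx (FAnd \<phi> (lift \<psi>))})"
  have "prv T ?\<Gamma> (FAnd \<phi> (lift \<psi>))" by (simp add: Hyp)
  then have "prv T ?\<Gamma> (FAnd (lift (FEx \<phi>)) (lift \<psi>))"
    using prv_lift_ExI[of T ?\<Gamma> \<phi>] by (simp add: prv_And_iff)
  then have "prv T ?\<Gamma> (lift (FAnd (FEx \<phi>) \<psi>))" by simp
  then show "prv T {FEx (FAnd \<phi> (lift \<psi>))} (FAnd (FEx \<phi>) \<psi>)"
    by (rule ExE[OF Hyp, rotated]) simp
next
  let ?\<Gamma> = "insert \<phi> (lift ` {FAnd (FEx \<phi>) \<psi>})"
  have "prv T ?\<Gamma> (FAnd (lift (FEx \<phi>)) (lift \<psi>))" by (simp add: Hyp)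
  then have "prv T ?\<Gamma> (FAnd \<phi> (lift \<psi>))"
    by (simp add: prv_And_iff Hyp)
  then have "prv T ?\<Gamma> (lift (FEx (FAnd \<phi> (lift \<psi>))))" by (rule prv_lift_ExI)
  moreover have "prv T {FAnd (FEx \<phi>) \<psi>} (FEx \<phi>)" by (rule AndE1[of _ _ _ \<psi>]) (simp add: Hyp)
  ultimately show "prv T {FAnd (FEx \<phi>) \<psi>} (FEx (FAnd \<phi> (lift \<psi>)))" by (rule ExE[rotated])
qed

lemma eqv_Neg_Ex: "eqv T (FNeg (FEx \<phi>)) (FAll (FNeg \<phi>))"
proof (rule eqvI)
  let ?\<Gamma> = "insert \<phi> (lift ` {FNeg (FEx \<phi>)})"
  have "prv T ?\<Gamma> (FNeg (lift (FEx \<phi>)))" by (simp add: Hyp)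
  moreover have "prv T ?\<Gamma> (lift (FEx \<phi>))" by (rule prv_lift_ExI) (simp add: Hyp)
  ultimately show "prv T {FNeg (FEx \<phi>)} (FAll (FNeg \<phi>))" by (intro AllI ImpI) (rule ImpE)
next
  let ?\<Gamma> = "{FEx \<phi>, FAll (FNeg \<phi>)}"
  have "prv T (insert \<phi> (lift ` ?\<Gamma>)) (FNeg \<phi>)" by (rule prv_lift_AllE) (simp add: Hyp)
  moreover have "prv T (insert \<phi> (lift ` ?\<Gamma>)) \<phi>" by (simp add: Hyp)
  ultimately have "prv T (insert \<phi> (lift ` ?\<Gamma>)) (lift FBot)" using ImpE[of T _ \<phi> FBot] by simp
  then have "prv T ?\<Gamma> FBot" by (rule ExE[OF Hyp, rotated]) simp
  then show "prv T {FAll (FNeg \<phi>)} (FNeg (FEx \<phi>))" by (rule ImpI)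
qed

subsection \<open>Prenex classes\<close>

lemma Sigma_subset_Pi: "\<phi> \<in> Sigma_cl k \<Longrightarrow> \<phi> \<in> Pi_cl (Suc k)"
  by (auto intro: exI[of _ 0])

lemma Pi_subset_Sigma: "\<phi> \<in> Pi_cl k \<Longrightarrow> \<phi> \<in> Sigma_cl (Suc k)"
  by (auto intro: exI[of _ 0])

declare Sigma_cl.simps(2) [simp del] Pi_cl.simps(2) [simp del]

lemma Sigma_Pi_Suc: "Sigma_cl k \<subseteq> Sigma_cl (Suc k) \<and> Pi_cl k \<subseteq> Pi_cl (Suc k)"
proof (induction k)
  case 0
  then show ?case using Sigma_subset_Pi[of _ 0] Pi_subset_Sigma[of _ 0] by auto
next
  case (Suc k)
  have "Sigma_cl (Suc k) \<subseteq> Sigma_cl (Suc (Suc k))"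
    unfolding Sigma_cl.simps(2)[of "Suc k"] Sigma_cl.simps(2)[of k] using Suc by blast
  moreover have "Pi_cl (Suc k) \<subseteq> Pi_cl (Suc (Suc k))"
    unfolding Pi_cl.simps(2)[of "Suc k"] Pi_cl.simps(2)[of k] using Suc by blast
  ultimately show ?case ..
qed

lemma Sigma_mono: "k \<le> l \<Longrightarrow> Sigma_cl k \<subseteq> Sigma_cl l"
  by (rule lift_Suc_mono_le[of Sigma_cl]) (use Sigma_Pi_Suc in auto)

lemma Pi_mono: "k \<le> l \<Longrightarrow> Pi_cl k \<subseteq> Pi_cl l"
  by (rule lift_Suc_mono_le[of Pi_cl]) (use Sigma_Pi_Suc in auto)

lemma qf_Sigma: "qf \<phi> \<Longrightarrow> \<phi> \<in> Sigma_cl k"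
  using Sigma_mono[of 0 k] by auto

lemma qf_Pi: "qf \<phi> \<Longrightarrow> \<phi> \<in> Pi_cl k"
  using Pi_mono[of 0 k] by auto

lemma FAll_Pi: "\<phi> \<in> Pi_cl (Suc k) \<Longrightarrow> FAll \<phi> \<in> Pi_cl (Suc k)"
  unfolding Pi_cl.simps(2) by clarsimp (metis funpow.simps(2) comp_apply)

lemma FEx_Sigma: "\<phi> \<in> Sigma_cl (Suc k) \<Longrightarrow> FEx \<phi> \<in> Sigma_cl (Suc k)"
  unfolding Sigma_cl.simps(2) by clarsimp (metis funpow.simps(2) comp_apply)

text \<open>Removes the outermost block one quantifier at a time, so that later proofs never mention
  block lengths; an empty block is the case \<open>Sigma\<close>.\<close>

lemma Pi_Suc_induct [consumes 1, case_names Sigma All]: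
  assumes "\<phi> \<in> Pi_cl (Suc k)" "\<And>\<phi>. \<phi> \<in> Sigma_cl k \<Longrightarrow> P \<phi>"
    and "\<And>\<phi>. \<phi> \<in> Pi_cl (Suc k) \<Longrightarrow> P \<phi> \<Longrightarrow> P (FAll \<phi>)"
  shows "P \<phi>"
proof -
  obtain n \<psi> where \<phi>: "\<phi> = (FAll ^^ n) \<psi>" "\<psi> \<in> Sigma_cl k"
    using assms(1) by (auto simp: Pi_cl.simps(2))
  have "P ((FAll ^^ n) \<psi>) \<and> (FAll ^^ n) \<psi> \<in> Pi_cl (Suc k)"
    by (induction n) (use \<phi>(2) assms(2,3) Sigma_subset_Pi FAll_Pi in simp_all)
  then show ?thesis using \<phi>(1) by simp
qed

lemma Sigma_Suc_induct [consumes 1, case_names Pi Ex]: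
  assumes "\<phi> \<in> Sigma_cl (Suc k)" "\<And>\<phi>. \<phi> \<in> Pi_cl k \<Longrightarrow> P \<phi>"
    and "\<And>\<phi>. \<phi> \<in> Sigma_cl (Suc k) \<Longrightarrow> P \<phi> \<Longrightarrow> P (FEx \<phi>)"
  shows "P \<phi>"
proof -
  obtain n \<psi> where \<phi>: "\<phi> = (FEx ^^ n) \<psi>" "\<psi> \<in> Pi_cl k"
    using assms(1) by (auto simp: Sigma_cl.simps(2))
  have "P ((FEx ^^ n) \<psi>) \<and> (FEx ^^ n) \<psi> \<in> Sigma_cl (Suc k)"
    by (induction n) (use \<phi>(2) assms(2,3) Pi_subset_Sigma FEx_Sigma in simp_all)
  then show ?thesis using \<phi>(1) by simp
qed

lemma qf_sub: "qf (sub \<sigma> \<phi>) = qf \<phi>"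
  by (induction \<phi> arbitrary: \<sigma>) auto

lemma Sigma_Pi_sub:
  "(\<phi> \<in> Sigma_cl k \<longrightarrow> sub \<sigma> \<phi> \<in> Sigma_cl k) \<and> (\<phi> \<in> Pi_cl k \<longrightarrow> sub \<sigma> \<phi> \<in> Pi_cl k)"
proof (induction k arbitrary: \<phi> \<sigma>)
  case 0
  then show ?case by (simp add: qf_sub)
next
  case (Suc k)
  have "sub \<sigma> \<phi> \<in> Sigma_cl (Suc k)" if "\<phi> \<in> Sigma_cl (Suc k)"
    using that
  proof (induction arbitrary: \<sigma> rule: Sigma_Suc_induct)
    case (Pi \<phi>)
    then show ?case using Suc.IH Pi_subset_Sigma by blast
  next
    case (Ex \<phi>)
    then show ?case using FEx_Sigma by simp
  qed
  moreover have "sub \<sigma> \<phi> \<in> Pi_cl (Suc k)" if "\<phi> \<in> Pi_cl (Suc k)"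
    using that
  proof (induction arbitrary: \<sigma> rule: Pi_Suc_induct)
    case (Sigma \<phi>)
    then show ?case using Suc.IH Sigma_subset_Pi by blast
  next
    case (All \<phi>)
    then show ?case using FAll_Pi by simp
  qed
  ultimately show ?case by blast
qed

lemma Sigma_sub: "\<phi> \<in> Sigma_cl k \<Longrightarrow> sub \<sigma> \<phi> \<in> Sigma_cl k"
  and Pi_sub: "\<phi> \<in> Pi_cl k \<Longrightarrow> sub \<sigma> \<phi> \<in> Pi_cl k"
  using Sigma_Pi_sub by blast+

lemma Sigma_lift: "\<phi> \<in> Sigma_cl k \<Longrightarrow> lift \<phi> \<in> Sigma_cl k"
  and Pi_lift: "\<phi> \<in> Pi_cl k \<Longrightarrow> lift \<phi> \<in> Pi_cl k"
  by (simp_all add: lift_def Sigma_sub Pi_sub)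

lemma FV_quantifier_And:
  assumes "FV \<chi> = FV \<phi> \<union> FV (lift \<psi>)"
  shows "FV (FAll \<chi>) = FV (FAll \<phi>) \<union> FV \<psi>" "FV (FEx \<chi>) = FV (FEx \<phi>) \<union> FV \<psi>"
  using assms by (auto simp: FV_lift)

text \<open>The outer block of \<open>a\<close> is pulled out first, then that of \<open>b\<close>,
  and what remains lies in the dual class one level down. All shifts are intuitionistic, hence
  \<open>T\<close> is arbitrary.\<close>

lemma Sigma_Pi_And:
  "(a \<in> Sigma_cl k \<longrightarrow> b \<in> Sigma_cl k \<longrightarrow> (\<exists>c\<in>Sigma_cl k. FV c = FV a \<union> FV b \<and> eqv T c (FAnd a b))) \<and>
   (a \<in> Pi_cl k \<longrightarrow> b \<in> Pi_cl k \<longrightarrow> (\<exists>c\<in>Pi_cl k. FV c = FV a \<union> FV b \<and> eqv T c (FAnd a b)))"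
proof (induction k arbitrary: a b)
  case 0
  then show ?case by (auto intro!: exI[of _ "FAnd a b"])
next
  case (Suc k)
  have "\<exists>c\<in>Sigma_cl (Suc k). FV c = FV a \<union> FV b \<and> eqv T c (FAnd a b)"
    if "a \<in> Sigma_cl (Suc k)" "b \<in> Sigma_cl (Suc k)" for a b
    using that
  proof (induction arbitrary: b rule: Sigma_Suc_induct)
    case (Ex a)
    then obtain c where c: "c \<in> Sigma_cl (Suc k)" "FV c = FV a \<union> FV (lift b)"
      "eqv T c (FAnd a (lift b))"
      using Sigma_lift by metis
    have "eqv T (FEx c) (FAnd (FEx a) b)" by (rule eqv_trans[OF eqv_Ex[OF c(3)] eqv_Ex_And])
    then show ?case using FEx_Sigma[OF c(1)] FV_quantifier_And(2)[OF c(2)] by metis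
  next
    case (Pi a)
    show ?case using Pi.prems Pi.hyps
    proof (induction arbitrary: a rule: Sigma_Suc_induct)
      case (Pi b)
      then show ?case using Suc.IH[of a b] Pi_subset_Sigma by blast
    next
      case (Ex b)
      then obtain c where c: "c \<in> Sigma_cl (Suc k)" "FV c = FV (lift a) \<union> FV b"
        "eqv T c (FAnd (lift a) b)"
        using Pi_lift by metis
      have "eqv T (FEx c) (FAnd a (FEx b))"
        by (rule eqv_trans[OF eqv_trans[OF eqv_Ex[OF eqv_trans[OF c(3) eqv_And_commute]] eqv_Ex_And]
              eqv_And_commute])
      moreover have "FV (FEx c) = FV a \<union> FV (FEx b)"
        using FV_quantifier_And(2)[of c b a] c(2) by (metis Un_commute)
      ultimately show ?case using FEx_Sigma[OF c(1)] by metis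
    qed
  qed
  moreover have "\<exists>c\<in>Pi_cl (Suc k). FV c = FV a \<union> FV b \<and> eqv T c (FAnd a b)"
    if "a \<in> Pi_cl (Suc k)" "b \<in> Pi_cl (Suc k)" for a b
    using that
  proof (induction arbitrary: b rule: Pi_Suc_induct)
    case (All a)
    then obtain c where c: "c \<in> Pi_cl (Suc k)" "FV c = FV a \<union> FV (lift b)"
      "eqv T c (FAnd a (lift b))"
      using Pi_lift by metis
    have "eqv T (FAll c) (FAnd (FAll a) b)" by (rule eqv_trans[OF eqv_All[OF c(3)] eqv_All_And])
    then show ?case using FAll_Pi[OF c(1)] FV_quantifier_And(1)[OF c(2)] by metis
  next
    case (Sigma a)
    show ?case using Sigma.prems Sigma.hyps
    proof (induction arbitrary: a rule: Pi_Suc_induct)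
      case (Sigma b)
      then show ?case using Suc.IH[of a b] Sigma_subset_Pi by blast
    next
      case (All b)
      then obtain c where c: "c \<in> Pi_cl (Suc k)" "FV c = FV (lift a) \<union> FV b"
        "eqv T c (FAnd (lift a) b)"
        using Sigma_lift by metis
      have "eqv T (FAll c) (FAnd a (FAll b))"
        by (rule eqv_trans[OF eqv_trans[OF eqv_All[OF eqv_trans[OF c(3) eqv_And_commute]] eqv_All_And]
              eqv_And_commute])
      moreover have "FV (FAll c) = FV a \<union> FV (FAll b)"
        using FV_quantifier_And(1)[of c b a] c(2) by (metis Un_commute)
      ultimately show ?case using FAll_Pi[OF c(1)] by metis
    qed
  qed
  ultimately show ?case by blast
qed

subsection \<open>Classical prenex normal forms\<close>

lemma PA_LEM: "prv PA \<Gamma> (FOr \<phi> (FNeg \<phi>))"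
  by (auto simp: PA_def intro: Ax)

lemma PA_DNE: "prv PA \<Gamma> (FImp (FNeg (FNeg \<phi>)) \<phi>)"
  by (rule prv_mp1[OF PA_LEM[of \<Gamma> \<phi>]], reify ipc_eqs) (rule ipc_prv, code_simp)

lemma PA_Neg_Neg: "eqv PA (FNeg (FNeg \<phi>)) \<phi>"
  unfolding eqv_def
  by (rule prv_mp1[OF PA_LEM[of _ \<phi>]], reify ipc_eqs) (rule ipc_prv, code_simp)

lemma PA_Neg_All: "eqv PA (FNeg (FAll \<phi>)) (FEx (FNeg \<phi>))"
proof -
  have "eqv PA (FNeg (FEx (FNeg \<phi>))) (FAll (FNeg (FNeg \<phi>)))" by (rule eqv_Neg_Ex)
  also have "eqv PA (FAll (FNeg (FNeg \<phi>))) (FAll \<phi>)" by (rule eqv_All[OF PA_Neg_Neg])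
  finally have "eqv PA (FNeg (FNeg (FEx (FNeg \<phi>)))) (FNeg (FAll \<phi>))" by (rule eqv_Neg)
  then show ?thesis by (rule eqv_trans[OF eqv_sym PA_Neg_Neg])
qed

lemma PA_Imp: "eqv PA (FImp \<phi> \<psi>) (FNeg (FAnd \<phi> (FNeg \<psi>)))"
  unfolding eqv_def
  by (rule prv_mp1[OF PA_LEM[of _ \<psi>]], reify ipc_eqs) (rule ipc_prv, code_simp)

lemma Sigma_Pi_Neg:
  "(a \<in> Sigma_cl k \<longrightarrow> (\<exists>c\<in>Pi_cl k. FV c = FV a \<and> eqv PA (FNeg a) c)) \<and>
   (a \<in> Pi_cl k \<longrightarrow> (\<exists>c\<in>Sigma_cl k. FV c = FV a \<and> eqv PA (FNeg a) c))"
proof (induction k arbitrary: a)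
  case 0
  then show ?case by (auto intro!: exI[of _ "FNeg a"])
next
  case (Suc k)
  have "\<exists>c\<in>Pi_cl (Suc k). FV c = FV a \<and> eqv PA (FNeg a) c" if "a \<in> Sigma_cl (Suc k)"
    using that
  proof (induction rule: Sigma_Suc_induct)
    case (Pi a)
    then show ?case using Suc.IH Sigma_subset_Pi by metis
  next
    case (Ex a)
    then obtain c where c: "c \<in> Pi_cl (Suc k)" "FV c = FV a" "eqv PA (FNeg a) c" by blast
    have "eqv PA (FNeg (FEx a)) (FAll c)" by (rule eqv_trans[OF eqv_Neg_Ex eqv_All[OF c(3)]])
    moreover have "FV (FAll c) = FV (FEx a)" using c(2) by simp
    ultimately show ?case using FAll_Pi[OF c(1)] by metis
  qed
  moreover have "\<exists>c\<in>Sigma_cl (Suc k). FV c = FV a \<and> eqv PA (FNeg a) c" if "a \<in> Pi_cl (Suc k)"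
    using that
  proof (induction rule: Pi_Suc_induct)
    case (Sigma a)
    then show ?case using Suc.IH Pi_subset_Sigma by metis
  next
    case (All a)
    then obtain c where c: "c \<in> Sigma_cl (Suc k)" "FV c = FV a" "eqv PA (FNeg a) c" by blast
    have "eqv PA (FNeg (FAll a)) (FEx c)" by (rule eqv_trans[OF PA_Neg_All eqv_Ex[OF c(3)]])
    moreover have "FV (FEx c) = FV (FAll a)" using c(2) by simp
    ultimately show ?case using FEx_Sigma[OF c(1)] by metis
  qed
  ultimately show ?case by blast
qed

text \<open>Classically an implication is a negated conjunction, so closure under
  \<open>FAnd\<close> and \<open>FNeg\<close> suffices.\<close>

lemma Pi_Imp:
  assumes "a \<in> Sigma_cl k" "b \<in> Pi_cl k"
  shows "\<exists>c\<in>Pi_cl k. FV c = FV a \<union> FV b \<and> eqv PA (FImp a b) c"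
proof -
  obtain b' where b': "b' \<in> Sigma_cl k" "FV b' = FV b" "eqv PA (FNeg b) b'"
    using Sigma_Pi_Neg assms(2) by blast
  obtain d where d: "d \<in> Sigma_cl k" "FV d = FV a \<union> FV b'" "eqv PA d (FAnd a b')"
    using Sigma_Pi_And[of a k b' PA] assms(1) b'(1) by blast
  obtain c where c: "c \<in> Pi_cl k" "FV c = FV d" "eqv PA (FNeg d) c"
    using Sigma_Pi_Neg d(1) by blast
  have "eqv PA (FAnd a (FNeg b)) d"
    by (rule eqv_trans[OF eqv_And[OF eqv_refl b'(3)] eqv_sym[OF d(3)]])
  then have "eqv PA (FImp a b) c" by (rule eqv_trans[OF PA_Imp eqv_trans[OF eqv_Neg c(3)]])
  then show ?thesis using c d(2) b'(2) by auto
qed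

lemma Sigma_Imp:
  assumes "a \<in> Pi_cl k" "b \<in> Sigma_cl k"
  shows "\<exists>c\<in>Sigma_cl k. FV c = FV a \<union> FV b \<and> eqv PA (FImp a b) c"
proof -
  obtain b' where b': "b' \<in> Pi_cl k" "FV b' = FV b" "eqv PA (FNeg b) b'"
    using Sigma_Pi_Neg assms(2) by blast
  obtain d where d: "d \<in> Pi_cl k" "FV d = FV a \<union> FV b'" "eqv PA d (FAnd a b')"
    using Sigma_Pi_And[of a k b' PA] assms(1) b'(1) by blast
  obtain c where c: "c \<in> Sigma_cl k" "FV c = FV d" "eqv PA (FNeg d) c"
    using Sigma_Pi_Neg d(1) by blast
  have "eqv PA (FAnd a (FNeg b)) d"
    by (rule eqv_trans[OF eqv_And[OF eqv_refl b'(3)] eqv_sym[OF d(3)]])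
  then have "eqv PA (FImp a b) c" by (rule eqv_trans[OF PA_Imp eqv_trans[OF eqv_Neg c(3)]])
  then show ?thesis using c d(2) b'(2) by auto
qed

text \<open>\<open>U_le k\<close> and \<open>E_le k\<close> are \<open>U_cl k\<close> and \<open>E_cl k\<close> together with all formulas of degree
  below \<open>k\<close>; unlike the exact classes they are inherited by subformulas.\<close>

definition U_le :: "nat \<Rightarrow> fm \<Rightarrow> bool" where
  "U_le k \<phi> \<longleftrightarrow> (\<forall>s\<in>Alt \<phi>. length s < k \<or> length s = k \<and> init_sign s \<noteq> Some Plus)"

definition E_le :: "nat \<Rightarrow> fm \<Rightarrow> bool" where
  "E_le k \<phi> \<longleftrightarrow> (\<forall>s\<in>Alt \<phi>. length s < k \<or> length s = k \<and> init_sign s \<noteq> Some Minus)"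

section \<open>Alternation paths and the connectives\<close>

lemma length_perp [simp]: "length (perp s) = length s"
  by (simp add: perp_def)

lemma init_sign_simps [simp]: "init_sign [] = None" "init_sign (a # s) = Some a"
  by (simp_all add: init_sign_def)

lemma init_sign_perp [simp]: "init_sign (perp s) = map_option flip (init_sign s)"
  by (cases s) (simp_all add: perp_def)

lemma flip_eq [simp]: "flip a = Plus \<longleftrightarrow> a = Minus" "flip a = Minus \<longleftrightarrow> a = Plus"
  by (cases a; simp)+

lemma finite_Alt: "finite (Alt \<phi>)"
  by (induction \<phi>) (simp_all add: setcompr_eq_image)

lemma Alt_nonempty: "Alt \<phi> \<noteq> {}"
proof (induction \<phi>)
  case (FAll \<phi>)
  then obtain s where "s \<in> Alt \<phi>" by blast
  then show ?case by (cases "init_sign s = Some Minus") auto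
next
  case (FEx \<phi>)
  then obtain s where "s \<in> Alt \<phi>" by blast
  then show ?case by (cases "init_sign s = Some Plus") auto
qed simp_all

lemma U_le_mono: "U_le j \<phi> \<Longrightarrow> j \<le> k \<Longrightarrow> U_le k \<phi>"
  by (fastforce simp: U_le_def)

lemma E_le_U_le: "E_le k \<phi> \<Longrightarrow> U_le (Suc k) \<phi>"
  by (fastforce simp: E_le_def U_le_def)

lemma U_le_Imp: "U_le k (FImp \<phi> \<psi>) \<Longrightarrow> E_le k \<phi> \<and> U_le k \<psi>"
  by (cases "\<psi> = FBot") (auto simp: U_le_def E_le_def ball_Un)

lemma E_le_Imp: "E_le k (FImp \<phi> \<psi>) \<Longrightarrow> U_le k \<phi> \<and> E_le k \<psi>"
  by (cases "\<psi> = FBot") (auto simp: U_le_def E_le_def ball_Un)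

lemma U_le_Neg: "E_le k \<phi> \<Longrightarrow> U_le k (FNeg \<phi>)"
  by (auto simp: U_le_def E_le_def)

lemma E_le_Neg: "U_le k \<phi> \<Longrightarrow> E_le k (FNeg \<phi>)"
  by (auto simp: U_le_def E_le_def)

lemma U_le_And: "U_le k (FAnd \<phi> \<psi>) \<Longrightarrow> U_le k \<phi> \<and> U_le k \<psi>"
  by (auto simp: U_le_def)

lemma E_le_And: "E_le k (FAnd \<phi> \<psi>) \<Longrightarrow> E_le k \<phi> \<and> E_le k \<psi>"
  by (auto simp: E_le_def)

text \<open>A path of \<open>\<phi>\<close> not starting with \<open>Minus\<close> is lengthened by
  the quantifier, so it was shorter than \<open>k\<close>; and the quantifier leaves no empty path,
  so \<open>k\<close> is positive.\<close>

lemma U_le_All: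
  assumes "U_le k (FAll \<phi>)"
  shows "U_le k \<phi> \<and> (\<exists>j. k = Suc j)"
proof
  have *: "length s < k \<or> length s = k \<and> init_sign s = Some Minus" if "s \<in> Alt \<phi>" for s
  proof (cases "init_sign s = Some Minus")
    case True
    then show ?thesis using assms that by (auto simp: U_le_def)
  next
    case False
    then have "Minus # s \<in> Alt (FAll \<phi>)" using that by auto
    then have "length (Minus # s) \<le> k" using assms unfolding U_le_def by fastforce
    then show ?thesis by simp
  qed
  then show "U_le k \<phi>" by (fastforce simp: U_le_def)
  obtain s where "s \<in> Alt \<phi>" using Alt_nonempty by blast
  then show "\<exists>j. k = Suc j" using *[of s] by (cases k; cases s) auto
qed

lemma E_le_Ex:
  assumes "E_le k (FEx \<phi>)"
  shows "E_le k \<phi> \<and> (\<exists>j. k = Suc j)"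
proof
  have *: "length s < k \<or> length s = k \<and> init_sign s = Some Plus" if "s \<in> Alt \<phi>" for s
  proof (cases "init_sign s = Some Plus")
    case True
    then show ?thesis using assms that by (auto simp: E_le_def)
  next
    case False
    then have "Plus # s \<in> Alt (FEx \<phi>)" using that by auto
    then have "length (Plus # s) \<le> k" using assms unfolding E_le_def by fastforce
    then show ?thesis by simp
  qed
  then show "E_le k \<phi>" by (fastforce simp: E_le_def)
  obtain s where "s \<in> Alt \<phi>" using Alt_nonempty by blast
  then show "\<exists>j. k = Suc j" using *[of s] by (cases k; cases s) auto
qed

text \<open>All paths of an existential formula start with \<open>Plus\<close>, which
  \<open>U_le k\<close> forbids at length \<open>k\<close>; so all are shorter and the formula falls
  one level.\<close>

lemma U_le_Ex:
  assumes "U_le k (FEx \<phi>)"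
  shows "\<exists>j. k = Suc j \<and> E_le j (FEx \<phi>)"
proof -
  have *: "length s < k \<and> init_sign s = Some Plus" if "s \<in> Alt (FEx \<phi>)" for s
    using assms that by (auto simp: U_le_def)
  obtain s where "s \<in> Alt (FEx \<phi>)" using Alt_nonempty by blast
  then obtain j where "k = Suc j" using *[of s] by (cases k) auto
  moreover have "E_le j (FEx \<phi>)" unfolding E_le_def
    using * calculation by (metis less_Suc_eq option.inject sign.distinct(1))
  ultimately show ?thesis by blast
qed

lemma E_le_All:
  assumes "E_le k (FAll \<phi>)"
  shows "\<exists>j. k = Suc j \<and> U_le j (FAll \<phi>)"
proof -
  have *: "length s < k \<and> init_sign s = Some Minus" if "s \<in> Alt (FAll \<phi>)" for s
    using assms that by (auto simp: E_le_def)
  obtain s where "s \<in> Alt (FAll \<phi>)" using Alt_nonempty by blast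
  then obtain j where "k = Suc j" using *[of s] by (cases k) auto
  moreover have "U_le j (FAll \<phi>)" unfolding U_le_def
    using * calculation by (metis less_Suc_eq option.inject sign.distinct(1))
  ultimately show ?thesis by blast
qed

lemma length_le_deg: "s \<in> Alt \<phi> \<Longrightarrow> length s \<le> deg \<phi>"
  by (simp add: deg_def finite_Alt)

lemma U_cl_U_le: "\<phi> \<in> U_cl k \<Longrightarrow> U_le k \<phi>"
  using length_le_deg[of _ \<phi>] by (cases k) (fastforce simp: F_cl_def U_le_def)+

lemma E_cl_E_le: "\<phi> \<in> E_cl k \<Longrightarrow> E_le k \<phi>"
  using length_le_deg[of _ \<phi>] by (cases k) (fastforce simp: F_cl_def E_le_def)+

text \<open>The level varies in the induction because a quantifier of the kind opposite to the class
  drops the formula one level, where the claim for its own kind applies.\<close>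

theorem prenex_PA:
  assumes "or_free \<phi>"
  shows "(U_le k \<phi> \<longrightarrow> (\<exists>\<pi>\<in>Pi_cl k. FV \<pi> = FV \<phi> \<and> eqv PA \<phi> \<pi>)) \<and>
    (E_le k \<phi> \<longrightarrow> (\<exists>\<sigma>\<in>Sigma_cl k. FV \<sigma> = FV \<phi> \<and> eqv PA \<phi> \<sigma>))"
  using assms
proof (induction \<phi> arbitrary: k)
  case (FEq s t)
  have "qf (FEq s t)" by simp
  then show ?case using qf_Pi qf_Sigma eqv_refl by metis
next
  case FBot
  have "qf FBot" by simp
  then show ?case using qf_Pi qf_Sigma eqv_refl by metis
next
  case (FImp \<phi> \<psi>)
  have "\<exists>\<pi>\<in>Pi_cl k. FV \<pi> = FV (FImp \<phi> \<psi>) \<and> eqv PA (FImp \<phi> \<psi>) \<pi>" if U: "U_le k (FImp \<phi> \<psi>)"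
  proof -
    obtain a b where a: "a \<in> Sigma_cl k" "FV a = FV \<phi>" "eqv PA \<phi> a"
      and b: "b \<in> Pi_cl k" "FV b = FV \<psi>" "eqv PA \<psi> b"
      using FImp U_le_Imp[OF U] by (metis or_free.simps(3))
    obtain c where c: "c \<in> Pi_cl k" "FV c = FV a \<union> FV b" "eqv PA (FImp a b) c"
      using Pi_Imp[OF a(1) b(1)] by blast
    have "eqv PA (FImp \<phi> \<psi>) c" by (rule eqv_trans[OF eqv_Imp[OF a(3) b(3)] c(3)])
    then show ?thesis using a(2) b(2) c(1,2) by (metis FV.simps(3))
  qed
  moreover have "\<exists>\<sigma>\<in>Sigma_cl k. FV \<sigma> = FV (FImp \<phi> \<psi>) \<and> eqv PA (FImp \<phi> \<psi>) \<sigma>"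
    if E: "E_le k (FImp \<phi> \<psi>)"
  proof -
    obtain a b where a: "a \<in> Pi_cl k" "FV a = FV \<phi>" "eqv PA \<phi> a"
      and b: "b \<in> Sigma_cl k" "FV b = FV \<psi>" "eqv PA \<psi> b"
      using FImp E_le_Imp[OF E] by (metis or_free.simps(3))
    obtain c where c: "c \<in> Sigma_cl k" "FV c = FV a \<union> FV b" "eqv PA (FImp a b) c"
      using Sigma_Imp[OF a(1) b(1)] by blast
    have "eqv PA (FImp \<phi> \<psi>) c" by (rule eqv_trans[OF eqv_Imp[OF a(3) b(3)] c(3)])
    then show ?thesis using a(2) b(2) c(1,2) by (metis FV.simps(3))
  qed
  ultimately show ?case by blast
next
  case (FAnd \<phi> \<psi>)
  have "\<exists>\<pi>\<in>Pi_cl k. FV \<pi> = FV (FAnd \<phi> \<psi>) \<and> eqv PA (FAnd \<phi> \<psi>) \<pi>" if U: "U_le k (FAnd \<phi> \<psi>)"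
  proof -
    obtain a b where a: "a \<in> Pi_cl k" "FV a = FV \<phi>" "eqv PA \<phi> a"
      and b: "b \<in> Pi_cl k" "FV b = FV \<psi>" "eqv PA \<psi> b"
      using FAnd U_le_And[OF U] by (metis or_free.simps(4))
    obtain c where c: "c \<in> Pi_cl k" "FV c = FV a \<union> FV b" "eqv PA c (FAnd a b)"
      using Sigma_Pi_And a(1) b(1) by metis
    have "eqv PA (FAnd \<phi> \<psi>) c" by (rule eqv_trans[OF eqv_And[OF a(3) b(3)] eqv_sym[OF c(3)]])
    then show ?thesis using a(2) b(2) c(1,2) by (metis FV.simps(4))
  qed
  moreover have "\<exists>\<sigma>\<in>Sigma_cl k. FV \<sigma> = FV (FAnd \<phi> \<psi>) \<and> eqv PA (FAnd \<phi> \<psi>) \<sigma>"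
    if E: "E_le k (FAnd \<phi> \<psi>)"
  proof -
    obtain a b where a: "a \<in> Sigma_cl k" "FV a = FV \<phi>" "eqv PA \<phi> a"
      and b: "b \<in> Sigma_cl k" "FV b = FV \<psi>" "eqv PA \<psi> b"
      using FAnd E_le_And[OF E] by (metis or_free.simps(4))
    obtain c where c: "c \<in> Sigma_cl k" "FV c = FV a \<union> FV b" "eqv PA c (FAnd a b)"
      using Sigma_Pi_And a(1) b(1) by metis
    have "eqv PA (FAnd \<phi> \<psi>) c" by (rule eqv_trans[OF eqv_And[OF a(3) b(3)] eqv_sym[OF c(3)]])
    then show ?thesis using a(2) b(2) c(1,2) by (metis FV.simps(4))
  qed
  ultimately show ?case by blast
next
  case (FOr \<phi> \<psi>)
  then show ?case by simp
next
  case (FAll \<phi>)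
  have U: "\<exists>\<pi>\<in>Pi_cl k. FV \<pi> = FV (FAll \<phi>) \<and> eqv PA (FAll \<phi>) \<pi>" if hU: "U_le k (FAll \<phi>)" for k
  proof -
    obtain \<pi> j where \<pi>: "\<pi> \<in> Pi_cl k" "FV \<pi> = FV \<phi>" "eqv PA \<phi> \<pi>" "k = Suc j"
      using FAll U_le_All[OF hU] by (metis or_free.simps(6))
    have "FV (FAll \<pi>) = FV (FAll \<phi>)" using \<pi>(2) by simp
    then show ?thesis using FAll_Pi[of \<pi> j] eqv_All[OF \<pi>(3)] \<pi>(1,4) by metis
  qed
  moreover have "\<exists>\<sigma>\<in>Sigma_cl k. FV \<sigma> = FV (FAll \<phi>) \<and> eqv PA (FAll \<phi>) \<sigma>" if "E_le k (FAll \<phi>)"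
    using E_le_All[OF that] U Pi_subset_Sigma by metis
  ultimately show ?case by blast
next
  case (FEx \<phi>)
  have E: "\<exists>\<sigma>\<in>Sigma_cl k. FV \<sigma> = FV (FEx \<phi>) \<and> eqv PA (FEx \<phi>) \<sigma>" if hE: "E_le k (FEx \<phi>)" for k
  proof -
    obtain \<sigma> j where \<sigma>: "\<sigma> \<in> Sigma_cl k" "FV \<sigma> = FV \<phi>" "eqv PA \<phi> \<sigma>" "k = Suc j"
      using FEx E_le_Ex[OF hE] by (metis or_free.simps(7))
    have "FV (FEx \<sigma>) = FV (FEx \<phi>)" using \<sigma>(2) by simp
    then show ?thesis using FEx_Sigma[of \<sigma> j] eqv_Ex[OF \<sigma>(3)] \<sigma>(1,4) by metis
  qed
  moreover have "\<exists>\<pi>\<in>Pi_cl k. FV \<pi> = FV (FEx \<phi>) \<and> eqv PA (FEx \<phi>) \<pi>" if "U_le k (FEx \<phi>)"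
    using U_le_Ex[OF that] E Sigma_subset_Pi by metis
  ultimately show ?case by blast
qed

subsection \<open>Theories with double negation elimination for \<open>\<Sigma>\<^sub>n\<close>\<close>

lemma eqv_Or_Bot: "eqv T (FOr \<phi> FBot) \<phi>"
  unfolding eqv_def by (reify ipc_eqs) (rule ipc_prv, code_simp)

lemma eqv_nn_Or:
  assumes "prv T {} (FOr \<phi> (FNeg \<phi>))"
  shows "eqv T (nn A (FOr \<phi> A)) (FOr \<phi> A)"
  unfolding eqv_def by (rule prv_mp1[OF assms], reify ipc_eqs) (rule ipc_prv, code_simp)

lemma eqv_nn: "eqv T \<phi> \<psi> \<Longrightarrow> eqv T (nn A \<phi>) (nn A \<psi>)"
  by (intro eqv_Imp eqv_refl)

text \<open>For decidable \<open>\<phi>\<close>, double negation relative to \<open>A\<close>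
  amounts to a disjunction with \<open>A\<close>.\<close>

lemma qf_tr: "qf \<phi> \<Longrightarrow> eqv HA (tr \<phi> A) (FOr \<phi> A)"
proof (induction \<phi>)
  case (FEq s t)
  show ?case unfolding eqv_def tr.simps
    by (rule prv_mp1[OF qf_decidable[OF FEq]], reify ipc_eqs) (rule ipc_prv, code_simp)
next
  case FBot
  show ?case unfolding eqv_def tr.simps by (reify ipc_eqs) (rule ipc_prv, code_simp)
next
  case (FImp \<phi> \<psi>)
  then have "eqv HA (tr (FImp \<phi> \<psi>) A) (FImp (FOr \<phi> A) (FOr \<psi> A))" by (simp add: eqv_Imp)
  moreover have "prv HA {} (FOr \<phi> (FNeg \<phi>))" using FImp.prems by (simp add: qf_decidable)
  then have "eqv HA (FImp (FOr \<phi> A) (FOr \<psi> A)) (FOr (FImp \<phi> \<psi>) A)"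
    unfolding eqv_def by (rule prv_mp1) (reify ipc_eqs, rule ipc_prv, code_simp)
  ultimately show ?case by (rule eqv_trans)
next
  case (FAnd \<phi> \<psi>)
  then have "eqv HA (tr (FAnd \<phi> \<psi>) A) (FAnd (FOr \<phi> A) (FOr \<psi> A))" by (simp add: eqv_And)
  moreover have "eqv HA (FAnd (FOr \<phi> A) (FOr \<psi> A)) (FOr (FAnd \<phi> \<psi>) A)"
    unfolding eqv_def by (reify ipc_eqs) (rule ipc_prv, code_simp)
  ultimately show ?case by (rule eqv_trans)
next
  case (FOr \<phi> \<psi>)
  then have "eqv HA (tr (FOr \<phi> \<psi>) A) (nn A (FOr (FOr \<phi> A) (FOr \<psi> A)))"
    by (simp add: eqv_Or eqv_nn)
  moreover have "eqv HA (FOr (FOr \<phi> A) (FOr \<psi> A)) (FOr (FOr \<phi> \<psi>) A)"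
    unfolding eqv_def by (reify ipc_eqs) (rule ipc_prv, code_simp)
  then have "eqv HA (nn A (FOr (FOr \<phi> A) (FOr \<psi> A))) (nn A (FOr (FOr \<phi> \<psi>) A))" by (rule eqv_nn)
  moreover have "eqv HA (nn A (FOr (FOr \<phi> \<psi>) A)) (FOr (FOr \<phi> \<psi>) A)"
    by (rule eqv_nn_Or[OF qf_decidable[OF FOr.prems]])
  ultimately show ?case by (blast intro: eqv_trans[of HA])
qed simp_all

abbreviation gg :: "fm \<Rightarrow> fm" where "gg \<phi> \<equiv> tr \<phi> FBot"

lemma PA_eqv_gg: "eqv PA \<phi> \<psi> \<Longrightarrow> eqv HA (gg \<phi>) (gg \<psi>)"
  unfolding eqv_def using tr_PA[of "{}" "FIff \<phi> \<psi>" FBot] by simp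

lemma gg_stable: "eqv T (FNeg (FNeg (gg \<phi>))) (gg \<phi>)"
  unfolding eqv_def
  by (rule prv_mp1[OF nn_stable[of T _ \<phi> FBot]], reify ipc_eqs) (rule ipc_prv, code_simp)

lemma eqv_nn_Imp:
  "eqv T (FNeg (FNeg (FImp \<phi> \<psi>))) (FImp (FNeg (FNeg \<phi>)) (FNeg (FNeg \<psi>)))"
  unfolding eqv_def by (reify ipc_eqs) (rule ipc_prv, code_simp)

lemma eqv_nn_And:
  "eqv T (FNeg (FNeg (FAnd \<phi> \<psi>))) (FAnd (FNeg (FNeg \<phi>)) (FNeg (FNeg \<psi>)))"
  unfolding eqv_def by (reify ipc_eqs) (rule ipc_prv, code_simp)

lemma eqv_Neg3: "eqv T (FNeg (FNeg (FNeg \<phi>))) (FNeg \<phi>)"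
  unfolding eqv_def by (reify ipc_eqs) (rule ipc_prv, code_simp)

lemma eqv_nn_Ex: "eqv T (FNeg (FNeg (FEx \<phi>))) (FNeg (FNeg (FEx (FNeg (FNeg \<phi>)))))"
proof (rule eqv_Neg)
  have "eqv T (FNeg (FEx \<phi>)) (FAll (FNeg \<phi>))" by (rule eqv_Neg_Ex)
  also have "eqv T (FAll (FNeg \<phi>)) (FAll (FNeg (FNeg (FNeg \<phi>))))"
    by (rule eqv_All[OF eqv_sym[OF eqv_Neg3]])
  also have "eqv T (FAll (FNeg (FNeg (FNeg \<phi>)))) (FNeg (FEx (FNeg (FNeg \<phi>))))"
    by (rule eqv_sym[OF eqv_Neg_Ex])
  finally show "eqv T (FNeg (FEx \<phi>)) (FNeg (FEx (FNeg (FNeg \<phi>))))" .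
qed

locale HA_extension =
  fixes S :: "fm set"
  assumes HA: "\<chi> \<in> HA \<Longrightarrow> prv S {} \<chi>"
begin

lemma HA_prv: "prv HA \<Gamma> \<phi> \<Longrightarrow> prv S \<Gamma> \<phi>"
  by (erule prv_theory_mono) (rule HA)

lemma HA_eqv: "eqv HA \<phi> \<psi> \<Longrightarrow> eqv S \<phi> \<psi>"
  by (erule eqv_theory_mono) (rule HA)

lemma qf_gg: "qf \<phi> \<Longrightarrow> eqv S (gg \<phi>) \<phi>"
  by (rule eqv_trans[OF HA_eqv[OF qf_tr] eqv_Or_Bot])

end

text \<open>Here \<open>\<sigma>\<close> may have any number of parameters; the passage from the
  one-variable schema is made by \<open>DNE_parameters\<close>.\<close>

locale DNE_theory = HA_extension +
  fixes n :: nat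
  assumes DNE: "\<sigma> \<in> Sigma_cl n \<Longrightarrow> prv S {} (FImp (FNeg (FNeg \<sigma>)) \<sigma>)"
begin

lemma Sigma_stable: "\<sigma> \<in> Sigma_cl n \<Longrightarrow> eqv S (FNeg (FNeg \<sigma>)) \<sigma>"
  unfolding eqv_def by (drule DNE, erule prv_mp1, reify ipc_eqs) (rule ipc_prv, code_simp)

lemma gg_All: "eqv S (gg \<phi>) \<phi> \<Longrightarrow> eqv S (gg (FAll \<phi>)) (FAll \<phi>)"
  by (simp add: eqv_All)

lemma gg_Ex:
  assumes "eqv S (gg \<phi>) \<phi>" "FEx \<phi> \<in> Sigma_cl n"
  shows "eqv S (gg (FEx \<phi>)) (FEx \<phi>)"
  using eqv_trans[OF eqv_nn[OF eqv_Ex[OF assms(1)]] Sigma_stable[OF assms(2)]] by simp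

text \<open>The translation adds double negations in front of \<open>\<exists>\<close>, and there
  \<open>DNE\<close> removes them, working outwards from the matrix.\<close>

lemma Sigma_Pi_gg:
  "j \<le> n \<Longrightarrow> (\<phi> \<in> Sigma_cl j \<longrightarrow> eqv S (gg \<phi>) \<phi>) \<and> (\<phi> \<in> Pi_cl j \<longrightarrow> eqv S (gg \<phi>) \<phi>)"
proof (induction j arbitrary: \<phi>)
  case 0
  then show ?case by (simp add: qf_gg)
next
  case (Suc j)
  have "eqv S (gg \<phi>) \<phi>" if "\<phi> \<in> Sigma_cl (Suc j)"
    using that
  proof (induction rule: Sigma_Suc_induct)
    case (Pi \<phi>)
    then show ?case using Suc by simp
  next
    case (Ex \<phi>)
    then show ?case using gg_Ex FEx_Sigma Sigma_mono[OF Suc.prems] by blast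
  qed
  moreover have "eqv S (gg \<phi>) \<phi>" if "\<phi> \<in> Pi_cl (Suc j)"
    using that by (induction rule: Pi_Suc_induct) (use Suc gg_All in auto)
  ultimately show ?case by blast
qed

lemma Sigma_gg: "\<phi> \<in> Sigma_cl n \<Longrightarrow> eqv S (gg \<phi>) \<phi>"
  using Sigma_Pi_gg by blast

text \<open>\<open>tr\<close> leaves \<open>\<forall>\<close> untouched, so one further universal
  block comes for free. This accounts for the gap between \<open>\<Pi>\<close> at level
  \<open>k\<close> and \<open>DNE\<close> for \<open>\<Sigma>\<close> at level
  \<open>k - 1\<close>.\<close>

lemma Pi_gg: "\<phi> \<in> Pi_cl (Suc n) \<Longrightarrow> eqv S (gg \<phi>) \<phi>"
  by (induction rule: Pi_Suc_induct) (use Sigma_gg gg_All in auto)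

lemma PA_Sigma: "eqv PA \<phi> \<sigma> \<Longrightarrow> \<sigma> \<in> Sigma_cl n \<Longrightarrow> eqv S (gg \<phi>) \<sigma>"
  by (rule eqv_trans[OF HA_eqv[OF PA_eqv_gg] Sigma_gg])

lemma PA_Pi: "eqv PA \<phi> \<pi> \<Longrightarrow> \<pi> \<in> Pi_cl (Suc n) \<Longrightarrow> eqv S (gg \<phi>) \<pi>"
  by (rule eqv_trans[OF HA_eqv[OF PA_eqv_gg] Pi_gg])

text \<open>Double negation commutes with every connective but \<open>\<forall>\<close>. A universal formula in
  \<open>E_le (Suc n)\<close>, and an existential one in \<open>U_le (Suc n)\<close>, has degree at most \<open>n\<close>: this
  saves the case of \<open>\<forall>\<close>, and in the case of \<open>\<exists>\<close> lets \<open>DNE(\<Sigma>\<^sub>n)\<close> apply to a prenex form.\<close>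

theorem gg_U_E:
  assumes "or_free \<phi>"
  shows "(U_le (Suc n) \<phi> \<longrightarrow> eqv S (gg \<phi>) \<phi>) \<and> (E_le (Suc n) \<phi> \<longrightarrow> eqv S (gg \<phi>) (FNeg (FNeg \<phi>)))"
  using assms
proof (induction \<phi>)
  case (FEq s t)
  have "eqv S (gg (FEq s t)) (FEq s t)" by (rule qf_gg) simp
  then show ?case by simp
next
  case FBot
  have "eqv S FBot (FNeg (FNeg FBot))"
    unfolding eqv_def by (reify ipc_eqs) (rule ipc_prv, code_simp)
  then show ?case by simp
next
  case (FImp \<phi> \<psi>)
  then have or: "or_free \<phi>" "or_free \<psi>" by auto
  have "eqv S (gg (FImp \<phi> \<psi>)) (FImp \<phi> \<psi>)" if "U_le (Suc n) (FImp \<phi> \<psi>)"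
  proof -
    have \<phi>: "eqv S (gg \<phi>) (FNeg (FNeg \<phi>))" and \<psi>: "eqv S (gg \<psi>) \<psi>"
      using FImp.IH or U_le_Imp[OF that] by blast+
    have *: "eqv S (FNeg (FNeg \<psi>)) \<psi>"
      by (rule eqv_trans[OF eqv_trans[OF eqv_Neg[OF eqv_Neg[OF eqv_sym[OF \<psi>]]] gg_stable] \<psi>])
    have "eqv S (FImp (FNeg (FNeg \<phi>)) \<psi>) (FImp \<phi> \<psi>)"
      using * unfolding eqv_def by (rule prv_mp1) (reify ipc_eqs, rule ipc_prv, code_simp)
    then show ?thesis using eqv_trans[OF eqv_Imp[OF \<phi> \<psi>]] by simp
  qed
  moreover have "eqv S (gg (FImp \<phi> \<psi>)) (FNeg (FNeg (FImp \<phi> \<psi>)))" if "E_le (Suc n) (FImp \<phi> \<psi>)"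
  proof -
    have \<phi>: "eqv S (gg \<phi>) \<phi>" and \<psi>: "eqv S (gg \<psi>) (FNeg (FNeg \<psi>))"
      using FImp.IH or E_le_Imp[OF that] by blast+
    have "eqv S (gg \<phi>) (FNeg (FNeg \<phi>))"
      by (rule eqv_trans[OF eqv_sym[OF gg_stable] eqv_Neg[OF eqv_Neg[OF \<phi>]]])
    then show ?thesis using eqv_trans[OF eqv_Imp[OF _ \<psi>] eqv_sym[OF eqv_nn_Imp]] by simp
  qed
  ultimately show ?case by blast
next
  case (FAnd \<phi> \<psi>)
  then have or: "or_free \<phi>" "or_free \<psi>" by auto
  have "eqv S (gg (FAnd \<phi> \<psi>)) (FAnd \<phi> \<psi>)" if "U_le (Suc n) (FAnd \<phi> \<psi>)"
    using FAnd.IH or U_le_And[OF that] by (simp add: eqv_And)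
  moreover have "eqv S (gg (FAnd \<phi> \<psi>)) (FNeg (FNeg (FAnd \<phi> \<psi>)))" if "E_le (Suc n) (FAnd \<phi> \<psi>)"
  proof -
    have \<phi>: "eqv S (gg \<phi>) (FNeg (FNeg \<phi>))" and \<psi>: "eqv S (gg \<psi>) (FNeg (FNeg \<psi>))"
      using FAnd.IH or E_le_And[OF that] by blast+
    show ?thesis using eqv_trans[OF eqv_And[OF \<phi> \<psi>] eqv_sym[OF eqv_nn_And]] by simp
  qed
  ultimately show ?case by blast
next
  case (FOr \<phi> \<psi>)
  then show ?case by simp
next
  case (FAll \<phi>)
  then have or: "or_free \<phi>" by simp
  have U: "eqv S (gg (FAll \<phi>)) (FAll \<phi>)" if "U_le (Suc n) (FAll \<phi>)"
    using FAll.IH or U_le_All[OF that] gg_All by blast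
  moreover have "eqv S (gg (FAll \<phi>)) (FNeg (FNeg (FAll \<phi>)))" if "E_le (Suc n) (FAll \<phi>)"
  proof -
    have "U_le (Suc n) (FAll \<phi>)" using E_le_All[OF that] U_le_mono[of n _ "Suc n"] by auto
    then show ?thesis
      using eqv_trans[OF eqv_sym[OF gg_stable[of S "FAll \<phi>"]] eqv_Neg[OF eqv_Neg[OF U]]] by simp
  qed
  ultimately show ?case by blast
next
  case (FEx \<phi>)
  then have or: "or_free \<phi>" by simp
  have "eqv S (gg (FEx \<phi>)) (FEx \<phi>)" if "U_le (Suc n) (FEx \<phi>)"
  proof -
    have E: "E_le n (FEx \<phi>)" using U_le_Ex[OF that] by auto
    then have "U_le (Suc n) \<phi>" using E_le_Ex E_le_U_le by blast
    then have \<phi>: "eqv S (gg \<phi>) \<phi>" using FEx.IH or by blast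
    obtain j where j: "n = Suc j" using E_le_Ex[OF E] by blast
    \<comment> \<open>The prenex form is first only classical. As \<open>S\<close> proves both
      \<open>\<phi>\<close> and \<open>\<sigma>\<close> equivalent to their translations, it becomes
      a prenex form in \<open>S\<close>, and \<open>DNE\<close> applies to
      \<open>FEx \<sigma>\<close>.\<close>
    obtain \<sigma> where \<sigma>: "\<sigma> \<in> Sigma_cl n" "eqv PA \<phi> \<sigma>"
      using prenex_PA[OF or] E_le_Ex[OF E] by blast
    have "eqv S \<phi> \<sigma>" by (rule eqv_trans[OF eqv_sym[OF \<phi>] PA_Sigma[OF \<sigma>(2,1)]])
    then have ex: "eqv S (FEx \<phi>) (FEx \<sigma>)" by (rule eqv_Ex)
    have "FEx \<sigma> \<in> Sigma_cl n" using \<sigma>(1) FEx_Sigma j by simp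
    then have "eqv S (FNeg (FNeg (FEx \<phi>))) (FEx \<phi>)"
      by (rule eqv_trans[OF eqv_trans[OF eqv_Neg[OF eqv_Neg[OF ex]] Sigma_stable] eqv_sym[OF ex]])
    then show ?thesis using eqv_trans[OF eqv_Neg[OF eqv_Neg[OF eqv_Ex[OF \<phi>]]]] by simp
  qed
  moreover have "eqv S (gg (FEx \<phi>)) (FNeg (FNeg (FEx \<phi>)))" if "E_le (Suc n) (FEx \<phi>)"
  proof -
    have "eqv S (gg \<phi>) (FNeg (FNeg \<phi>))" using FEx.IH or E_le_Ex[OF that] by blast
    then show ?thesis
      using eqv_trans[OF eqv_Neg[OF eqv_Neg[OF eqv_Ex]] eqv_sym[OF eqv_nn_Ex]] by simp
  qed
  ultimately show ?case by blast
qed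

text \<open>A chain of equivalences in \<open>S\<close>: from \<open>\<phi>\<close> to
  \<open>gg \<phi>\<close>, by the classical normal form to \<open>gg \<pi>\<close>, and back to
  \<open>\<pi>\<close>.\<close>

lemma U_prenex:
  assumes "or_free \<phi>" "U_le k \<phi>" "k \<le> Suc n"
  obtains \<pi> where "\<pi> \<in> Pi_cl k" "FV \<pi> = FV \<phi>" "eqv S \<phi> \<pi>"
proof -
  obtain \<pi> where \<pi>: "\<pi> \<in> Pi_cl k" "FV \<pi> = FV \<phi>" "eqv PA \<phi> \<pi>"
    using prenex_PA assms(1,2) by blast
  have "eqv S \<phi> (gg \<phi>)"
    using gg_U_E[OF assms(1)] U_le_mono[OF assms(2,3)] eqv_sym by blast
  moreover have "eqv S (gg \<phi>) \<pi>" using PA_Pi[OF \<pi>(3)] \<pi>(1) Pi_mono[OF assms(3)] by blast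
  ultimately show ?thesis using that \<pi> eqv_trans by blast
qed

end

subsection \<open>Conservation over theories deciding \<open>\<Sigma>\<^sub>n\<close>\<close>

lemma eqv_Ex_Or: "eqv T (FEx (FOr \<phi> (lift \<psi>))) (FOr (FEx \<phi>) \<psi>)"
proof (rule eqvI)
  let ?\<Gamma> = "lift ` {FEx (FOr \<phi> (lift \<psi>))}"
  have "prv T (insert (FOr \<phi> (lift \<psi>)) ?\<Gamma>) (FOr (lift (FEx \<phi>)) (lift \<psi>))"
  proof (rule OrE)
    show "prv T (insert \<phi> (insert (FOr \<phi> (lift \<psi>)) ?\<Gamma>)) (FOr (lift (FEx \<phi>)) (lift \<psi>))"
      by (rule OrI1, rule prv_lift_ExI) (simp add: Hyp)
    show "prv T (insert (lift \<psi>) (insert (FOr \<phi> (lift \<psi>)) ?\<Gamma>)) (FOr (lift (FEx \<phi>)) (lift \<psi>))"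
      by (rule OrI2) (simp add: Hyp)
  qed (simp add: Hyp)
  then have "prv T (insert (FOr \<phi> (lift \<psi>)) ?\<Gamma>) (lift (FOr (FEx \<phi>) \<psi>))" by simp
  then show "prv T {FEx (FOr \<phi> (lift \<psi>))} (FOr (FEx \<phi>) \<psi>)"
    by (rule ExE[OF Hyp, rotated]) simp
next
  show "prv T {FOr (FEx \<phi>) \<psi>} (FEx (FOr \<phi> (lift \<psi>)))"
  proof (rule OrE)
    show "prv T {FEx \<phi>, FOr (FEx \<phi>) \<psi>} (FEx (FOr \<phi> (lift \<psi>)))"
      by (rule prv_Ex_mono, rule OrI1) (simp add: Hyp)
    show "prv T {\<psi>, FOr (FEx \<phi>) \<psi>} (FEx (FOr \<phi> (lift \<psi>)))"
      by (rule ExI[of _ _ _ zero]) (simp add: OrI2 Hyp)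
  qed (simp add: Hyp)
qed

text \<open>Moving \<open>\<psi>\<close> out of the scope of \<open>\<forall>\<close> is not
  intuitionistically valid in general. The hypothesis decides it: either \<open>\<phi>\<close> holds
  throughout, or a counterexample forces \<open>\<psi>\<close>.\<close>

lemma eqv_All_Or:
  assumes "prv T {} (FOr (FAll \<phi>) (FEx (FNeg \<phi>)))"
  shows "eqv T (FAll (FOr \<phi> (lift \<psi>))) (FOr (FAll \<phi>) \<psi>)"
proof (rule eqvI)
  let ?D = "FAll (FOr \<phi> (lift \<psi>))"
  show "prv T {?D} (FOr (FAll \<phi>) \<psi>)"
  proof (rule OrE[OF prv_mono[OF assms]])
    show "prv T {FAll \<phi>, ?D} (FOr (FAll \<phi>) \<psi>)" by (rule OrI1) (simp add: Hyp)
    let ?\<Gamma> = "insert (FNeg \<phi>) (lift ` {FEx (FNeg \<phi>), ?D})"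
    have "prv T ?\<Gamma> (FOr \<phi> (lift \<psi>))" by (rule prv_lift_AllE) (simp add: Hyp)
    moreover have "prv T ?\<Gamma> (FNeg \<phi>)" by (simp add: Hyp)
    ultimately have "prv T ?\<Gamma> (lift \<psi>)"
      by (rule prv_mp2) (reify ipc_eqs, rule ipc_prv, code_simp)
    then have "prv T {FEx (FNeg \<phi>), ?D} \<psi>" by (rule ExE[OF Hyp, rotated]) simp
    then show "prv T {FEx (FNeg \<phi>), ?D} (FOr (FAll \<phi>) \<psi>)" by (rule OrI2)
  qed simp
next
  show "prv T {FOr (FAll \<phi>) \<psi>} (FAll (FOr \<phi> (lift \<psi>)))"
  proof (rule OrE)
    show "prv T {FAll \<phi>, FOr (FAll \<phi>) \<psi>} (FAll (FOr \<phi> (lift \<psi>)))"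
      by (rule prv_All_mono, rule OrI1) (simp add: Hyp)
    show "prv T {\<psi>, FOr (FAll \<phi>) \<psi>} (FAll (FOr \<phi> (lift \<psi>)))"
      by (rule AllI, rule OrI2) (simp add: Hyp)
  qed (simp add: Hyp)
qed

locale LEM_theory = DNE_theory +
  assumes LEM: "\<sigma> \<in> Sigma_cl n \<Longrightarrow> prv S {} (FOr \<sigma> (FNeg \<sigma>))"
begin

text \<open>Excluded middle is applied to the \<open>\<Sigma>\<close> form of
  \<open>\<exists>x. \<not> \<phi>\<close>, obtained classically and transferred through
  \<open>gg\<close>. In the negative case stability of \<open>\<phi>\<close> gives
  \<open>\<forall>x. \<phi>\<close>.\<close>

lemma Pi_counterexample:
  assumes "FAll \<phi> \<in> Pi_cl (Suc j)" "\<phi> \<in> Pi_cl (Suc j)" "Suc j \<le> n"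
  shows "prv S {} (FOr (FAll \<phi>) (FEx (FNeg \<phi>)))"
proof -
  have "Suc j \<le> Suc n" using assms(3) by simp
  then have n: "\<phi> \<in> Pi_cl (Suc n)" using assms(2) Pi_mono by blast
  obtain \<sigma> where \<sigma>: "\<sigma> \<in> Sigma_cl (Suc j)" "eqv PA (FNeg \<phi>) \<sigma>"
    using Sigma_Pi_Neg assms(2) by blast
  then have "eqv S (gg (FNeg \<phi>)) \<sigma>" using PA_Sigma Sigma_mono[OF assms(3)] by blast
  then have neg: "eqv S (FNeg \<phi>) \<sigma>"
    using eqv_trans[OF eqv_sym[OF eqv_Neg[OF Pi_gg[OF n]]]] by simp
  have stable: "eqv S (FNeg (FNeg \<phi>)) \<phi>"
    by (rule eqv_trans[OF eqv_trans[OF eqv_Neg[OF eqv_Neg[OF eqv_sym[OF Pi_gg[OF n]]]] gg_stable]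
          Pi_gg[OF n]])
  have "FEx \<sigma> \<in> Sigma_cl n" using FEx_Sigma[OF \<sigma>(1)] Sigma_mono[OF assms(3)] by blast
  then have "prv S {} (FOr (FEx \<sigma>) (FNeg (FEx \<sigma>)))" by (rule LEM)
  moreover have "eqv S (FEx \<sigma>) (FEx (FNeg \<phi>))" by (rule eqv_sym[OF eqv_Ex[OF neg]])
  moreover have "eqv S (FNeg (FEx \<sigma>)) (FAll \<phi>)"
    by (rule eqv_trans[OF eqv_trans[OF eqv_Neg[OF eqv_sym[OF eqv_Ex[OF neg]]] eqv_Neg_Ex]
          eqv_All[OF stable]])
  ultimately have "prv S {} (FOr (FEx (FNeg \<phi>)) (FAll \<phi>))" using eqvD1[OF eqv_Or] by blast
  then show ?thesis by (rule prv_mp1) (reify ipc_eqs, rule ipc_prv, code_simp)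
qed

text \<open>For \<open>\<exists>\<close>, the disjunct \<open>A\<close> moves out of the scope and
  \<open>LEM\<close> removes the relative double negation; for \<open>\<forall>\<close>, the shift
  of \<open>A\<close> is justified by \<open>Pi_counterexample\<close>.\<close>

lemma tr_decidable:
  "j \<le> n \<Longrightarrow> (\<phi> \<in> Sigma_cl j \<longrightarrow> eqv S (tr \<phi> A) (FOr \<phi> A)) \<and> (\<phi> \<in> Pi_cl j \<longrightarrow> eqv S (tr \<phi> A) (FOr \<phi> A))"
proof (induction j arbitrary: \<phi> A)
  case 0
  then show ?case by (simp add: HA_eqv[OF qf_tr])
next
  case (Suc j)
  have "eqv S (tr \<phi> A) (FOr \<phi> A)" if "\<phi> \<in> Sigma_cl (Suc j)"
    using that
  proof (induction arbitrary: A rule: Sigma_Suc_induct)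
    case (Pi \<phi>)
    then show ?case using Suc by simp
  next
    case (Ex \<phi>)
    have "prv S {} (FOr (FEx \<phi>) (FNeg (FEx \<phi>)))"
      using LEM FEx_Sigma[OF Ex.hyps] Sigma_mono[OF Suc.prems] by blast
    then have "eqv S (nn A (FOr (FEx \<phi>) A)) (FOr (FEx \<phi>) A)" by (rule eqv_nn_Or)
    then show ?case
      using eqv_trans[OF eqv_nn[OF eqv_trans[OF eqv_Ex[OF Ex.IH] eqv_Ex_Or]]] by simp
  qed
  moreover have "eqv S (tr \<phi> A) (FOr \<phi> A)" if "\<phi> \<in> Pi_cl (Suc j)"
    using that
  proof (induction arbitrary: A rule: Pi_Suc_induct)
    case (Sigma \<phi>)
    then show ?case using Suc by simp
  next
    case (All \<phi>)
    show ?case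
      using eqv_trans[OF eqv_All[OF All.IH] eqv_All_Or[OF Pi_counterexample]] All.hyps FAll_Pi
        Suc.prems by simp
  qed
  ultimately show ?case by blast
qed

text \<open>The outer universal block is dropped, since free variables of theorems count as
  quantified. What remains is a \<open>\<Sigma>\<close> formula at level
  \<open>n + 1\<close>.\<close>

theorem conservation:
  assumes "prv PA {} \<phi>" "\<phi> \<in> Pi_cl (Suc (Suc n))"
  shows "prv S {} \<phi>"
  using assms(2,1)
proof (induction rule: Pi_Suc_induct)
  case (All \<phi>)
  then show ?case by (simp add: prv_FAll_iff)
next
  case (Sigma \<phi>)
  \<comment> \<open>Above level \<open>n\<close> the disjunction with \<open>A\<close> is no longer
    available, but the relative double negation of \<open>\<phi>\<close> still follows.\<close>
  have "prv S {} (FImp (tr \<phi> A) (nn A \<phi>))" for A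
    using Sigma.hyps
  proof (induction arbitrary: A rule: Sigma_Suc_induct)
    case (Pi \<phi>)
    then have "eqv S (tr \<phi> A) (FOr \<phi> A)" using tr_decidable by blast
    then show ?case
      unfolding eqv_def by (rule prv_mp1) (reify ipc_eqs, rule ipc_prv, code_simp)
  next
    case (Ex \<phi>)
    let ?\<psi> = "tr \<phi> (lift A)"
    let ?\<Gamma> = "insert ?\<psi> (lift ` {FEx ?\<psi>, FImp (FEx \<phi>) A})"
    have "prv S ?\<Gamma> (FImp ?\<psi> (nn (lift A) \<phi>))" by (rule prv_mono[OF Ex.IH]) simp
    moreover have "prv S ?\<Gamma> ?\<psi>" by (simp add: Hyp)
    moreover have "prv S ?\<Gamma> (FImp \<phi> (lift A))"
    proof (rule ImpI, rule ImpE)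
      show "prv S (insert \<phi> ?\<Gamma>) (FImp (lift (FEx \<phi>)) (lift A))" by (simp add: Hyp)
      show "prv S (insert \<phi> ?\<Gamma>) (lift (FEx \<phi>))" by (rule prv_lift_ExI) (simp add: Hyp)
    qed
    ultimately have "prv S ?\<Gamma> (lift A)"
      by (rule prv_mp3) (reify ipc_eqs, rule ipc_prv, code_simp)
    then have "prv S {FEx ?\<psi>, FImp (FEx \<phi>) A} A" by (rule ExE[OF Hyp, rotated]) simp
    then have "prv S {} (FImp (FImp (FEx \<phi>) A) (FImp (FEx ?\<psi>) A))" by (intro ImpI)
    then have "prv S {} (FImp (nn A (FEx ?\<psi>)) (nn A (FEx \<phi>)))"
      by (rule prv_mp1) (reify ipc_eqs, rule ipc_prv, code_simp)
    then show ?case by simp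
  qed
  \<comment> \<open>Friedman's choice of \<open>A\<close> as \<open>\<phi>\<close> itself: the
    outcome \<open>(\<phi> \<longrightarrow> \<phi>) \<longrightarrow> \<phi>\<close> yields
    \<open>\<phi>\<close>. Its free variables are not captured, because \<open>tr\<close> lifts
    \<open>A\<close> under binders.\<close>
  moreover have "prv S {} (tr \<phi> \<phi>)" using tr_PA[OF Sigma.prems, of \<phi>] HA_prv by simp
  ultimately have "prv S {} (nn \<phi> \<phi>)" by (rule ImpE)
  then show ?case by (rule prv_mp1) (reify ipc_eqs, rule ipc_prv, code_simp)
qed

end

subsection \<open>Contracting parameters\<close>

text \<open>Parameters 0 and 1 of \<open>\<sigma>\<close> are merged into one parameter z by
  \<open>\<exists>x y. pair x y = z \<and> \<sigma>(x, y)\<close>. Substituting their pair for z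
  recovers \<open>\<sigma>\<close>, by injectivity.\<close>

lemma pair_two_parameters:
  fixes \<sigma> :: fm
  defines "\<rho> \<equiv> case_nat (Var (Suc 0)) (case_nat (Var 0) (\<lambda>n. Var (Suc (Suc (Suc n)))))"
    and "\<tau> \<equiv> case_nat (pair (Var 0) (Var (Suc 0))) (\<lambda>n. Var (Suc (Suc n)))"
  shows "eqv HA (sub \<tau> (FEx (FEx (FAnd
    (FEq (pair (Var (Suc 0)) (Var 0)) (Var (Suc (Suc 0)))) (sub \<rho> \<sigma>))))) \<sigma>"
proof -
  define \<rho>' where "\<rho>' = case_nat (Var (Suc 0)) (case_nat (Var 0) (\<lambda>n. Var (Suc (Suc (Suc (Suc n))))))"
  let ?E = "FEq (pair (Var (Suc 0)) (Var 0)) (pair (Var (Suc (Suc 0))) (Var (Suc (Suc (Suc 0)))))"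
  let ?X = "FAnd ?E (sub \<rho>' \<sigma>)"
  have "(\<lambda>n. sub_trm (up (up \<tau>)) (\<rho> n)) = \<rho>'"
    by (rule ext) (simp add: \<rho>_def \<rho>'_def \<tau>_def split: nat.split)
  then have eq: "sub \<tau> (FEx (FEx (FAnd
      (FEq (pair (Var (Suc 0)) (Var 0)) (Var (Suc (Suc 0)))) (sub \<rho> \<sigma>)))) = FEx (FEx ?X)"
    by (simp add: \<tau>_def)
  have "eqv HA (FEx (FEx ?X)) \<sigma>"
  proof (rule eqvI)
    let ?\<Gamma> = "insert ?X (lift ` insert (FEx ?X) (lift ` {FEx (FEx ?X)}))"
    have X: "prv HA ?\<Gamma> ?X" by (simp add: Hyp)
    note inj = pair_inj[OF AndE1[OF X]]
    \<comment> \<open>\<open>\<alpha>\<close> puts the first parameter of \<open>\<sigma>\<close> at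
      the hole \<open>Var 0\<close>, and \<open>\<beta>\<close> the second, so that
      \<open>EqSubst\<close> replaces the two bound variables one after the other.\<close>
    define \<alpha> where "\<alpha> = case_nat (Var 0) (case_nat (Var (Suc 0)) (\<lambda>n. Var (Suc (Suc (Suc (Suc (Suc n)))))))"
    define \<beta> where "\<beta> = case_nat (Var (Suc (Suc (Suc 0)))) (case_nat (Var 0) (\<lambda>n. Var (Suc (Suc (Suc (Suc (Suc n)))))))"
    have "(\<lambda>n. sub_trm (case_nat (Var (Suc 0)) Var) (\<alpha> n)) = \<rho>'"
      by (rule ext) (simp add: \<alpha>_def \<rho>'_def split: nat.split)
    then have "inst (sub \<alpha> \<sigma>) (Var (Suc 0)) = sub \<rho>' \<sigma>" by (simp add: inst_def)
    then have "prv HA ?\<Gamma> (inst (sub \<alpha> \<sigma>) (Var (Suc (Suc 0))))"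
      using EqSubst[OF AndE1[OF inj], of "sub \<alpha> \<sigma>"] AndE2[OF X] by simp
    moreover have "(\<lambda>n. sub_trm (case_nat (Var (Suc (Suc 0))) Var) (\<alpha> n)) =
        (\<lambda>n. sub_trm (case_nat (Var 0) Var) (\<beta> n))"
      by (rule ext) (simp add: \<alpha>_def \<beta>_def split: nat.split)
    then have "inst (sub \<alpha> \<sigma>) (Var (Suc (Suc 0))) = inst (sub \<beta> \<sigma>) (Var 0)" by (simp add: inst_def)
    ultimately have "prv HA ?\<Gamma> (inst (sub \<beta> \<sigma>) (Var (Suc (Suc (Suc 0)))))"
      using EqSubst[OF AndE2[OF inj], of "sub \<beta> \<sigma>"] by simp
    moreover have "(\<lambda>n. sub_trm (case_nat (Var (Suc (Suc (Suc 0)))) Var) (\<beta> n)) = (\<lambda>n. Var (Suc (Suc n)))"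
      by (rule ext) (simp add: \<beta>_def split: nat.split)
    then have "inst (sub \<beta> \<sigma>) (Var (Suc (Suc (Suc 0)))) = lift (lift \<sigma>)"
      by (simp add: inst_def lift_def)
    ultimately have "prv HA ?\<Gamma> (lift (lift \<sigma>))" by simp
    then have "prv HA (insert (FEx ?X) (lift ` {FEx (FEx ?X)})) (lift \<sigma>)"
      by (rule ExE[OF Hyp, rotated]) simp
    then show "prv HA {FEx (FEx ?X)} \<sigma>" by (rule ExE[OF Hyp, rotated]) simp
  next
    have "(\<lambda>n. sub_trm (case_nat (Var (Suc 0)) Var) (sub_trm (up (case_nat (Var 0) Var)) (\<rho>' n))) = Var"
      by (rule ext) (simp add: \<rho>'_def split: nat.split)
    then have "prv HA {\<sigma>} (inst (sub (up (case_nat (Var 0) Var)) ?X) (Var (Suc 0)))"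
      by (simp add: inst_def AndI EqRefl Hyp)
    then have "prv HA {\<sigma>} (inst (FEx ?X) (Var 0))"
      by (auto simp: inst_def[of "FEx _"] intro: ExI)
    then show "prv HA {\<sigma>} (FEx (FEx ?X))" by (rule ExI)
  qed
  then show ?thesis using eq by simp
qed

text \<open>Repeated merging of two parameters; the new quantifiers join the leading
  \<open>\<exists>\<close> block, hence the positive level. \<open>t\<close> is the resulting nested
  pair.\<close>

lemma one_parameter:
  assumes "\<sigma> \<in> Sigma_cl (Suc k)"
  obtains \<tau> t where "\<tau> \<in> Sigma_cl (Suc k)" "FV \<tau> \<subseteq> {0}" "eqv HA (sub (\<lambda>_. t) \<tau>) \<sigma>"
proof -
  have "\<exists>\<tau> t. \<tau> \<in> Sigma_cl (Suc k) \<and> FV \<tau> \<subseteq> {0} \<and> eqv HA (sub (\<lambda>_. t) \<tau>) \<sigma>"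
    if "FV \<sigma> \<subseteq> {..<Suc N}" "\<sigma> \<in> Sigma_cl (Suc k)" for N
    using that
  proof (induction N arbitrary: \<sigma>)
    case 0
    then have "FV \<sigma> \<subseteq> {0}" by auto
    then have "sub (\<lambda>_. Var 0) \<sigma> = \<sigma>" using sub_cong[of \<sigma> "\<lambda>_. Var 0" Var] by auto
    then show ?case using 0 \<open>FV \<sigma> \<subseteq> {0}\<close> by (metis eqv_refl)
  next
    case (Suc N)
    define \<rho> where "\<rho> = case_nat (Var (Suc 0)) (case_nat (Var 0) (\<lambda>n. Var (Suc (Suc (Suc n)))))"
    define \<tau>' where "\<tau>' = case_nat (pair (Var 0) (Var (Suc 0))) (\<lambda>n. Var (Suc (Suc n)))"
    let ?E = "FEq (pair (Var (Suc 0)) (Var 0)) (Var (Suc (Suc 0)))"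
    have "?E \<in> Sigma_cl (Suc k)" by (simp add: qf_Sigma)
    then obtain c where c: "c \<in> Sigma_cl (Suc k)" "FV c = FV ?E \<union> FV (sub \<rho> \<sigma>)"
      "eqv HA c (FAnd ?E (sub \<rho> \<sigma>))"
      using Sigma_Pi_And Sigma_sub[OF Suc.prems(2)] by metis
    let ?\<sigma>' = "FEx (FEx c)"
    have "m < Suc N" if "m \<in> FV ?\<sigma>'" for m
    proof -
      have "m = 0 \<or> Suc (Suc m) \<in> FV (sub \<rho> \<sigma>)" using that c(2) by auto
      then show ?thesis
      proof
        assume "Suc (Suc m) \<in> FV (sub \<rho> \<sigma>)"
        then obtain i where i: "i \<in> FV \<sigma>" "Suc (Suc m) \<in> fv_trm (\<rho> i)" by (auto simp: FV_sub)
        then have "i = Suc m" by (auto simp: \<rho>_def split: nat.split_asm)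
        then show ?thesis using i(1) Suc.prems(1) by auto
      qed simp
    qed
    moreover have "?\<sigma>' \<in> Sigma_cl (Suc k)" using c(1) FEx_Sigma by blast
    ultimately obtain \<tau> t where \<tau>: "\<tau> \<in> Sigma_cl (Suc k)" "FV \<tau> \<subseteq> {0}"
      "eqv HA (sub (\<lambda>_. t) \<tau>) ?\<sigma>'"
      using Suc.IH[of ?\<sigma>'] by blast
    have "eqv HA (sub \<tau>' (sub (\<lambda>_. t) \<tau>)) (sub \<tau>' ?\<sigma>')" by (rule eqv_sub[OF \<tau>(3)])
    also have "eqv HA (sub \<tau>' ?\<sigma>') (sub \<tau>' (FEx (FEx (FAnd ?E (sub \<rho> \<sigma>)))))"
      by (rule eqv_sub[OF eqv_Ex[OF eqv_Ex[OF c(3)]]])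
    also have "eqv HA (sub \<tau>' (FEx (FEx (FAnd ?E (sub \<rho> \<sigma>))))) \<sigma>"
      unfolding \<rho>_def \<tau>'_def by (rule pair_two_parameters)
    finally have "eqv HA (sub (\<lambda>_. sub_trm \<tau>' t) \<tau>) \<sigma>" by simp
    then show ?case using \<tau>(1,2) by blast
  qed
  moreover obtain N where "FV \<sigma> \<subseteq> {..<Suc N}"
    using finite_nat_set_iff_bounded[of "FV \<sigma>"] finite_FV[of \<sigma>] by (meson lessThan_iff less_SucI subsetI)
  ultimately show ?thesis using that assms by blast
qed

context HA_extension
begin

text \<open>Theorems are closed under substitution, so \<open>one_parameter\<close> transfers the
  one-variable case. Level 0 has no \<open>\<exists>\<close> block and is settled by
  decidability.\<close>

lemma DNE_parameters:
  assumes "\<And>\<phi>. \<phi> \<in> Sigma_cl n \<Longrightarrow> FV \<phi> \<subseteq> {0} \<Longrightarrow> prv S {} (FImp (FNeg (FNeg \<phi>)) \<phi>)"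
    and "\<sigma> \<in> Sigma_cl n"
  shows "prv S {} (FImp (FNeg (FNeg \<sigma>)) \<sigma>)"
proof (cases n)
  case 0
  then have "prv S {} (FOr \<sigma> (FNeg \<sigma>))" using assms(2) by (simp add: HA_prv qf_decidable)
  then show ?thesis by (rule prv_mp1) (reify ipc_eqs, rule ipc_prv, code_simp)
next
  case (Suc k)
  obtain \<tau> t where \<tau>: "\<tau> \<in> Sigma_cl n" "FV \<tau> \<subseteq> {0}" "eqv HA (sub (\<lambda>_. t) \<tau>) \<sigma>"
    using one_parameter assms(2) Suc by blast
  have *: "eqv S (sub (\<lambda>_. t) \<tau>) \<sigma>" by (rule HA_eqv[OF \<tau>(3)])
  have "prv S {} (FImp (FNeg (FNeg (sub (\<lambda>_. t) \<tau>))) (sub (\<lambda>_. t) \<tau>))"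
    using prv_sub[OF assms(1)[OF \<tau>(1,2)], of "\<lambda>_. t"] by simp
  then show ?thesis by (rule eqvD1[OF eqv_Imp[OF eqv_Neg[OF eqv_Neg[OF *]] *]])
qed

lemma LEM_parameters:
  assumes "\<And>\<phi>. \<phi> \<in> Sigma_cl n \<Longrightarrow> FV \<phi> \<subseteq> {0} \<Longrightarrow> prv S {} (FOr \<phi> (FNeg \<phi>))"
    and "\<sigma> \<in> Sigma_cl n"
  shows "prv S {} (FOr \<sigma> (FNeg \<sigma>))"
proof (cases n)
  case 0
  then show ?thesis using assms(2) by (simp add: HA_prv qf_decidable)
next
  case (Suc k)
  obtain \<tau> t where \<tau>: "\<tau> \<in> Sigma_cl n" "FV \<tau> \<subseteq> {0}" "eqv HA (sub (\<lambda>_. t) \<tau>) \<sigma>"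
    using one_parameter assms(2) Suc by blast
  have *: "eqv S (sub (\<lambda>_. t) \<tau>) \<sigma>" by (rule HA_eqv[OF \<tau>(3)])
  have "prv S {} (FOr (sub (\<lambda>_. t) \<tau>) (FNeg (sub (\<lambda>_. t) \<tau>)))"
    using prv_sub[OF assms(1)[OF \<tau>(1,2)], of "\<lambda>_. t"] by simp
  then show ?thesis by (rule eqvD1[OF eqv_Or[OF * eqv_Neg[OF *]]])
qed

end

subsection \<open>Doubly negated principles\<close>

lemma lift_sentences: "(\<And>\<chi>. \<chi> \<in> D \<Longrightarrow> FV \<chi> = {}) \<Longrightarrow> lift ` D = D"
  by (simp add: lift_def sub_closed)

text \<open>Derivations are finite, and sentences are unchanged by lifting, so the axioms from
  \<open>D\<close> can be moved to the local assumptions even across the rules for bound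
  variables.\<close>

lemma sentences_finitely_used:
  assumes "prv (T \<union> D) \<Gamma> \<phi>" and closed: "\<And>\<chi>. \<chi> \<in> D \<Longrightarrow> FV \<chi> = {}"
  shows "\<exists>F\<subseteq>D. finite F \<and> prv T (\<Gamma> \<union> F) \<phi>"
  using assms(1)
proof (induction rule: prv.induct)
  case (Ax \<phi> \<Gamma>)
  show ?case
  proof (cases "\<phi> \<in> T")
    case True
    then show ?thesis by (intro exI[of _ "{}"]) (simp add: prv.Ax)
  next
    case False
    then show ?thesis using Ax by (intro exI[of _ "{\<phi>}"]) (simp add: prv.Hyp)
  qed
next
  case (Hyp \<phi> \<Gamma>)
  then show ?case by (intro exI[of _ "{}"]) (simp add: prv.Hyp)
next
  case (BotE \<Gamma> \<phi>)
  then show ?case using prv.BotE by metis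
next
  case (ImpI \<phi> \<Gamma> \<psi>)
  then show ?case using prv.ImpI by (metis Un_insert_left)
next
  case (ImpE \<Gamma> \<phi> \<psi>)
  then obtain F G where "F \<subseteq> D" "finite F" "prv T (\<Gamma> \<union> F) (FImp \<phi> \<psi>)"
    "G \<subseteq> D" "finite G" "prv T (\<Gamma> \<union> G) \<phi>" by blast
  moreover from this have "prv T (\<Gamma> \<union> (F \<union> G)) (FImp \<phi> \<psi>)" "prv T (\<Gamma> \<union> (F \<union> G)) \<phi>"
    by (auto elim!: prv_mono)
  ultimately show ?case by (intro exI[of _ "F \<union> G"]) (auto intro: prv.ImpE)
next
  case (AndI \<Gamma> \<phi> \<psi>)
  then obtain F G where "F \<subseteq> D" "finite F" "prv T (\<Gamma> \<union> F) \<phi>"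
    "G \<subseteq> D" "finite G" "prv T (\<Gamma> \<union> G) \<psi>" by blast
  moreover from this have "prv T (\<Gamma> \<union> (F \<union> G)) \<phi>" "prv T (\<Gamma> \<union> (F \<union> G)) \<psi>"
    by (auto elim!: prv_mono)
  ultimately show ?case by (intro exI[of _ "F \<union> G"]) (auto intro: prv.AndI)
next
  case (AndE1 \<Gamma> \<phi> \<psi>)
  then show ?case using prv.AndE1 by metis
next
  case (AndE2 \<Gamma> \<phi> \<psi>)
  then show ?case using prv.AndE2 by metis
next
  case (OrI1 \<Gamma> \<phi> \<psi>)
  then show ?case using prv.OrI1 by metis
next
  case (OrI2 \<Gamma> \<psi> \<phi>)
  then show ?case using prv.OrI2 by metis
next
  case (OrE \<Gamma> \<phi> \<psi> \<chi>)
  then obtain F G H where FGH: "F \<subseteq> D" "finite F" "prv T (\<Gamma> \<union> F) (FOr \<phi> \<psi>)"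
    "G \<subseteq> D" "finite G" "prv T (insert \<phi> \<Gamma> \<union> G) \<chi>"
    "H \<subseteq> D" "finite H" "prv T (insert \<psi> \<Gamma> \<union> H) \<chi>" by blast
  have "prv T (\<Gamma> \<union> (F \<union> G \<union> H)) \<chi>"
    by (rule prv.OrE[OF prv_mono[OF FGH(3)] prv_mono[OF FGH(6)] prv_mono[OF FGH(9)]]) auto
  then show ?case using FGH by (intro exI[of _ "F \<union> G \<union> H"]) auto
next
  case (AllI \<Gamma> \<phi>)
  then obtain F where F: "F \<subseteq> D" "finite F" "prv T (lift ` \<Gamma> \<union> F) \<phi>" by blast
  have "lift ` F = F" by (rule lift_sentences) (use F(1) closed in blast)
  then have "prv T (\<Gamma> \<union> F) (FAll \<phi>)" using prv.AllI[of T "\<Gamma> \<union> F" \<phi>] F(3) by (simp add: image_Un)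
  then show ?case using F(1,2) by blast
next
  case (AllE \<Gamma> \<phi> t)
  then show ?case using prv.AllE by metis
next
  case (ExI \<Gamma> \<phi> t)
  then show ?case using prv.ExI by metis
next
  case (ExE \<Gamma> \<phi> \<psi>)
  then obtain F G where FG: "F \<subseteq> D" "finite F" "prv T (\<Gamma> \<union> F) (FEx \<phi>)"
    "G \<subseteq> D" "finite G" "prv T (insert \<phi> (lift ` \<Gamma>) \<union> G) (lift \<psi>)" by blast
  have "lift ` (F \<union> G) = F \<union> G" by (rule lift_sentences) (use FG closed in blast)
  then have "lift ` (\<Gamma> \<union> (F \<union> G)) = lift ` \<Gamma> \<union> (F \<union> G)" by (simp only: image_Un)
  then have "prv T (\<Gamma> \<union> (F \<union> G)) \<psi>"
    by (intro prv.ExE[OF prv_mono[OF FG(3)] prv_mono[OF FG(6)]]) auto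
  then show ?case using FG by (intro exI[of _ "F \<union> G"]) auto
next
  case (EqRefl \<Gamma> t)
  then show ?case by (intro exI[of _ "{}"]) (simp add: prv.EqRefl)
next
  case (EqSubst \<Gamma> s t \<phi>)
  then obtain F G where FG: "F \<subseteq> D" "finite F" "prv T (\<Gamma> \<union> F) (FEq s t)"
    "G \<subseteq> D" "finite G" "prv T (\<Gamma> \<union> G) (inst \<phi> s)" by blast
  have "prv T (\<Gamma> \<union> (F \<union> G)) (inst \<phi> t)"
    by (rule prv.EqSubst[OF prv_mono[OF FG(3)] prv_mono[OF FG(6)]]) auto
  then show ?case using FG by (intro exI[of _ "F \<union> G"]) auto
qed

text \<open>Against the goal \<open>\<not>\<not>\<phi>\<close> each assumption \<open>\<chi>\<close>
  may be replaced by \<open>\<not>\<not>\<chi>\<close>. This permits arguing from a principle when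
  only its double negation is given.\<close>

lemma prv_nneg_sentences:
  assumes "prv (T \<union> D) {} \<phi>"
    and "\<And>\<chi>. \<chi> \<in> D \<Longrightarrow> FV \<chi> = {}" "\<And>\<chi>. \<chi> \<in> D \<Longrightarrow> prv T {} (FNeg (FNeg \<chi>))"
  shows "prv T {} (FNeg (FNeg \<phi>))"
proof -
  obtain F where F: "F \<subseteq> D" "finite F" "prv T F \<phi>"
    using sentences_finitely_used[OF assms(1,2)] by auto
  have "prv T F (FNeg (FNeg \<phi>)) \<Longrightarrow> F \<subseteq> D \<Longrightarrow> prv T {} (FNeg (FNeg \<phi>))"
    using F(2)
  proof (induction F rule: finite_induct[consumes 1])
    case empty
    then show ?case by simp
  next
    case (insert \<chi> F)
    have "prv T F (FNeg (FNeg \<chi>))" by (rule prv_mono[OF assms(3)]) (use insert.prems in auto)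
    moreover have "prv T F (FImp \<chi> (FNeg (FNeg \<phi>)))" by (rule ImpI) (rule insert.prems(1))
    ultimately have "prv T F (FNeg (FNeg \<phi>))"
      by (rule prv_mp2) (reify ipc_eqs, rule ipc_prv, code_simp)
    then show ?case using insert by blast
  qed
  moreover have "prv T F (FNeg (FNeg \<phi>))"
    using F(3) by (rule prv_mp1) (reify ipc_eqs, rule ipc_prv, code_simp)
  ultimately show ?thesis using F(1) by blast
qed

subsection \<open>The equivalence\<close>

lemma Sigma_E_le_Pi_U_le: "(\<phi> \<in> Sigma_cl k \<longrightarrow> E_le k \<phi>) \<and> (\<phi> \<in> Pi_cl k \<longrightarrow> U_le k \<phi>)"
proof (induction k arbitrary: \<phi>)
  case 0
  then show ?case by (simp add: Alt_qf E_le_def U_le_def)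
next
  case (Suc k)
  have "E_le (Suc k) \<phi>" if "\<phi> \<in> Sigma_cl (Suc k)"
    using that
  proof (induction rule: Sigma_Suc_induct)
    case (Pi \<phi>)
    then show ?case using Suc.IH by (fastforce simp: E_le_def U_le_def)
  next
    case (Ex \<phi>)
    have "length s \<le> k" if "s \<in> Alt \<phi>" "init_sign s \<noteq> Some Plus" for s
      using Ex.IH that by (cases s; cases "hd s") (force simp: E_le_def)+
    then show ?case using Ex.IH by (fastforce simp: E_le_def)
  qed
  moreover have "U_le (Suc k) \<phi>" if "\<phi> \<in> Pi_cl (Suc k)"
    using that
  proof (induction rule: Pi_Suc_induct)
    case (Sigma \<phi>)
    then show ?case using Suc.IH E_le_U_le by blast
  next
    case (All \<phi>)
    have "length s \<le> k" if "s \<in> Alt \<phi>" "init_sign s \<noteq> Some Minus" for s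
      using All.IH that by (cases s; cases "hd s") (force simp: U_le_def)+
    then show ?case using All.IH by (fastforce simp: U_le_def)
  qed
  ultimately show ?case by blast
qed

lemma deg_DNE_instance:
  assumes "\<sigma> \<in> Sigma_cl k"
  shows "deg (FAll (FImp (FNeg (FNeg \<sigma>)) \<sigma>)) \<le> Suc k"
proof -
  have "length s \<le> k" if "s \<in> Alt \<sigma>" for s
    using Sigma_E_le_Pi_U_le assms that by (fastforce simp: E_le_def)
  then have "length s \<le> k" if "s \<in> Alt (FImp (FNeg (FNeg \<sigma>)) \<sigma>)" for s
    using that by (auto split: if_split_asm)
  then have "length s \<le> Suc k" if "s \<in> Alt (FAll (FImp (FNeg (FNeg \<sigma>)) \<sigma>))" for s
    using that by (fastforce simp del: Alt.simps(3))
  then show ?thesis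
    unfolding deg_def by (intro Max.boundedI) (auto simp: finite_Alt Alt_nonempty simp del: Alt.simps)
qed

lemma Alt_All_Minus: "s \<in> Alt (FAll \<phi>) \<Longrightarrow> init_sign s = Some Minus"
  by auto

lemma deg_FAll_pos: "deg (FAll \<phi>) \<noteq> 0"
proof -
  obtain s where s: "s \<in> Alt (FAll \<phi>)" using Alt_nonempty by blast
  then have "s \<noteq> []" using Alt_All_Minus[OF s] by (cases s) auto
  then show ?thesis using length_le_deg[OF s] by (cases s) auto
qed

lemma deg_FNeg: "deg (FNeg \<phi>) = deg \<phi>"
  by (simp add: deg_def image_image)

text \<open>All paths of a universal formula start with \<open>Minus\<close>, so it lies in the
  \<open>U\<close> class of its exact degree, whatever that is.\<close>

lemma FAll_U_cl: "FAll \<phi> \<in> U_cl (deg (FAll \<phi>))"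
  using deg_FAll_pos[of \<phi>] Alt_All_Minus[of _ \<phi>]
  by (cases "deg (FAll \<phi>)") (auto simp: F_cl_def simp del: Alt.simps)

lemma FNeg_FAll_E_cl: "FNeg (FAll \<phi>) \<in> E_cl (deg (FAll \<phi>))"
proof -
  have "init_sign s = Some Plus" if "s \<in> Alt (FNeg (FAll \<phi>))" for s
    using that Alt_All_Minus[of _ \<phi>] by (auto simp del: Alt.simps(6))
  then show ?thesis using deg_FAll_pos[of \<phi>] deg_FNeg[of "FAll \<phi>"]
    by (cases "deg (FAll \<phi>)") (auto simp: F_cl_def simp del: Alt.simps)
qed

section \<open>Removing disjunctions from prenex formulas\<close>

lemma qf_or_free: "qf \<phi> \<Longrightarrow> \<exists>\<psi>. qf \<psi> \<and> or_free \<psi> \<and> FV \<psi> = FV \<phi> \<and> eqv HA \<phi> \<psi>"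
proof (induction \<phi>)
  case (FEq s t)
  then show ?case by (intro exI[of _ "FEq s t"]) simp
next
  case FBot
  then show ?case by (intro exI[of _ FBot]) simp
next
  case (FImp a b)
  then obtain a' b' where "qf a'" "or_free a'" "FV a' = FV a" "eqv HA a a'"
    "qf b'" "or_free b'" "FV b' = FV b" "eqv HA b b'" by auto
  then show ?case by (intro exI[of _ "FImp a' b'"]) (simp add: eqv_Imp)
next
  case (FAnd a b)
  then obtain a' b' where "qf a'" "or_free a'" "FV a' = FV a" "eqv HA a a'"
    "qf b'" "or_free b'" "FV b' = FV b" "eqv HA b b'" by auto
  then show ?case by (intro exI[of _ "FAnd a' b'"]) (simp add: eqv_And)
next
  case (FOr a b)
  then obtain a' b' where *: "qf a'" "or_free a'" "FV a' = FV a" "eqv HA a a'"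
    "qf b'" "or_free b'" "FV b' = FV b" "eqv HA b b'" by auto
  have "eqv HA (FOr a b) (FImp (FNeg a) b)"
    unfolding eqv_def
    by (rule prv_mp1[OF qf_decidable[of a]], use FOr.prems in simp, reify ipc_eqs)
      (rule ipc_prv, code_simp)
  also have "eqv HA (FImp (FNeg a) b) (FImp (FNeg a') b')" using * by (intro eqv_Imp) auto
  finally show ?case using * by (intro exI[of _ "FImp (FNeg a') b'"]) simp
qed simp_all

text \<open>Only the matrix can contain \<open>\<or>\<close>, and there decidability turns
  \<open>a \<or> b\<close> into \<open>\<not> a \<longrightarrow> b\<close>.\<close>

lemma Sigma_Pi_or_free:
  "(\<phi> \<in> Sigma_cl k \<longrightarrow> (\<exists>\<psi>\<in>Sigma_cl k. or_free \<psi> \<and> FV \<psi> = FV \<phi> \<and> eqv HA \<phi> \<psi>)) \<and>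
   (\<phi> \<in> Pi_cl k \<longrightarrow> (\<exists>\<psi>\<in>Pi_cl k. or_free \<psi> \<and> FV \<psi> = FV \<phi> \<and> eqv HA \<phi> \<psi>))"
proof (induction k arbitrary: \<phi>)
  case 0
  then show ?case using qf_or_free[of \<phi>] by simp
next
  case (Suc k)
  have "\<exists>\<psi>\<in>Sigma_cl (Suc k). or_free \<psi> \<and> FV \<psi> = FV \<phi> \<and> eqv HA \<phi> \<psi>"
    if "\<phi> \<in> Sigma_cl (Suc k)"
    using that
  proof (induction rule: Sigma_Suc_induct)
    case (Pi \<phi>)
    then show ?case using Suc.IH Pi_subset_Sigma by metis
  next
    case (Ex \<phi>)
    then obtain \<psi> where "\<psi> \<in> Sigma_cl (Suc k)" "or_free \<psi>" "FV \<psi> = FV \<phi>" "eqv HA \<phi> \<psi>" by blast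
    then show ?case by (intro bexI[of _ "FEx \<psi>"]) (simp_all add: eqv_Ex FEx_Sigma)
  qed
  moreover have "\<exists>\<psi>\<in>Pi_cl (Suc k). or_free \<psi> \<and> FV \<psi> = FV \<phi> \<and> eqv HA \<phi> \<psi>"
    if "\<phi> \<in> Pi_cl (Suc k)"
    using that
  proof (induction rule: Pi_Suc_induct)
    case (Sigma \<phi>)
    then show ?case using Suc.IH Sigma_subset_Pi by metis
  next
    case (All \<phi>)
    then obtain \<psi> where "\<psi> \<in> Pi_cl (Suc k)" "or_free \<psi>" "FV \<psi> = FV \<phi>" "eqv HA \<phi> \<psi>" by blast
    then show ?case by (intro bexI[of _ "FAll \<psi>"]) (simp_all add: eqv_All FAll_Pi)
  qed
  ultimately show ?case by blast
qed

section \<open>Adding instances of principles to a theory\<close>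

lemma FV_DNE: "\<chi> \<in> DNE \<Gamma> \<Longrightarrow> FV \<chi> = {}"
  by (auto simp: DNE_def)

lemma FV_LEM: "\<chi> \<in> LEM \<Gamma> \<Longrightarrow> FV \<chi> = {}"
  by (auto simp: LEM_def)

context HA_extension
begin

lemma extension: "HA_extension (S \<union> D)"
  by unfold_locales (rule prv_theory_mono[OF HA], assumption, simp add: Ax)

lemma DNE_extension: "DNE (Sigma_cl n) \<subseteq> D \<Longrightarrow> DNE_theory (S \<union> D) n"
proof -
  assume D: "DNE (Sigma_cl n) \<subseteq> D"
  interpret SD: HA_extension "S \<union> D" by (rule extension)
  have "prv (S \<union> D) {} (FImp (FNeg (FNeg \<phi>)) \<phi>)" if "\<phi> \<in> Sigma_cl n" "FV \<phi> \<subseteq> {0}" for \<phi>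
  proof -
    have "FAll (FImp (FNeg (FNeg \<phi>)) \<phi>) \<in> DNE (Sigma_cl n)" using that by (auto simp: DNE_def)
    then have "prv (S \<union> D) {} (FAll (FImp (FNeg (FNeg \<phi>)) \<phi>))" using D by (auto intro: Ax)
    then show ?thesis by (simp add: prv_FAll_iff)
  qed
  then show ?thesis
    by unfold_locales (rule SD.DNE_parameters)
qed

text \<open>\<open>LEM\<close> is applied to the \<open>\<Pi>\<close> form of
  \<open>\<not>\<phi>\<close>; the resulting \<open>\<not>\<phi> \<or> \<not>\<not>\<phi>\<close>
  becomes a decision of \<open>\<phi>\<close> by \<open>DNE\<close>.\<close>

lemma LEM_extension:
  assumes "DNE (Sigma_cl n) \<subseteq> D" "LEM (Pi_cl n) \<subseteq> D"
  shows "LEM_theory (S \<union> D) n"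
proof -
  interpret SD: DNE_theory "S \<union> D" n by (rule DNE_extension[OF assms(1)])
  have "prv (S \<union> D) {} (FOr \<phi> (FNeg \<phi>))" if \<phi>: "\<phi> \<in> Sigma_cl n" "FV \<phi> \<subseteq> {0}" for \<phi>
  proof -
    obtain \<pi> where \<pi>: "\<pi> \<in> Pi_cl n" "FV \<pi> = FV \<phi>" "eqv PA (FNeg \<phi>) \<pi>"
      using Sigma_Pi_Neg \<phi>(1) by blast
    have "eqv (S \<union> D) (gg (FNeg \<phi>)) \<pi>"
      using SD.PA_Pi[OF \<pi>(3)] \<pi>(1) Pi_mono[of n "Suc n"] by auto
    then have *: "eqv (S \<union> D) (FNeg \<phi>) \<pi>"
      using eqv_trans[OF eqv_sym[OF eqv_Neg[OF SD.Sigma_gg[OF \<phi>(1)]]]] by simp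
    have "FAll (FOr \<pi> (FNeg \<pi>)) \<in> LEM (Pi_cl n)" using \<pi>(1,2) \<phi>(2) by (auto simp: LEM_def)
    then have "prv (S \<union> D) {} (FAll (FOr \<pi> (FNeg \<pi>)))" using assms(2) by (auto intro: Ax)
    then have "prv (S \<union> D) {} (FOr \<pi> (FNeg \<pi>))" by (simp add: prv_FAll_iff)
    then have "prv (S \<union> D) {} (FOr (FNeg \<phi>) (FNeg (FNeg \<phi>)))"
      by (rule eqvD2[OF eqv_Or[OF * eqv_Neg[OF *]]])
    then show ?thesis using SD.DNE[OF \<phi>(1)]
      by (rule prv_mp2) (reify ipc_eqs, rule ipc_prv, code_simp)
  qed
  then show ?thesis by unfold_locales (rule SD.LEM_parameters)
qed

lemma nneg_DNE_Sigma_0: "\<chi> \<in> DNE (Sigma_cl 0) \<Longrightarrow> prv S {} (FNeg (FNeg \<chi>))"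
proof -
  assume "\<chi> \<in> DNE (Sigma_cl 0)"
  then obtain \<phi> where \<phi>: "qf \<phi>" "\<chi> = FAll (FImp (FNeg (FNeg \<phi>)) \<phi>)" by (auto simp: DNE_def)
  have "prv S {} (FImp (FNeg (FNeg \<phi>)) \<phi>)"
    by (rule prv_mp1[OF HA_prv[OF qf_decidable[OF \<phi>(1)]]], reify ipc_eqs) (rule ipc_prv, code_simp)
  then have "prv S {} \<chi>" by (simp add: \<phi>(2) prv_FAll_iff)
  then show ?thesis by (rule prv_mp1) (reify ipc_eqs, rule ipc_prv, code_simp)
qed

lemma negated_U_prenex:
  assumes "\<And>\<chi>. \<chi> \<in> DNE (Sigma_cl n) \<Longrightarrow> prv S {} (FNeg (FNeg \<chi>))"
    and "or_free (FNeg \<phi>)" "U_le k (FNeg \<phi>)" "k \<le> Suc n"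
  shows "\<exists>\<psi>\<in>nneg (Pi_cl k). FV (FNeg \<phi>) = FV \<psi> \<and> FIff (FNeg \<phi>) \<psi> \<in> theorems S"
proof -
  let ?D = "DNE (Sigma_cl n)"
  interpret SD: DNE_theory "S \<union> ?D" n by (rule DNE_extension) simp
  obtain \<pi> where \<pi>: "\<pi> \<in> Pi_cl k" "FV \<pi> = FV (FNeg \<phi>)" "eqv (S \<union> ?D) (FNeg \<phi>) \<pi>"
    using SD.U_prenex[OF assms(2-4)] by blast
  then have "prv S {} (FNeg (FNeg (FIff (FNeg \<phi>) \<pi>)))"
    unfolding eqv_def using prv_nneg_sentences[of S ?D] FV_DNE assms(1) by blast
  \<comment> \<open>As the left side is already a negation, the outer double negation can be
    absorbed into \<open>\<pi>\<close>.\<close>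
  then have "prv S {} (FIff (FNeg \<phi>) (FNeg (FNeg \<pi>)))"
    by (rule prv_mp1) (reify ipc_eqs, rule ipc_prv, code_simp)
  then show ?thesis using \<pi>(1,2)
    by (intro bexI[of _ "FNeg (FNeg \<pi>)"]) (auto simp: theorems_def nneg_def)
qed

text \<open>\<open>prenex\<close> captures what both statements on normal forms provide. The
  level-\<open>n\<close> principles are added as axioms to apply \<open>conservation\<close> and
  then discharged under a double negation.\<close>

lemma nneg_DNE_Suc:
  assumes PA: "\<And>\<phi>. prv S {} \<phi> \<Longrightarrow> prv PA {} \<phi>"
    and DNE: "\<And>\<chi>. \<chi> \<in> DNE (Sigma_cl n) \<Longrightarrow> prv S {} (FNeg (FNeg \<chi>))"
    and LEM: "\<And>\<chi>. \<chi> \<in> LEM (Pi_cl n) \<Longrightarrow> prv S {} (FNeg (FNeg \<chi>))"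
    and prenex: "\<And>\<theta>. or_free (FAll \<theta>) \<Longrightarrow> deg (FAll \<theta>) \<le> Suc (Suc n) \<Longrightarrow>
      \<exists>\<pi>\<in>Pi_cl (Suc (Suc n)). eqv S (FNeg (FNeg (FAll \<theta>))) (FNeg (FNeg \<pi>))"
    and \<chi>: "\<chi> \<in> DNE (Sigma_cl (Suc n))"
  shows "prv S {} (FNeg (FNeg \<chi>))"
proof -
  obtain \<phi> where \<phi>: "\<phi> \<in> Sigma_cl (Suc n)" "\<chi> = FAll (FImp (FNeg (FNeg \<phi>)) \<phi>)"
    using \<chi> by (auto simp: DNE_def)
  \<comment> \<open>Normal forms are supplied only for formulas without \<open>\<or>\<close>, so the
    given instance is first rewritten.\<close>
  obtain \<sigma> where \<sigma>: "\<sigma> \<in> Sigma_cl (Suc n)" "or_free \<sigma>" "eqv HA \<phi> \<sigma>"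
    using Sigma_Pi_or_free \<phi>(1) by blast
  let ?\<theta> = "FAll (FImp (FNeg (FNeg \<sigma>)) \<sigma>)"
  let ?D = "DNE (Sigma_cl n) \<union> LEM (Pi_cl n)"
  have \<theta>: "eqv S \<chi> ?\<theta>"
    unfolding \<phi>(2) using HA_eqv[OF \<sigma>(3)] by (intro eqv_All eqv_Imp eqv_Neg)
  obtain \<pi> where \<pi>: "\<pi> \<in> Pi_cl (Suc (Suc n))" "eqv S (FNeg (FNeg ?\<theta>)) (FNeg (FNeg \<pi>))"
    using prenex[OF _ deg_DNE_instance[OF \<sigma>(1)]] \<sigma>(2) by auto
  have "prv PA {} ?\<theta>" by (simp add: prv_FAll_iff PA_DNE)
  then have "prv PA {} (FNeg (FNeg ?\<theta>))"
    by (rule prv_mp1) (reify ipc_eqs, rule ipc_prv, code_simp)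
  \<comment> \<open>Theorems of \<open>S\<close> hold classically, so \<open>\<pi>\<close> inherits
    provability in \<open>PA\<close> from the instance of \<open>DNE\<close>.\<close>
  moreover have "eqv PA (FNeg (FNeg ?\<theta>)) (FNeg (FNeg \<pi>))"
    using PA \<pi>(2) unfolding eqv_def by blast
  ultimately have "prv PA {} \<pi>" using eqvD1 PA_Neg_Neg by blast
  interpret SD: LEM_theory "S \<union> ?D" n by (rule LEM_extension) auto
  have "prv (S \<union> ?D) {} \<pi>" by (rule SD.conservation[OF \<open>prv PA {} \<pi>\<close> \<pi>(1)])
  then have "prv S {} (FNeg (FNeg \<pi>))"
    by (rule prv_nneg_sentences) (use FV_DNE FV_LEM DNE LEM in blast)+
  then have "prv S {} (FNeg (FNeg ?\<theta>))" by (rule eqvD2[OF \<pi>(2)])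
  then show ?thesis by (rule eqvD2[OF eqv_Neg[OF eqv_Neg[OF \<theta>]]])
qed

end

theorem theorem7p19:
  fixes k :: nat and T :: "fm set"
  assumes "in_between (HA \<union> nneg (LEM_Pi (int k - 2))) PA T"
  defines "stmt1 \<equiv> \<forall>k'\<le>k. PNFT T (or_free_part (neg (E_cl k'))) (nneg (Pi_cl k'))"
    and "stmt2 \<equiv> \<forall>k'\<le>k. PNFT T (or_free_part (nneg (U_cl k'))) (nneg (Pi_cl k'))"
    and "stmt3 \<equiv> proves T (nneg (DNE_Sigma (int k - 1)))"
  shows "(stmt1 \<longleftrightarrow> stmt2) \<and> (stmt2 \<longleftrightarrow> stmt3) \<and> (stmt1 \<longleftrightarrow> stmt3)"
proof -
  have T: "prv T {} \<phi>" if "\<phi> \<in> HA \<union> nneg (LEM_Pi (int k - 2))" for \<phi>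
    using assms(1) Ax[OF that] by (auto simp: in_between_def theorems_def)
  have T_PA: "prv PA {} \<phi>" if "prv T {} \<phi>" for \<phi>
    using assms(1) that by (auto simp: in_between_def theorems_def)
  interpret HA_extension T by unfold_locales (use T in blast)
  have LEM: "prv T {} (FNeg (FNeg \<chi>))" if "\<chi> \<in> LEM (Pi_cl m)" "Suc (Suc m) \<le> k" for \<chi> m
  proof -
    have "Pi_cl m \<subseteq> Pi_cl (nat (int k - 2))" by (rule Pi_mono) (use that(2) in simp)
    then have "\<chi> \<in> LEM_Pi (int k - 2)" using that by (auto simp: LEM_Pi_def LEM_def)
    then show ?thesis using T by (auto simp: nneg_def)
  qed
  have forward: "PNFT T (or_free_part (neg (E_cl k'))) (nneg (Pi_cl k'))"
    "PNFT T (or_free_part (nneg (U_cl k'))) (nneg (Pi_cl k'))" if stmt3 "k' \<le> k" for k'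
  proof -
    \<comment> \<open>Subtraction is truncated: for \<open>k\<close> zero this is \<open>DNE\<close>
      at level 0, a consequence of decidability, while \<open>stmt3\<close> is then vacuous.\<close>
    have DNE: "prv T {} (FNeg (FNeg \<chi>))" if "\<chi> \<in> DNE (Sigma_cl (k - 1))" for \<chi>
    proof (cases k)
      case 0
      then show ?thesis using that nneg_DNE_Sigma_0 by simp
    next
      case (Suc n)
      then show ?thesis using that \<open>stmt3\<close>
        by (auto simp: stmt3_def proves_def theorems_def nneg_def DNE_Sigma_def)
    qed
    have k': "k' \<le> Suc (k - 1)" using that(2) by simp
    \<comment> \<open>Both classes consist of negations satisfying \<open>U_le k'\<close>, so one
      argument serves for both.\<close>
    have *: "\<exists>\<psi>\<in>nneg (Pi_cl k'). FV \<phi> = FV \<psi> \<and> FIff \<phi> \<psi> \<in> theorems T"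
      if "or_free \<phi>" "U_le k' \<phi>" "\<phi> = FNeg \<rho>" for \<phi> \<rho>
      using negated_U_prenex[OF DNE _ _ k', of \<rho>] that by simp
    show "PNFT T (or_free_part (neg (E_cl k'))) (nneg (Pi_cl k'))"
      unfolding PNFT_def or_free_part_def neg_def
      using * U_le_Neg E_cl_E_le by blast
    show "PNFT T (or_free_part (nneg (U_cl k'))) (nneg (Pi_cl k'))"
      unfolding PNFT_def or_free_part_def nneg_def[of "U_cl k'"]
      using * U_le_Neg E_le_Neg U_cl_U_le by blast
  qed
  have backward: stmt3 if "stmt1 \<or> stmt2"
  proof -
    have prenex: "\<exists>\<pi>\<in>Pi_cl m. eqv T (FNeg (FNeg (FAll \<theta>))) (FNeg (FNeg \<pi>))"
      if or: "or_free (FAll \<theta>)" and deg: "deg (FAll \<theta>) \<le> m" and "m \<le> k" for \<theta> m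
    proof -
      \<comment> \<open>The exact degree may be smaller than \<open>m\<close>; normal forms are
        therefore taken at level \<open>?d\<close>, using that they are given for all levels up to
        \<open>k\<close>.\<close>
      let ?d = "deg (FAll \<theta>)"
      have "FNeg (FNeg (FAll \<theta>)) \<in> or_free_part (neg (E_cl ?d))"
        using or FNeg_FAll_E_cl[of \<theta>] by (auto simp: or_free_part_def neg_def)
      moreover have "FNeg (FNeg (FAll \<theta>)) \<in> or_free_part (nneg (U_cl ?d))"
        using or FAll_U_cl[of \<theta>] by (auto simp: or_free_part_def nneg_def)
      moreover have "?d \<le> k" using deg \<open>m \<le> k\<close> by simp
      ultimately obtain \<psi> where "\<psi> \<in> nneg (Pi_cl ?d)" "FIff (FNeg (FNeg (FAll \<theta>))) \<psi> \<in> theorems T"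
        using \<open>stmt1 \<or> stmt2\<close> unfolding stmt1_def stmt2_def PNFT_def by metis
      moreover have "Pi_cl ?d \<subseteq> Pi_cl m" using deg by (rule Pi_mono)
      ultimately show ?thesis by (auto simp: nneg_def eqv_def theorems_def)
    qed
    \<comment> \<open>Induction on the level: the step to \<open>Suc m\<close> uses the double
      negations of \<open>DNE\<close> and \<open>LEM\<close> at level \<open>m\<close>, the latter
      available because \<open>Suc (Suc m) \<le> k\<close>.\<close>
    have DNE: "prv T {} (FNeg (FNeg \<chi>))" if "m < k" "\<chi> \<in> DNE (Sigma_cl m)" for \<chi> m
      using that
    proof (induction m arbitrary: \<chi>)
      case 0
      then show ?case using nneg_DNE_Sigma_0 by simp
    next
      case (Suc m)
      show ?case
      proof (rule nneg_DNE_Suc[OF T_PA _ _ _ Suc.prems(2)])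
        show "prv T {} (FNeg (FNeg \<chi>))" if "\<chi> \<in> DNE (Sigma_cl m)" for \<chi>
          using Suc.IH Suc.prems(1) that by simp
        show "prv T {} (FNeg (FNeg \<chi>))" if "\<chi> \<in> LEM (Pi_cl m)" for \<chi>
          using LEM that Suc.prems(1) by simp
        show "\<exists>\<pi>\<in>Pi_cl (Suc (Suc m)). eqv T (FNeg (FNeg (FAll \<theta>))) (FNeg (FNeg \<pi>))"
          if "or_free (FAll \<theta>)" "deg (FAll \<theta>) \<le> Suc (Suc m)" for \<theta>
          using prenex[OF that] Suc.prems(1) by simp
      qed
    qed
    show ?thesis
      using DNE[of "nat (int k - 1)"]
      by (auto simp: stmt3_def proves_def theorems_def nneg_def DNE_Sigma_def)
  qed
  have "stmt1" "stmt2" if stmt3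
    using forward[OF that] unfolding stmt1_def stmt2_def by blast+
  then show ?thesis using backward by blast
qed

end
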